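(* Let $(E,\tau,M,\rho)$ be a Lie algebroid, $p,q\in\mathbb{Z}$, $P\in A^p(M,E)$, $Q\in A^q(M,E)$. 1. The graded bracket of the Lie derivative $\mathcal{L}_\rho(P)$ and the exterior derivative $d_\rho$ vanishes identically: $$\bigl[\mathcal{L}_\rho(P),d_\rho\bigr]=\mathcal{L}_\rho(P)\circ d_\rho-(-1)^{p-1}d_\rho\circ\mathcal{L}_\rho(P)=0.$$ 2. The graded bracket of the Lie derivatives $\mathcal{L}_\rho(P)$ and $\mathcal{L}_\rho(Q)$ is equal to the Lie derivative $\mathcal{L}_\rho\bigl([P,Q]\bigr)$: $$\bigl[\mathcal{L}_\rho(P),\mathcal{L}_\rho(Q)\bigr]=\mathcal{L}_\rho(P)\circ\mathcal{L}_\rho(Q)-(-1)^{(p-1)(q-1)}\mathcal{L}_\rho(Q)\circ\mathcal{L}_\rho(P)=\mathcal{L}_\rho\bigl([P,Q]\bigr),$$ where $[P,Q]$ is the Schouten-Nijenhuis bracket of $P$ and $Q$.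
   Context: A Lie algebroid $(E,\tau,M,\rho)$ is a smooth real vector bundle $(E,\tau,M)$ of finite rank over a smooth manifold $M$ (with projection $\tau:E\to M$), equipped with a Lie algebra bracket $(s_1,s_2)\mapsto\{s_1,s_2\}$ on the space of smooth sections of $\tau$ and a smooth vector bundle map $\rho:E\to TM$ (the anchor), such that $s\mapsto\rho\circ s$ is a Lie algebra homomorphism into the Lie algebra of smooth vector fields on $M$, and $\{s_1,fs_2\}=f\{s_1,s_2\}+\langle df,\rho\circ s_1\rangle s_2$ for all smooth sections $s_1,s_2$ and all $f\in C^\infty(M,\mathbb{R})$. For $p\in\mathbb{Z}$, $A^p(M,E)$ is the space of smooth sections of $\bigwedge^pE$ and $\Omega^p(M,E)$ the space of smooth sections of $\bigwedge^pE^*$, with degree-$0$ parts equal to $C^\infty(M,\mathbb{R})$ and zero for $p<0$; $A(M,E)=\oplus_pA^p(M,E)$, $\Omega(M,E)=\oplus_p\Omega^p(M,E)$. An element of $\Omega^p(M,E)$ is identified with a skew-symmetric $C^\infty(M,\mathbb{R})$-multilinear map $A^1(M,E)^p\to C^\infty(M,\mathbb{R})$. Interior product: for $V\in A^1(M,E)$ and $\eta\in\Omega^p(M,E)$, $i(V)\eta=0$ if $p\le0$ and $i(V)\eta(V_1,\ldots,V_{p-1})=\eta(V,V_1,\ldots,V_{p-1})$ if $p\ge1$. For $f\in A^0(M,E)$, $i(f)\eta=f\eta$; for $p\ge1$, $i(P_1\wedge\cdots\wedge P_p)=i(P_1)\circ\cdots\circ i(P_p)$ with $P_j\in A^1(M,E)$;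 extended by linearity to $A(M,E)$. $d_\rho:\Omega(M,E)\to\Omega(M,E)$ is the $\mathbb{R}$-linear, degree $1$ map with $\langle d_\rho f,V\rangle=\langle df,\rho\circ V\rangle$ for functions $f$ and, for $\eta\in\Omega^p(M,E)$, $p\ge1$, $d_\rho\eta(V_0,\ldots,V_p)=\sum_{i=0}^p(-1)^i\langle d(\eta(V_0,\ldots,\widehat{V}_i,\ldots,V_p)),\rho\circ V_i\rangle+\sum_{0\le i<j\le p}(-1)^{i+j}\eta(\{V_i,V_j\},V_0,\ldots,\widehat{V}_i,\ldots,\widehat{V}_j,\ldots,V_p)$ (hats denote omitted terms). The graded bracket of two homogeneous linear endomorphisms $F,G$ of degrees $d_1,d_2$ is $[F,G]=F\circ G-(-1)^{d_1d_2}G\circ F$. For $P\in A^p(M,E)$, the Lie derivative with respect to $P$ is the graded endomorphism of $\Omega(M,E)$ of degree $1-p$ given by $\mathcal{L}_\rho(P)=[i(P),d_\rho]=i(P)\circ d_\rho-(-1)^pd_\rho\circ i(P)$. The Schouten-Nijenhuis bracket of $P\in A^p(M,E)$ and $Q\in A^q(M,E)$ is the unique $[P,Q]\in A^{p+q-1}(M,E)$ such that $i([P,Q])=\bigl[[i(P),d_\rho],i(Q)\bigr]$ as endomorphisms of $\Omega(M,E)$. *)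

theory Defs
  imports "HOL-Analysis.Analysis" "HOL-Library.Function_Algebras"
begin

section \<open>Functions into a real vector space\<close>

instantiation "fun" :: (type, real_vector) real_vector
begin

definition scaleR_fun_def: "c *\<^sub>R f = (\<lambda>x. c *\<^sub>R f x)"

instance
  by standard (simp_all add: scaleR_fun_def fun_eq_iff scaleR_add_right scaleR_add_left)

end

lemma scaleR_fun_apply [simp]: "(c *\<^sub>R f) x = c *\<^sub>R f x"
  by (simp add: scaleR_fun_def)


section \<open>Smooth manifolds\<close>

primrec Ck_on :: "nat \<Rightarrow> 'a::real_normed_vector set \<Rightarrow> ('a \<Rightarrow> 'c::real_normed_vector) \<Rightarrow> bool" where
  "Ck_on 0 S f \<longleftrightarrow> continuous_on S f"
| "Ck_on (Suc k) S f \<longleftrightarrow> (\<forall>x\<in>S. f differentiable (at x)) \<and>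
     (\<forall>v. Ck_on k S (\<lambda>x. frechet_derivative f (at x) v))"

text \<open>Only used for open sets of finite-dimensional spaces, where having all iterated
  directional derivatives continuous is the same as being infinitely differentiable.\<close>

definition smooth_on :: "'a::real_normed_vector set \<Rightarrow> ('a \<Rightarrow> 'c::real_normed_vector) \<Rightarrow> bool" where
  "smooth_on S f \<longleftrightarrow> (\<forall>k. Ck_on k S f)"

text \<open>The underlying topological space of a manifold is a second countable Hausdorff type
  \<open>'m\<close>. The model space \<open>'b\<close> ranges over \<open>{real_inner, heine_borel}\<close>: by Riesz's theorem these
  are exactly the finite-dimensional Euclidean spaces. Unlike the class \<open>euclidean_space\<close>, this
  does not exclude dimension \<open>0\<close>. A chart is a pair of its domain and its coordinate map.\<close>

type_synonym ('m, 'b) atlas = "('m set \<times> ('m \<Rightarrow> 'b)) set"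

definition smooth_manifold ::
    "('m::{t2_space, second_countable_topology}, 'b::{real_inner, heine_borel}) atlas \<Rightarrow> bool" where
  "smooth_manifold At \<longleftrightarrow>
     (\<Union>(W, \<phi>)\<in>At. W) = UNIV \<and>
     (\<forall>(W, \<phi>)\<in>At. open W \<and> open (\<phi> ` W) \<and> homeomorphism W (\<phi> ` W) \<phi> (inv_into W \<phi>)) \<and>
     (\<forall>(W, \<phi>)\<in>At. \<forall>(W', \<phi>')\<in>At. smooth_on (\<phi> ` (W \<inter> W')) (\<phi>' \<circ> inv_into W \<phi>))"

definition msmooth :: "('m::topological_space, 'b::real_normed_vector) atlas \<Rightarrow> 'm set \<Rightarrow>
    ('m \<Rightarrow> 'c::real_normed_vector) \<Rightarrow> bool" where
  "msmooth At U g \<longleftrightarrow> (\<forall>(W, \<phi>)\<in>At. smooth_on (\<phi> ` (W \<inter> U)) (g \<circ> inv_into W \<phi>))"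

definition smooth_functions :: "('m::topological_space, 'b::real_normed_vector) atlas \<Rightarrow> ('m \<Rightarrow> real) set" where
  "smooth_functions At = {f. msmooth At UNIV f}"


section \<open>Smooth vector bundles\<close>

text \<open>The fibres are subspaces of one ambient real vector space \<open>'v\<close>, which carries no other
  structure; the total space is \<open>SIGMA x:UNIV. fibre E x\<close> with projection \<open>fst\<close>. The smooth
  structure is given by a vector bundle atlas: an element \<open>(U, \<theta>)\<close> of \<open>frames E\<close> is the inverse of
  a local trivialisation over \<open>U\<close>, so that \<open>\<theta> x\<close> is an isomorphism from the model fibre \<open>'f\<close> onto
  the fibre over \<open>x\<close>.\<close>

record ('m, 'v, 'f) vbundle =
  fibre :: "'m \<Rightarrow> 'v set"
  frames :: "('m set \<times> ('m \<Rightarrow> 'f \<Rightarrow> 'v)) set"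

text \<open>In the last condition below, the transition function applied to the constant vector \<open>w\<close> is
  \<open>g\<close>. As the model fibre is finite-dimensional, smoothness for every \<open>w\<close> is smoothness of the
  transition function as a map into the linear group. The same remark applies to the smoothness
  of bundle maps.\<close>

definition smooth_vector_bundle ::
    "('m::topological_space, 'b::real_normed_vector) atlas \<Rightarrow>
     ('m, 'v::real_vector, 'f::{real_inner, heine_borel}) vbundle \<Rightarrow> bool" where
  "smooth_vector_bundle At E \<longleftrightarrow>
     (\<forall>x. subspace (fibre E x)) \<and>
     (\<Union>(U, \<theta>)\<in>frames E. U) = UNIV \<and>
     (\<forall>(U, \<theta>)\<in>frames E. open U \<and> (\<forall>x\<in>U. linear (\<theta> x) \<and> bij_betw (\<theta> x) UNIV (fibre E x))) \<and>
     (\<forall>(U, \<theta>)\<in>frames E. \<forall>(U', \<theta>')\<in>frames E. \<forall>w. \<exists>g.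
        msmooth At (U \<inter> U') g \<and> (\<forall>x\<in>U \<inter> U'. \<theta> x w = \<theta>' x (g x)))"

definition smooth_sections ::
    "('m::topological_space, 'b::real_normed_vector) atlas \<Rightarrow>
     ('m, 'v, 'f::real_normed_vector) vbundle \<Rightarrow> ('m \<Rightarrow> 'v) set" where
  "smooth_sections At E = {s. (\<forall>x. s x \<in> fibre E x) \<and>
     (\<forall>(U, \<theta>)\<in>frames E. \<exists>g. msmooth At U g \<and> (\<forall>x\<in>U. s x = \<theta> x (g x)))}"

definition smooth_bundle_map ::
    "('m::topological_space, 'b::real_normed_vector) atlas \<Rightarrow>
     ('m, 'v::real_vector, 'f) vbundle \<Rightarrow>
     ('m, 'w::real_vector, 'g::real_normed_vector) vbundle \<Rightarrow> ('m \<Rightarrow> 'v \<Rightarrow> 'w) \<Rightarrow> bool" where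
  "smooth_bundle_map At E F h \<longleftrightarrow>
     (\<forall>x. \<forall>v\<in>fibre E x. h x v \<in> fibre F x) \<and>
     (\<forall>x a b. \<forall>v\<in>fibre E x. \<forall>w\<in>fibre E x.
        h x (a *\<^sub>R v + b *\<^sub>R w) = a *\<^sub>R h x v + b *\<^sub>R h x w) \<and>
     (\<forall>(U, \<theta>)\<in>frames E. \<forall>(U', \<theta>')\<in>frames F. \<forall>w. \<exists>g.
        msmooth At (U \<inter> U') g \<and> (\<forall>x\<in>U \<inter> U'. h x (\<theta> x w) = \<theta>' x (g x)))"

text \<open>Tangent vectors are derivations of the algebra of smooth functions at a point, extended by
  zero to functions that are not smooth so that equality of derivations is equality in HOL.
  Hence the pairing of \<open>df\<close> with a tangent vector \<open>D\<close> is \<open>D f\<close>.\<close>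

definition tangent_space ::
    "('m::topological_space, 'b::real_normed_vector) atlas \<Rightarrow> 'm \<Rightarrow> (('m \<Rightarrow> real) \<Rightarrow> real) set" where
  "tangent_space At x = {D.
     (\<forall>f\<in>smooth_functions At. \<forall>g\<in>smooth_functions At. \<forall>a b.
        D (a *\<^sub>R f + b *\<^sub>R g) = a * D f + b * D g) \<and>
     (\<forall>f\<in>smooth_functions At. \<forall>g\<in>smooth_functions At. D (f * g) = f x * D g + g x * D f) \<and>
     (\<forall>f. f \<notin> smooth_functions At \<longrightarrow> D f = 0)}"

definition chart_vector ::
    "('m::topological_space, 'b::real_normed_vector) atlas \<Rightarrow> 'm set \<Rightarrow> ('m \<Rightarrow> 'b) \<Rightarrow>
     'm \<Rightarrow> 'b \<Rightarrow> ('m \<Rightarrow> real) \<Rightarrow> real" where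
  "chart_vector At W \<phi> x v = (\<lambda>f. if f \<in> smooth_functions At
     then frechet_derivative (f \<circ> inv_into W \<phi>) (at (\<phi> x)) v else 0)"

definition tangent_bundle ::
    "('m::topological_space, 'b::real_normed_vector) atlas \<Rightarrow> ('m, ('m \<Rightarrow> real) \<Rightarrow> real, 'b) vbundle" where
  "tangent_bundle At =
     \<lparr>fibre = tangent_space At, frames = (\<lambda>(W, \<phi>). (W, chart_vector At W \<phi>)) ` At\<rparr>"

definition vector_field_bracket ::
    "('m::topological_space, 'b::real_normed_vector) atlas \<Rightarrow> ('m \<Rightarrow> ('m \<Rightarrow> real) \<Rightarrow> real) \<Rightarrow>
     ('m \<Rightarrow> ('m \<Rightarrow> real) \<Rightarrow> real) \<Rightarrow> 'm \<Rightarrow> ('m \<Rightarrow> real) \<Rightarrow> real" where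
  "vector_field_bracket At X Y x f = (if f \<in> smooth_functions At
     then X x (\<lambda>y. Y y f) - Y x (\<lambda>y. X y f) else 0)"


section \<open>Lie algebroids\<close>

text \<open>Only the values of the bracket on smooth sections and of the anchor on the fibres matter.\<close>

record ('m, 'b, 'v, 'f) algebroid =
  base :: "('m, 'b) atlas"
  vec_bundle :: "('m, 'v, 'f) vbundle"
  bracket :: "('m \<Rightarrow> 'v) \<Rightarrow> ('m \<Rightarrow> 'v) \<Rightarrow> ('m \<Rightarrow> 'v)"
  anchor :: "'m \<Rightarrow> 'v \<Rightarrow> ('m \<Rightarrow> real) \<Rightarrow> real"

abbreviation sections ::
    "('m::topological_space, 'b::real_normed_vector, 'v, 'f::real_normed_vector) algebroid \<Rightarrow> ('m \<Rightarrow> 'v) set" where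
  "sections L \<equiv> smooth_sections (base L) (vec_bundle L)"

abbreviation afibre :: "('m, 'b, 'v, 'f) algebroid \<Rightarrow> 'm \<Rightarrow> 'v set" where
  "afibre L \<equiv> fibre (vec_bundle L)"

definition lie_bracket_on :: "'s::real_vector set \<Rightarrow> ('s \<Rightarrow> 's \<Rightarrow> 's) \<Rightarrow> bool" where
  "lie_bracket_on S br \<longleftrightarrow>
     (\<forall>s\<in>S. \<forall>t\<in>S. br s t \<in> S) \<and>
     (\<forall>s\<in>S. \<forall>t\<in>S. \<forall>u\<in>S. \<forall>a b. br (a *\<^sub>R s + b *\<^sub>R t) u = a *\<^sub>R br s u + b *\<^sub>R br t u) \<and>
     (\<forall>s\<in>S. \<forall>t\<in>S. \<forall>u\<in>S. \<forall>a b. br u (a *\<^sub>R s + b *\<^sub>R t) = a *\<^sub>R br u s + b *\<^sub>R br u t) \<and>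
     (\<forall>s\<in>S. br s s = 0) \<and>
     (\<forall>s\<in>S. \<forall>t\<in>S. \<forall>u\<in>S. br s (br t u) + br t (br u s) + br u (br s t) = 0)"

definition lie_algebroid ::
    "('m::{t2_space, second_countable_topology}, 'b::{real_inner, heine_borel},
      'v::real_vector, 'f::{real_inner, heine_borel}) algebroid \<Rightarrow> bool" where
  "lie_algebroid L \<longleftrightarrow>
     smooth_manifold (base L) \<and>
     smooth_vector_bundle (base L) (vec_bundle L) \<and>
     lie_bracket_on (sections L) (bracket L) \<and>
     smooth_bundle_map (base L) (vec_bundle L) (tangent_bundle (base L)) (anchor L) \<and>
     (\<forall>s\<in>sections L. \<forall>t\<in>sections L. (\<lambda>x. anchor L x (bracket L s t x)) =
        vector_field_bracket (base L) (\<lambda>x. anchor L x (s x)) (\<lambda>x. anchor L x (t x))) \<and>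
     (\<forall>s\<in>sections L. \<forall>t\<in>sections L. \<forall>f\<in>smooth_functions (base L).
        bracket L s (\<lambda>x. f x *\<^sub>R t x) =
        (\<lambda>x. f x *\<^sub>R bracket L s t x + anchor L x (s x) f *\<^sub>R t x))"


section \<open>Exterior powers, forms and multivectors\<close>

text \<open>Tuples of vectors are lists. A function on lists can be regarded as having one component for
  each list length; the component in degree \<open>p\<close> is its restriction to lists of length \<open>p\<close>.
  Degrees are integers, and everything of negative degree vanishes since no list has negative
  length.\<close>

definition alternating_on :: "'v::real_vector set \<Rightarrow> int \<Rightarrow> ('v list \<Rightarrow> real) \<Rightarrow> bool" where
  "alternating_on S p \<omega> \<longleftrightarrow>
     (\<forall>us vs v w a b. set us \<subseteq> S \<and> set vs \<subseteq> S \<and> v \<in> S \<and> w \<in> S \<and>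
        int (length us + length vs + 1) = p \<longrightarrow>
        \<omega> (us @ (a *\<^sub>R v + b *\<^sub>R w) # vs) = a * \<omega> (us @ v # vs) + b * \<omega> (us @ w # vs)) \<and>
     (\<forall>us vs ws v w. set us \<subseteq> S \<and> set vs \<subseteq> S \<and> set ws \<subseteq> S \<and> v \<in> S \<and> w \<in> S \<and>
        int (length us + length vs + length ws + 2) = p \<longrightarrow>
        \<omega> (us @ v # vs @ w # ws) = - \<omega> (us @ w # vs @ v # ws))"

text \<open>The wedge product of the vectors \<open>v\<^sub>1, \<dots>, v\<^sub>p\<close> of \<open>S\<close> is realised as the evaluation
  functional on the space of alternating \<open>p\<close>-linear forms on \<open>S\<close>, and the exterior power as the
  span of these functionals in the dual of that space. Functionals are extended by zero to
  functions that are not alternating \<open>p\<close>-linear.\<close>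

definition wedge :: "'v::real_vector set \<Rightarrow> 'v list \<Rightarrow> ('v list \<Rightarrow> real) \<Rightarrow> real" where
  "wedge S vs = (\<lambda>\<omega>. if alternating_on S (int (length vs)) \<omega> then \<omega> vs else 0)"

definition exterior_power :: "'v::real_vector set \<Rightarrow> int \<Rightarrow> (('v list \<Rightarrow> real) \<Rightarrow> real) set" where
  "exterior_power S p = span (wedge S ` {vs. set vs \<subseteq> S \<and> int (length vs) = p})"

text \<open>Smooth sections of the exterior powers of \<open>E\<close> are the sections that are, over the domain of
  each trivialisation, linear combinations with smooth coefficients of the wedge products of the
  local sections \<open>\<lambda>x. \<theta> x w\<close>.\<close>

definition multivectors ::
    "('m::topological_space, 'b::real_normed_vector, 'v::real_vector, 'f::real_normed_vector) algebroid \<Rightarrow>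
     int \<Rightarrow> ('m \<Rightarrow> ('v list \<Rightarrow> real) \<Rightarrow> real) set" where
  "multivectors L p = {P. (\<forall>x. P x \<in> exterior_power (afibre L x) p) \<and>
     (\<forall>(U, \<theta>)\<in>frames (vec_bundle L). \<exists>T c. finite T \<and>
        (\<forall>ws\<in>T. int (length ws) = p \<and> msmooth (base L) U (c ws)) \<and>
        (\<forall>x\<in>U. P x = (\<Sum>ws\<in>T. c ws x *\<^sub>R wedge (afibre L x) (map (\<theta> x) ws))))}"

text \<open>Forms of degree \<open>p\<close> are smooth sections of the bundle of alternating \<open>p\<close>-linear forms on the
  fibres, extended by zero to all lists. Hence distinct degrees have disjoint supports, and the
  direct sum over all degrees is an internal one.\<close>

definition forms ::
    "('m::topological_space, 'b::real_normed_vector, 'v::real_vector, 'f::real_normed_vector) algebroid \<Rightarrow>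
     int \<Rightarrow> ('m \<Rightarrow> 'v list \<Rightarrow> real) set" where
  "forms L p = {\<eta>. (\<forall>x. alternating_on (afibre L x) p (\<eta> x)) \<and>
     (\<forall>x vs. \<not> (set vs \<subseteq> afibre L x \<and> int (length vs) = p) \<longrightarrow> \<eta> x vs = 0) \<and>
     (\<forall>(U, \<theta>)\<in>frames (vec_bundle L). \<forall>ws. int (length ws) = p \<longrightarrow>
        msmooth (base L) U (\<lambda>x. \<eta> x (map (\<theta> x) ws)))}"

definition Omega ::
    "('m::topological_space, 'b::real_normed_vector, 'v::real_vector, 'f::real_normed_vector) algebroid \<Rightarrow>
     ('m \<Rightarrow> 'v list \<Rightarrow> real) set" where
  "Omega L = span (\<Union>p. forms L p)"

definition eval_form :: "('m \<Rightarrow> 'v list \<Rightarrow> real) \<Rightarrow> ('m \<Rightarrow> 'v) list \<Rightarrow> 'm \<Rightarrow> real" where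
  "eval_form \<eta> Vs = (\<lambda>x. \<eta> x (map (\<lambda>V. V x) Vs))"


section \<open>Interior product, exterior derivative and brackets\<close>

definition contract :: "'v \<Rightarrow> ('v list \<Rightarrow> real) \<Rightarrow> ('v list \<Rightarrow> real)" where
  "contract v \<omega> = (\<lambda>vs. \<omega> (v # vs))"

text \<open>The linear extension of \<open>i(v\<^sub>1 \<and> \<dots> \<and> v\<^sub>p) = i(v\<^sub>1) \<circ> \<dots> \<circ> i(v\<^sub>p)\<close>: for fixed \<open>\<omega>\<close> and \<open>vs\<close>,
  the value of the right-hand side is an alternating form in the vectors \<open>v\<^sub>1, \<dots>, v\<^sub>p\<close>, to which the
  functional \<open>P x\<close> is applied. See \<open>interior_decomposable\<close> below.\<close>

definition interior ::
    "('m \<Rightarrow> ('v list \<Rightarrow> real) \<Rightarrow> real) \<Rightarrow> ('m \<Rightarrow> 'v list \<Rightarrow> real) \<Rightarrow> ('m \<Rightarrow> 'v list \<Rightarrow> real)" where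
  "interior P \<eta> = (\<lambda>x vs. P x (\<lambda>us. foldr contract us (\<eta> x) vs))"

definition omit :: "nat \<Rightarrow> 'a list \<Rightarrow> 'a list" where
  "omit i xs = take i xs @ drop (Suc i) xs"

definition cartan_formula ::
    "('m, 'b, 'v, 'f) algebroid \<Rightarrow> ('m \<Rightarrow> 'v list \<Rightarrow> real) \<Rightarrow> ('m \<Rightarrow> 'v) list \<Rightarrow> 'm \<Rightarrow> real" where
  "cartan_formula L \<eta> Vs x =
     (\<Sum>i<length Vs. (-1) ^ i * anchor L x ((Vs ! i) x) (eval_form \<eta> (omit i Vs))) +
     (\<Sum>j<length Vs. \<Sum>i<j. (-1) ^ (i + j) *
        eval_form \<eta> (bracket L (Vs ! i) (Vs ! j) # omit i (omit j Vs)) x)"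

text \<open>For a list of \<open>p + 1\<close> sections, the formula only involves the component of \<open>\<eta>\<close> in degree
  \<open>p\<close>, so it is used for all of \<open>Omega L\<close> at once. The derivative has no component in degree \<open>0\<close>.\<close>

definition exterior_derivative ::
    "('m::topological_space, 'b::real_normed_vector, 'v::real_vector, 'f::real_normed_vector) algebroid \<Rightarrow>
     ('m \<Rightarrow> 'v list \<Rightarrow> real) \<Rightarrow> ('m \<Rightarrow> 'v list \<Rightarrow> real)" where
  "exterior_derivative L \<eta> = (THE \<zeta>. \<zeta> \<in> Omega L \<and> (\<forall>x. \<zeta> x [] = 0) \<and>
     (\<forall>Vs. Vs \<noteq> [] \<and> set Vs \<subseteq> sections L \<longrightarrow> eval_form \<zeta> Vs = cartan_formula L \<eta> Vs))"

definition graded_bracket ::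
    "int \<Rightarrow> int \<Rightarrow> ('w::real_vector \<Rightarrow> 'w) \<Rightarrow> ('w \<Rightarrow> 'w) \<Rightarrow> ('w \<Rightarrow> 'w)" where
  "graded_bracket d1 d2 F G = (\<lambda>\<eta>. F (G \<eta>) - ((-1) powi (d1 * d2)) *\<^sub>R G (F \<eta>))"

text \<open>The degree \<open>p\<close> of \<open>P\<close> is an argument, since the zero multivector belongs to every degree.\<close>

definition lie_derivative ::
    "('m::topological_space, 'b::real_normed_vector, 'v::real_vector, 'f::real_normed_vector) algebroid \<Rightarrow>
     int \<Rightarrow> ('m \<Rightarrow> ('v list \<Rightarrow> real) \<Rightarrow> real) \<Rightarrow> ('m \<Rightarrow> 'v list \<Rightarrow> real) \<Rightarrow> ('m \<Rightarrow> 'v list \<Rightarrow> real)" where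
  "lie_derivative L p P = graded_bracket (- p) 1 (interior P) (exterior_derivative L)"

definition schouten_bracket ::
    "('m::topological_space, 'b::real_normed_vector, 'v::real_vector, 'f::real_normed_vector) algebroid \<Rightarrow>
     int \<Rightarrow> ('m \<Rightarrow> ('v list \<Rightarrow> real) \<Rightarrow> real) \<Rightarrow> int \<Rightarrow> ('m \<Rightarrow> ('v list \<Rightarrow> real) \<Rightarrow> real) \<Rightarrow>
     'm \<Rightarrow> ('v list \<Rightarrow> real) \<Rightarrow> real" where
  "schouten_bracket L p P q Q = (THE R. R \<in> multivectors L (p + q - 1) \<and>
     (\<forall>\<eta>\<in>Omega L. interior R \<eta> =
        graded_bracket (1 - p) (- q)
          (graded_bracket (- p) 1 (interior P) (exterior_derivative L)) (interior Q) \<eta>))"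


section \<open>Agreement of the interior product with its defining properties\<close>

lemma foldr_contract: "foldr contract us \<omega> vs = \<omega> (rev us @ vs)"
  by (induction us arbitrary: vs) (simp_all add: contract_def)

lemma alternating_on_combination:
  assumes "alternating_on S p \<omega>" and "alternating_on S p \<omega>'"
  shows "alternating_on S p (\<lambda>us. c * \<omega> us + \<omega>' us)"
  unfolding alternating_on_def
proof (intro conjI allI impI, goal_cases)
  case (1 us vs v w a b)
  note assms[unfolded alternating_on_def, THEN conjunct1, rule_format, OF 1]
  then show ?case by (simp only: algebra_simps)
next
  case (2 us vs ws v w)
  note assms[unfolded alternating_on_def, THEN conjunct2, rule_format, OF 2]
  then show ?case by (simp only: algebra_simps minus_add_distrib mult_minus_right)
qed

lemma alternating_on_contracted:
  assumes "\<eta> \<in> Omega L"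
  shows "alternating_on (afibre L x) p (\<lambda>us. foldr contract us (\<eta> x) vs)"
  using assms unfolding Omega_def
proof (induction rule: span_induct_alt)
  case base
  then show ?case by (simp add: alternating_on_def foldr_contract)
next
  case (step c \<eta> \<zeta>)
  then obtain k where \<eta>: "\<eta> \<in> forms L k" by blast
  let ?S = "afibre L x"
  have alt: "alternating_on ?S k (\<eta> x)"
    and supp: "\<And>us. \<not> (set us \<subseteq> ?S \<and> int (length us) = k) \<Longrightarrow> \<eta> x us = 0"
    using \<eta> by (auto simp: forms_def)
  have "alternating_on ?S p (\<lambda>us. \<eta> x (rev us @ vs))"
  proof (cases "set vs \<subseteq> ?S \<and> int (length vs) + p = k")
    case False
    then have zero: "\<eta> x us = 0" if "int (length us) = p + int (length vs)" "set vs \<subseteq> set us" for us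
      using that by (intro supp) auto
    show ?thesis unfolding alternating_on_def
    proof (intro conjI allI impI, goal_cases)
      case (1 us ws v w a b)
      then have "\<eta> x (rev (us @ u # ws) @ vs) = 0" for u
        by (intro zero) auto
      then show ?case by (simp del: rev_append)
    next
      case (2 us ws zs v w)
      then have "\<eta> x (rev (us @ u # ws @ u' # zs) @ vs) = 0" for u u'
        by (intro zero) auto
      then show ?case by (simp del: rev_append)
    qed
  next
    case True
    show ?thesis unfolding alternating_on_def
    proof (intro conjI allI impI, goal_cases)
      case (1 us ws v w a b)
      then have "\<eta> x (rev ws @ (a *\<^sub>R v + b *\<^sub>R w) # (rev us @ vs)) =
          a * \<eta> x (rev ws @ v # (rev us @ vs)) + b * \<eta> x (rev ws @ w # (rev us @ vs))"
        using True by (intro alt[unfolded alternating_on_def, THEN conjunct1, rule_format]) simp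
      then show ?case by simp
    next
      case (2 us ws zs v w)
      then have "\<eta> x (rev zs @ w # rev ws @ v # (rev us @ vs)) =
          - \<eta> x (rev zs @ v # rev ws @ w # (rev us @ vs))"
        using True by (intro alt[unfolded alternating_on_def, THEN conjunct2, rule_format]) simp
      then show ?case by simp
    qed
  qed
  then have "alternating_on ?S p (\<lambda>us. c * \<eta> x (rev us @ vs) + \<zeta> x (rev us @ vs))"
    using step(2) by (intro alternating_on_combination) (simp_all add: foldr_contract)
  then show ?case by (simp add: foldr_contract)
qed

lemma interior_decomposable:
  assumes "\<eta> \<in> Omega L"
  shows "interior (\<lambda>x. f x *\<^sub>R wedge (afibre L x) (map (\<lambda>V. V x) Vs)) \<eta> =
    (\<lambda>x. f x *\<^sub>R foldr (\<lambda>V \<zeta> x. contract (V x) (\<zeta> x)) Vs \<eta> x)"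
proof -
  have "foldr contract (map (\<lambda>V. V x) Vs) (\<eta> x) = foldr (\<lambda>V \<zeta> x. contract (V x) (\<zeta> x)) Vs \<eta> x" for x
    by (induction Vs) auto
  then show ?thesis
    using alternating_on_contracted[OF assms]
    by (simp add: interior_def wedge_def fun_eq_iff)
qed

lemma interior_add: "interior (P + Q) \<eta> = interior P \<eta> + interior Q \<eta>"
  by (simp add: interior_def fun_eq_iff)

end

theory Submission
  imports Defs
begin

text \<open>Cartan's calculus is set up for function-multilinear alternating maps on lists of
  sections, where \<open>d\<close> and \<open>L(V)\<close> can be defined by recursion on the list; \<open>L(V) = [i(V), d]\<close> then
  holds by definition and \<open>[L(V), i(W)] = i({V, W})\<close>, \<open>[L(V), L(W)] = L({V, W})\<close>, \<open>[L(V), d] = 0\<close> and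
  \<open>d \<circ> d = 0\<close> follow by induction. Bump functions and local frames identify these maps with
  forms, so that \<open>d\<close> is well defined.

  For the existence of \<open>[P, Q]\<close>: near a point, \<open>i(P)\<close> and \<open>i(Q)\<close> are operators generated by
  multiplications with functions and interior products with global sections. By the derivation
  properties of the graded bracket, \<open>[[i(P), d], i(Q)]\<close> again is, near that point, such an operator,
  hence at each point it is the contraction with an element of the exterior power. Evaluating on a
  dual family of local frames shows that this element varies smoothly. Both claims are then formal
  consequences of \<open>d \<circ> d = 0\<close> and the graded Jacobi identity.\<close>

section \<open>Smooth functions on open sets\<close>

text \<open>The obstacle is that \<open>exterior_derivative\<close> and
  \<open>schouten_bracket\<close> are definite descriptions: nothing can be computed before
  existence and uniqueness are settled inside \<open>Omega L\<close> and
  \<open>multivectors L k\<close>. For \<open>d\<close> this requires that the alternating sum,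
  which differentiates its arguments, is nevertheless linear over functions; only then is it the
  evaluation of a form. For the bracket, [[i(P), d], i(Q)] contains \<open>d\<close> and could be a
  differential operator; that it has order zero is the real content. A multivector field is a
  combination of wedge products only locally, so the order-zero property is proved for an
  inductively generated algebra of operators and transferred by locality of \<open>d\<close>. The
  generators are global sections because \<open>d\<close> and the algebroid bracket act on global
  objects only; bump functions make a local frame look global near a point. Dual families stand in
  for bases of the exterior powers, since only the reconstruction of a form from finitely many
  values is needed.\<close>

lemma Ck_on_derivative:
  assumes "Ck_on (Suc k) S f" "x \<in> S"
  shows "(f has_derivative frechet_derivative f (at x)) (at x)"
  using assms frechet_derivative_works by auto

text \<open>The derivative at a point depends on the germ there, which \<open>f\<close> and
  \<open>g\<close> share because \<open>S\<close> is open.\<close>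

lemma Ck_on_cong:
  assumes "open S" "\<And>x. x \<in> S \<Longrightarrow> f x = g x" "Ck_on k S f"
  shows "Ck_on k S g"
  using assms(2,3)
proof (induction k arbitrary: f g)
  case 0
  then show ?case using continuous_on_cong by (metis Ck_on.simps(1))
next
  case (Suc k)
  have *: "(g has_derivative frechet_derivative f (at x)) (at x)" if "x \<in> S" for x
    using has_derivative_transform_within_open[OF Ck_on_derivative assms(1) that] Suc.prems that by blast
  then have eq: "frechet_derivative g (at x) = frechet_derivative f (at x)" if "x \<in> S" for x
    using frechet_derivative_at[OF *[OF that]] by simp
  have "Ck_on k S (\<lambda>x. frechet_derivative g (at x) v)" for v
    by (rule Suc.IH[of "\<lambda>x. frechet_derivative f (at x) v"]) (use Suc.prems eq in simp_all)
  then show ?case using * by (auto simp: differentiable_def)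
qed

text \<open>The product and chain rules deliver some derivative \<open>f'\<close>, not the term
  \<open>frechet_derivative f (at x)\<close> of the definition; uniqueness of derivatives bridges
  the two.\<close>

lemma Ck_on_SucI:
  assumes "open S" "\<And>x. x \<in> S \<Longrightarrow> (f has_derivative f' x) (at x)"
    "\<And>v. Ck_on k S (\<lambda>x. f' x v)"
  shows "Ck_on (Suc k) S f"
proof -
  have "frechet_derivative f (at x) = f' x" if "x \<in> S" for x
    using frechet_derivative_at[OF assms(2)[OF that]] by simp
  then have "Ck_on k S (\<lambda>x. frechet_derivative f (at x) v)" for v
    by (intro Ck_on_cong[OF assms(1) _ assms(3)[of v]]) auto
  then show ?thesis using assms(2) by (auto simp: differentiable_def)
qed

lemma Ck_on_local:
  assumes "\<And>x. x \<in> S \<Longrightarrow> \<exists>T. open T \<and> x \<in> T \<and> Ck_on k T f"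
  shows "Ck_on k S f"
  using assms
proof (induction k arbitrary: f)
  case 0
  then show ?case
    by (metis Ck_on.simps(1) continuous_on_eq_continuous_at continuous_at_imp_continuous_on)
next
  case (Suc k)
  then show ?case by (metis Ck_on.simps(2))
qed

lemma Ck_on_subset: "Ck_on k S f \<Longrightarrow> T \<subseteq> S \<Longrightarrow> Ck_on k T f"
  by (induction k arbitrary: f) (auto intro: continuous_on_subset)

lemma Ck_on_lower: "Ck_on (Suc k) S f \<Longrightarrow> Ck_on k S f"
proof (induction k arbitrary: f)
  case 0
  then show ?case
    by (auto intro!: continuous_at_imp_continuous_on differentiable_imp_continuous_within)
next
  case (Suc k)
  then show ?case by (metis Ck_on.simps(2))
qed

lemma Ck_on_const: "Ck_on k S (\<lambda>x. c)"
  by (induction k arbitrary: c) auto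

lemma Ck_on_add:
  assumes "open S" "Ck_on k S f" "Ck_on k S g"
  shows "Ck_on k S (\<lambda>x. f x + g x)"
  using assms(2,3)
proof (induction k arbitrary: f g)
  case 0
  then show ?case by (simp add: continuous_on_add)
next
  case (Suc k)
  show ?case
  proof (rule Ck_on_SucI[OF assms(1) has_derivative_add[OF Ck_on_derivative Ck_on_derivative]])
    show "Ck_on k S (\<lambda>x. frechet_derivative f (at x) v + frechet_derivative g (at x) v)" for v
      by (intro Suc.IH) (use Suc.prems in auto)
  qed (use Suc.prems in auto)
qed

lemma Ck_on_bilinear:
  assumes "bounded_bilinear pr" "open S" "Ck_on k S f" "Ck_on k S g"
  shows "Ck_on k S (\<lambda>x. pr (f x) (g x))"
  using assms(3,4)
proof (induction k arbitrary: f g)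
  case 0
  then show ?case by (simp add: bounded_bilinear.continuous_on[OF assms(1)])
next
  case (Suc k)
  note low = Suc.prems[THEN Ck_on_lower]
  show ?case
  proof (rule Ck_on_SucI[OF assms(2) bounded_bilinear.FDERIV[OF assms(1) Ck_on_derivative Ck_on_derivative]])
    show "Ck_on k S (\<lambda>x. pr (f x) (frechet_derivative g (at x) v) + pr (frechet_derivative f (at x) v) (g x))" for v
      by (intro Ck_on_add assms(2) Suc.IH low) (use Suc.prems in auto)
  qed (use Suc.prems in auto)
qed

text \<open>On the real line the derivative of \<psi> is multiplication by its value at 1, so the
  chain rule yields a product. The induction is general in \<psi>, whose derivative becomes the next
  outer function.\<close>

lemma Ck_on_real_compose:
  fixes \<psi> :: "real \<Rightarrow> real"
  assumes "open S" "Ck_on k UNIV \<psi>" "Ck_on k S f"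
  shows "Ck_on k S (\<lambda>x. \<psi> (f x))"
  using assms(2,3)
proof (induction k arbitrary: f \<psi>)
  case 0
  then show ?case using continuous_on_compose2[of UNIV \<psi> S f] by simp
next
  case (Suc k)
  have "((\<lambda>x. \<psi> (f x)) has_derivative
      (\<lambda>v. frechet_derivative f (at x) v * frechet_derivative \<psi> (at (f x)) 1)) (at x)" if "x \<in> S" for x
  proof -
    have d: "(\<psi> has_derivative frechet_derivative \<psi> (at (f x))) (at (f x))"
      using Suc.prems by (intro Ck_on_derivative) auto
    then have "frechet_derivative \<psi> (at (f x)) c = c * frechet_derivative \<psi> (at (f x)) 1" for c
      using linear_scale[OF has_derivative_linear[OF d], of c 1] by simp
    then have "(\<lambda>v. frechet_derivative \<psi> (at (f x)) (frechet_derivative f (at x) v)) =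
        (\<lambda>v. frechet_derivative f (at x) v * frechet_derivative \<psi> (at (f x)) 1)"
      by blast
    then show ?thesis
      using has_derivative_compose[OF Ck_on_derivative[OF Suc.prems(2) that] d] by simp
  qed
  moreover have "Ck_on k S (\<lambda>x. frechet_derivative f (at x) v * frechet_derivative \<psi> (at (f x)) 1)" for v
  proof (rule Ck_on_bilinear[OF bounded_bilinear_mult assms(1)])
    show "Ck_on k S (\<lambda>x. frechet_derivative f (at x) v)"
      using Suc.prems by auto
    show "Ck_on k S (\<lambda>x. frechet_derivative \<psi> (at (f x)) 1)"
      by (rule Suc.IH[OF _ Ck_on_lower[OF Suc.prems(2)]]) (use Suc.prems in auto)
  qed
  ultimately show ?case
    by (intro Ck_on_SucI[OF assms(1), where f' = "\<lambda>x v. frechet_derivative f (at x) v * frechet_derivative \<psi> (at (f x)) 1"])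
qed

lemma smooth_on_cong: "open S \<Longrightarrow> (\<And>x. x \<in> S \<Longrightarrow> f x = g x) \<Longrightarrow> smooth_on S f \<Longrightarrow> smooth_on S g"
  unfolding smooth_on_def by (intro allI Ck_on_cong[of S f g]) auto

lemma smooth_on_subset: "smooth_on S f \<Longrightarrow> T \<subseteq> S \<Longrightarrow> smooth_on T f"
  unfolding smooth_on_def using Ck_on_subset[of _ S f T] by auto

lemma smooth_on_local:
  "(\<And>x. x \<in> S \<Longrightarrow> \<exists>T. open T \<and> x \<in> T \<and> smooth_on T f) \<Longrightarrow> smooth_on S f"
  unfolding smooth_on_def by (intro allI Ck_on_local) blast

lemma smooth_on_const: "smooth_on S (\<lambda>x. c)"
  unfolding smooth_on_def by (intro allI Ck_on_const)

lemma smooth_on_add: "open S \<Longrightarrow> smooth_on S f \<Longrightarrow> smooth_on S g \<Longrightarrow> smooth_on S (\<lambda>x. f x + g x)"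
  unfolding smooth_on_def by (intro allI Ck_on_add[of S _ f g]) auto

lemma smooth_on_bilinear:
  "bounded_bilinear pr \<Longrightarrow> open S \<Longrightarrow> smooth_on S f \<Longrightarrow> smooth_on S g \<Longrightarrow> smooth_on S (\<lambda>x. pr (f x) (g x))"
  unfolding smooth_on_def by (intro allI Ck_on_bilinear[of pr S _ f g]) auto

lemma smooth_on_real_compose:
  "open S \<Longrightarrow> smooth_on UNIV (\<psi>::real \<Rightarrow> real) \<Longrightarrow> smooth_on S f \<Longrightarrow> smooth_on S (\<lambda>x. \<psi> (f x))"
  unfolding smooth_on_def by (intro allI Ck_on_real_compose[of S _ \<psi> f]) auto

lemma smooth_on_sum:
  assumes "open S" "\<And>i. i \<in> I \<Longrightarrow> smooth_on S (f i)"
  shows "smooth_on S (\<lambda>x. \<Sum>i\<in>I. f i x)"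
  using assms by (induction I rule: infinite_finite_induct) (auto intro: smooth_on_const smooth_on_add[of S "f _"])

lemma smooth_on_derivative:
  assumes "smooth_on S f"
  shows "smooth_on S (\<lambda>x. frechet_derivative f (at x) v)"
  using assms unfolding smooth_on_def by (metis Ck_on.simps(2))

lemma smooth_on_differentiable: "smooth_on S f \<Longrightarrow> x \<in> S \<Longrightarrow> f differentiable (at x)"
  unfolding smooth_on_def by (metis Ck_on.simps(2))

text \<open>The classical flat functions \<open>t\<^sup>-\<^sup>n exp (-1/t)\<close>; the family is closed under differentiation up
  to linear combinations, which gives smoothness by induction on the order.\<close>

definition flat :: "nat \<Rightarrow> real \<Rightarrow> real" where
  "flat n t = (if t > 0 then inverse t ^ n / exp (inverse t) else 0)"

text \<open>From the right, the substitution of \<open>inverse t\<close> turns this into the decay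
  of a power against the exponential at infinity.\<close>

lemma flat_tendsto: "(flat n \<longlongrightarrow> 0) (at 0)"
proof -
  have "((\<lambda>t::real. inverse t ^ n / exp (inverse t)) \<longlongrightarrow> 0) (at_right 0)"
    using filterlim_compose[OF tendsto_power_div_exp_0 filterlim_inverse_at_top_right] .
  then have "(flat n \<longlongrightarrow> 0) (at_right 0)"
    by (rule Lim_transform_eventually) (auto simp: flat_def eventually_at_right_less eventually_at_filter)
  moreover have "(flat n \<longlongrightarrow> 0) (at_left 0)"
    by (rule Lim_transform_eventually[OF tendsto_const]) (auto simp: flat_def eventually_at_filter)
  ultimately show ?thesis by (simp add: filterlim_split_at)
qed

lemma flat_has_derivative:
  "(flat n has_real_derivative flat (n + 2) t + (- real n) * flat (n + 1) t) (at t)"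
proof -
  consider "t < 0" | "t = 0" | "t > 0" by linarith
  then show ?thesis
  proof cases
    case 1
    have "(flat n has_real_derivative 0) (at t)"
      by (rule has_field_derivative_transform_within_open[where S = "{..<0}", OF DERIV_const[of 0]])
        (use 1 in \<open>auto simp: flat_def\<close>)
    then show ?thesis using 1 by (simp add: flat_def)
  next
    case 2
    \<comment> \<open>As \<open>flat n 0 = 0\<close>, this is the difference quotient at 0; off 0 it
      equals \<open>flat (n + 1) h\<close>.\<close>
    have "((\<lambda>h. flat n h / h) \<longlongrightarrow> 0) (at 0)"
      by (rule Lim_transform_eventually[OF flat_tendsto[of "n + 1"]])
        (auto simp: flat_def divide_inverse eventually_at_filter)
    then show ?thesis using 2 by (simp add: DERIV_def flat_def)
  next
    case 3
    have "((\<lambda>t. inverse t ^ n) has_real_derivative - real n * inverse t ^ (n + 1)) (at t)"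
      using DERIV_power[OF DERIV_inverse[of t], of n] 3 by (cases n) (simp_all add: algebra_simps)
    moreover have "((\<lambda>t. exp (- inverse t)) has_real_derivative exp (- inverse t) * inverse t ^ 2) (at t)"
      using 3 by (auto intro!: derivative_eq_intros simp: power2_eq_square)
    ultimately have "((\<lambda>t. inverse t ^ n * exp (- inverse t)) has_real_derivative
        flat (n + 2) t + (- real n) * flat (n + 1) t) (at t)"
      by (rule DERIV_cong[OF DERIV_mult])
        (use 3 in \<open>simp add: flat_def exp_minus divide_inverse algebra_simps power2_eq_square\<close>)
    then have "((\<lambda>t::real. inverse t ^ n / exp (inverse t)) has_real_derivative
        flat (n + 2) t + (- real n) * flat (n + 1) t) (at t)"
      by (simp add: exp_minus divide_inverse)
    then show ?thesis
      by (rule has_field_derivative_transform_within_open[where S = "{0<..}"])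
        (use 3 in \<open>auto simp: flat_def\<close>)
  qed
qed

lemma smooth_on_flat: "smooth_on UNIV (flat n)"
  unfolding smooth_on_def
proof
  fix k
  show "Ck_on k UNIV (flat n)"
  proof (induction k arbitrary: n)
    case 0
    then show ?case
      by (auto intro!: continuous_at_imp_continuous_on DERIV_isCont flat_has_derivative)
  next
    case (Suc k)
    show ?case
      by (rule Ck_on_SucI[OF open_UNIV flat_has_derivative[unfolded has_field_derivative_def]])
        (intro Ck_on_bilinear[OF bounded_bilinear_mult] Ck_on_add Ck_on_const Suc open_UNIV)
  qed
qed

lemma smooth_cutoff:
  obtains \<psi> :: "real \<Rightarrow> real"
  where "smooth_on UNIV \<psi>" "\<And>t. t \<le> 0 \<Longrightarrow> \<psi> t = 1" "\<And>t. t \<ge> 1 \<Longrightarrow> \<psi> t = 0"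
proof
  \<comment> \<open>\<open>exp (-1)\<close> is \<open>flat 0 1\<close>, so the argument of the outer
    \<open>flat 0\<close> is at most 0 from t = 1 on, and equal to \<open>exp (-1)\<close> for t
    \<le> 0. Only a constant is inverted, which avoids smoothness of quotients such as f(t) / (f(t)
    + f(1 - t)).\<close>
  let ?\<psi> = "\<lambda>t. inverse (flat 0 (exp (-1))) * flat 0 (exp (-1) + (-1) * flat 0 t)"
  show "smooth_on UNIV ?\<psi>"
    by (intro smooth_on_bilinear[OF bounded_bilinear_mult] smooth_on_const open_UNIV
        smooth_on_real_compose[OF _ smooth_on_flat] smooth_on_add smooth_on_flat)
  show "?\<psi> t = 1" if "t \<le> 0" for t
    using that by (simp add: flat_def)
  show "?\<psi> t = 0" if "t \<ge> 1" for t
  proof -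
    have "exp (- 1) \<le> exp (- inverse t)"
      using that by (simp add: inverse_le_1_iff)
    also have "\<dots> = flat 0 t"
      using that by (simp add: flat_def exp_minus inverse_eq_divide)
    finally have "exp (- 1) \<le> flat 0 t" .
    then show ?thesis by (simp add: flat_def)
  qed
qed

text \<open>In a space with compact closed balls, a ball is covered by finitely many balls of radius
  \<open>1/2\<close>, so orthonormal families, whose members are at distance \<open>sqrt 2\<close>, have bounded size.\<close>

lemma finite_orthonormal_basis:
  obtains B :: "'a::{real_inner, heine_borel} set"
  where "finite B" "\<And>x. x = (\<Sum>b\<in>B. (x \<bullet> b) *\<^sub>R b)"
proof -
  let ?on = "\<lambda>A::'a set. finite A \<and> (\<forall>a\<in>A. \<forall>b\<in>A. a \<bullet> b = (if a = b then 1 else 0))"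
  have "cball (0::'a) 1 \<subseteq> (\<Union>k\<in>UNIV. ball k (1/2))"
  proof
    show "x \<in> (\<Union>k\<in>UNIV. ball k (1/2))" for x :: 'a
      by (rule UN_I[of x]) auto
  qed
  then obtain K :: "'a set" where K: "finite K" "cball 0 1 \<subseteq> (\<Union>k\<in>K. ball k (1/2))"
    using compactE_image[OF compact_cball[of "0::'a" 1], of UNIV "\<lambda>k. ball k (1/2)"]
    by (metis open_ball)
  have bound: "card A < Suc (card K)" if "?on A" for A
  proof -
    have "\<exists>k\<in>K. a \<in> ball k (1/2)" if "a \<in> A" for a
    proof -
      have "norm a = 1" using \<open>?on A\<close> that by (simp add: norm_eq_sqrt_inner)
      then show ?thesis using K(2) by (auto simp: subset_iff)
    qed
    then obtain \<kappa> where \<kappa>: "\<And>a. a \<in> A \<Longrightarrow> \<kappa> a \<in> K" "\<And>a. a \<in> A \<Longrightarrow> a \<in> ball (\<kappa> a) (1/2)"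
      by metis
    have "inj_on \<kappa> A"
    proof (rule inj_onI, rule ccontr)
      fix a b assume ab: "a \<in> A" "b \<in> A" "\<kappa> a = \<kappa> b" "a \<noteq> b"
      have "dist a b < 1"
        using \<kappa>(2)[OF ab(1)] \<kappa>(2)[OF ab(2)] ab(3) by (metis dist_commute dist_triangle_half_r mem_ball)
      then have "norm (a - b) ^ 2 < 1" by (simp add: dist_norm power_less_one_iff abs_square_less_1)
      moreover have "norm (a - b) ^ 2 = 2"
        using \<open>?on A\<close> ab by (simp add: power2_norm_eq_inner inner_diff)
      ultimately show False by simp
    qed
    then show ?thesis using \<kappa>(1) K(1) by (metis card_inj_on_le image_subsetI less_Suc_eq_le)
  qed
  have "?on {}" by simp
  then obtain B where B: "?on B" "\<And>A. ?on A \<Longrightarrow> card A \<le> card B"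
    using ex_has_greatest_nat[of ?on "{}" card "Suc (card K)"] bound by blast
  show thesis
  proof
    show "finite B" using B by simp
    fix x
    \<comment> \<open>\<open>y\<close> is orthogonal to \<open>B\<close>; were it nonzero, its
      normalisation would enlarge the family of maximal size.\<close>
    define y where "y = x - (\<Sum>b\<in>B. (x \<bullet> b) *\<^sub>R b)"
    have orth: "y \<bullet> c = 0" if "c \<in> B" for c
    proof -
      have "(\<Sum>b\<in>B. (x \<bullet> b) * (b \<bullet> c)) = (\<Sum>b\<in>B. if b = c then x \<bullet> b else 0)"
        using B(1) that by (intro sum.cong) auto
      then show ?thesis using B(1) that by (simp add: y_def inner_diff_left inner_sum_left)
    qed
    show "x = (\<Sum>b\<in>B. (x \<bullet> b) *\<^sub>R b)"
    proof (rule ccontr)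
      assume "\<not> ?thesis"
      then have "y \<noteq> 0" by (simp add: y_def)
      define u where "u = inverse (norm y) *\<^sub>R y"
      have "u \<bullet> u = 1" using \<open>y \<noteq> 0\<close>
        by (simp add: u_def dot_square_norm power2_eq_square divide_simps)
      moreover have "u \<bullet> c = 0" "c \<bullet> u = 0" if "c \<in> B" for c
        using orth[OF that] by (auto simp: u_def inner_commute)
      ultimately have "u \<notin> B" "?on (insert u B)" using B(1) by (auto)
      then show False using B(2)[of "insert u B"] B(1) by simp
    qed
  qed
qed

section \<open>Functions on manifolds\<close>

locale smooth_atlas =
  fixes At :: "('m::{t2_space, second_countable_topology}, 'b::{real_inner, heine_borel}) atlas"
  assumes manifold: "smooth_manifold At"
begin

abbreviation C :: "('m \<Rightarrow> real) set" where
  "C \<equiv> smooth_functions At"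

lemma chart_properties:
  assumes "(W, \<phi>) \<in> At"
  shows "open W \<and> open (\<phi> ` W) \<and> homeomorphism W (\<phi> ` W) \<phi> (inv_into W \<phi>)"
  by (rule bspec[OF manifold[unfolded smooth_manifold_def, THEN conjunct2, THEN conjunct1] assms, unfolded prod.case])

lemmas chart_open = chart_properties[THEN conjunct1]
  and chart_image = chart_properties[THEN conjunct2, THEN conjunct1]
  and chart_homeomorphism = chart_properties[THEN conjunct2, THEN conjunct2]

lemma chart_around: obtains W \<phi> where "(W, \<phi>) \<in> At" "x \<in> W"
proof -
  have "x \<in> (\<Union>(W, \<phi>)\<in>At. W)"
    using manifold[unfolded smooth_manifold_def, THEN conjunct1] by (rule ssubst) simp
  then show thesis using that by (elim UN_E) (auto split: prod.splits)
qed

lemma chart_transition: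
  assumes "(W, \<phi>) \<in> At" "(W', \<phi>') \<in> At"
  shows "smooth_on (\<phi> ` (W \<inter> W')) (\<phi>' \<circ> inv_into W \<phi>)"
  using bspec[OF bspec[OF manifold[unfolded smooth_manifold_def, THEN conjunct2, THEN conjunct2] assms(1),
    unfolded prod.case] assms(2)] by simp

lemma chart_inv: "(W, \<phi>) \<in> At \<Longrightarrow> x \<in> W \<Longrightarrow> inv_into W \<phi> (\<phi> x) = x"
  using homeomorphism_apply1[OF chart_homeomorphism] by blast

lemma chart_image_open:
  assumes "(W, \<phi>) \<in> At" "open U"
  shows "open (\<phi> ` (W \<inter> U))"
proof -
  have "openin (top_of_set (\<phi> ` W)) (\<phi> ` (W \<inter> U))"
    by (rule homeomorphism_imp_open_map[OF chart_homeomorphism[OF assms(1)]])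
      (simp add: assms openin_open_Int)
  then show ?thesis using chart_image[OF assms(1)] openin_open_trans by blast
qed

lemma msmooth_iff:
  "msmooth At U g \<longleftrightarrow> (\<forall>W \<phi>. (W, \<phi>) \<in> At \<longrightarrow> smooth_on (\<phi> ` (W \<inter> U)) (g \<circ> inv_into W \<phi>))"
  unfolding msmooth_def by auto

lemma msmooth_subset:
  assumes "msmooth At U g" "V \<subseteq> U"
  shows "msmooth At V g"
  unfolding msmooth_iff
proof (intro allI impI)
  fix W \<phi> assume "(W, \<phi>) \<in> At"
  then have "smooth_on (\<phi> ` (W \<inter> U)) (g \<circ> inv_into W \<phi>)"
    using assms(1) unfolding msmooth_iff by blast
  then show "smooth_on (\<phi> ` (W \<inter> V)) (g \<circ> inv_into W \<phi>)"
    by (rule smooth_on_subset) (use assms(2) in auto)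
qed

text \<open>The representative \<open>g'\<close> may change with the point, which lets piecewise
  definitions be treated one case at a time.\<close>

lemma msmooth_localI:
  assumes "open U"
    and "\<And>x. x \<in> U \<Longrightarrow> \<exists>N g'. open N \<and> x \<in> N \<and> msmooth At (U \<inter> N) g' \<and> (\<forall>y\<in>U \<inter> N. g y = g' y)"
  shows "msmooth At U g"
  unfolding msmooth_iff
proof (intro allI impI, rule smooth_on_local)
  fix W \<phi> z assume W: "(W, \<phi>) \<in> At" and "z \<in> \<phi> ` (W \<inter> U)"
  then obtain x where x: "x \<in> W" "x \<in> U" "z = \<phi> x" by blast
  obtain N g' where N: "open N" "x \<in> N" "msmooth At (U \<inter> N) g'" "\<forall>y\<in>U \<inter> N. g y = g' y"
    using assms(2)[OF x(2)] by blast
  let ?T = "\<phi> ` (W \<inter> (U \<inter> N))"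
  have T: "open ?T" using chart_image_open[OF W] assms(1) N(1) by blast
  have "smooth_on ?T (g' \<circ> inv_into W \<phi>)" using N(3) W unfolding msmooth_iff by blast
  then have "smooth_on ?T (g \<circ> inv_into W \<phi>)"
    by (rule smooth_on_cong[OF T, rotated]) (use N(4) chart_inv[OF W] in auto)
  then show "\<exists>T. open T \<and> z \<in> T \<and> smooth_on T (g \<circ> inv_into W \<phi>)"
    using T x N(2) by blast
qed

lemma msmooth_cong:
  assumes "open U" "msmooth At U g" "\<And>x. x \<in> U \<Longrightarrow> g' x = g x"
  shows "msmooth At U g'"
  by (rule msmooth_localI[OF assms(1)]) (use assms in \<open>auto intro!: exI[of _ UNIV] exI[of _ g]\<close>)

lemma msmooth_const: "msmooth At U (\<lambda>x. c)"
  unfolding msmooth_iff by (simp add: comp_def smooth_on_const)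

lemma msmooth_add:
  assumes "open U" "msmooth At U f" "msmooth At U g"
  shows "msmooth At U (\<lambda>x. f x + g x)"
  unfolding msmooth_iff
proof (intro allI impI)
  fix W \<phi> assume W: "(W, \<phi>) \<in> At"
  have "smooth_on (\<phi> ` (W \<inter> U)) (\<lambda>y. (f \<circ> inv_into W \<phi>) y + (g \<circ> inv_into W \<phi>) y)"
    by (rule smooth_on_add) (use W assms chart_image_open in \<open>auto simp: msmooth_iff simp del: o_apply\<close>)
  then show "smooth_on (\<phi> ` (W \<inter> U)) ((\<lambda>x. f x + g x) \<circ> inv_into W \<phi>)"
    by (simp add: comp_def)
qed

lemma msmooth_bilinear:
  assumes "bounded_bilinear pr" "open U" "msmooth At U f" "msmooth At U g"
  shows "msmooth At U (\<lambda>x. pr (f x) (g x))"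
  unfolding msmooth_iff
proof (intro allI impI)
  fix W \<phi> assume W: "(W, \<phi>) \<in> At"
  have "smooth_on (\<phi> ` (W \<inter> U)) (\<lambda>y. pr ((f \<circ> inv_into W \<phi>) y) ((g \<circ> inv_into W \<phi>) y))"
    by (rule smooth_on_bilinear[OF assms(1)]) (use W assms chart_image_open in \<open>auto simp: msmooth_iff simp del: o_apply\<close>)
  then show "smooth_on (\<phi> ` (W \<inter> U)) ((\<lambda>x. pr (f x) (g x)) \<circ> inv_into W \<phi>)"
    by (simp add: comp_def)
qed

lemmas msmooth_scaleR = msmooth_bilinear[OF bounded_bilinear_scaleR]
lemmas msmooth_mult = msmooth_bilinear[OF bounded_bilinear_mult]
lemmas msmooth_inner = msmooth_bilinear[OF bounded_bilinear_inner]

lemma msmooth_sum: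
  assumes "open U" "\<And>i. i \<in> I \<Longrightarrow> msmooth At U (f i)"
  shows "msmooth At U (\<lambda>x. \<Sum>i\<in>I. f i x)"
  using assms(2)
proof (induction I rule: infinite_finite_induct)
  case (insert i I)
  then show ?case using msmooth_add[OF assms(1), of "f i" "\<lambda>x. \<Sum>i\<in>I. f i x"] by simp
qed (auto intro: msmooth_const)

lemma smooth_functions_iff: "f \<in> C \<longleftrightarrow> msmooth At UNIV f"
  by (simp add: smooth_functions_def)

lemma smooth_functions_msmooth: "f \<in> C \<Longrightarrow> msmooth At U f"
  using msmooth_subset smooth_functions_iff by blast

lemma smooth_functions_const: "(\<lambda>x. c) \<in> C"
  by (simp add: smooth_functions_iff msmooth_const)

lemma smooth_functions_add: "f \<in> C \<Longrightarrow> g \<in> C \<Longrightarrow> (\<lambda>x. f x + g x) \<in> C"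
  by (simp add: smooth_functions_iff msmooth_add)

lemma smooth_functions_mult: "f \<in> C \<Longrightarrow> g \<in> C \<Longrightarrow> (\<lambda>x. f x * g x) \<in> C"
  by (simp add: smooth_functions_iff msmooth_mult)

lemma smooth_functions_minus: "f \<in> C \<Longrightarrow> (\<lambda>x. - f x) \<in> C"
  using smooth_functions_mult[OF smooth_functions_const[of "-1"]] by simp

lemma smooth_functions_diff: "f \<in> C \<Longrightarrow> g \<in> C \<Longrightarrow> (\<lambda>x. f x - g x) \<in> C"
  using smooth_functions_add[OF _ smooth_functions_minus] by simp

lemma smooth_functions_localI:
  assumes "\<And>x. \<exists>N g. open N \<and> x \<in> N \<and> msmooth At N g \<and> (\<forall>y\<in>N. f y = g y)"
  shows "f \<in> C"
  unfolding smooth_functions_iff by (rule msmooth_localI) (use assms in auto)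

text \<open>Two sets are returned: \<open>V\<close>, where the function is 1, and a closed
  \<open>K\<close> inside \<open>N\<close> off which it vanishes. Closedness of \<open>K\<close> is
  what makes extension by zero smooth later, since the points outside \<open>N\<close> then have the
  open complement of \<open>K\<close> as a neighbourhood.\<close>

lemma bump:
  assumes "open N" "x0 \<in> N"
  obtains h K V where "h \<in> C" "closed K" "K \<subseteq> N" "\<And>x. x \<notin> K \<Longrightarrow> h x = 0"
    "open V" "x0 \<in> V" "V \<subseteq> N" "\<And>x. x \<in> V \<Longrightarrow> h x = 1"
proof -
  obtain W \<phi> where W: "(W, \<phi>) \<in> At" "x0 \<in> W" by (rule chart_around)
  note inv = chart_inv[OF W(1)]
  have "open (\<phi> ` (W \<inter> N))" "\<phi> x0 \<in> \<phi> ` (W \<inter> N)"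
    using chart_image_open[OF W(1) assms(1)] W(2) assms(2) by auto
  then obtain r where r: "r > 0" "cball (\<phi> x0) r \<subseteq> \<phi> ` (W \<inter> N)"
    using open_contains_cball by blast
  obtain \<psi> :: "real \<Rightarrow> real" where \<psi>: "smooth_on UNIV \<psi>" "\<And>t. t \<le> 0 \<Longrightarrow> \<psi> t = 1" "\<And>t. t \<ge> 1 \<Longrightarrow> \<psi> t = 0"
    using smooth_cutoff by blast
  \<comment> \<open>The argument of \<psi> is 1 at distance r and negative up to distance r / 2,
    which gives 0 outside the ball of radius r and 1 on the ball of half that radius.\<close>
  define k where "k = (\<lambda>y. \<psi> (2 / r\<^sup>2 * ((y - \<phi> x0) \<bullet> (y - \<phi> x0)) + - 1))"
  define h where "h = (\<lambda>x. if x \<in> W then k (\<phi> x) else 0)"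
  define K where "K = inv_into W \<phi> ` cball (\<phi> x0) r"
  define V where "V = W \<inter> \<phi> -` ball (\<phi> x0) (r / 2)"
  have pull: "x \<in> N" if x: "x \<in> W" "\<phi> x \<in> cball (\<phi> x0) r" for x
  proof -
    obtain x' where "x' \<in> W" "x' \<in> N" "\<phi> x = \<phi> x'" using x r(2) by blast
    then show ?thesis using inv x(1) by metis
  qed
  have kN: "K \<subseteq> W \<inter> N"
    using r(2) inv by (auto simp: K_def)
  have "continuous_on (\<phi> ` W) (inv_into W \<phi>)"
    using chart_homeomorphism[OF W(1)] by (simp add: homeomorphism_def)
  then have "continuous_on (cball (\<phi> x0) r) (inv_into W \<phi>)"
    by (rule continuous_on_subset) (use r(2) in blast)
  then have "compact K"
    unfolding K_def by (intro compact_continuous_image compact_cball)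
  \<comment> \<open>Hausdorff separation enters here: a closed coordinate ball is closed in the
    whole manifold.\<close>
  then have "closed K" by (rule compact_imp_closed)
  have k_far: "k y = 0" if "y \<notin> cball (\<phi> x0) r" for y
  proof -
    have "r\<^sup>2 \<le> (norm (y - \<phi> x0))\<^sup>2"
      using that r(1) by (intro power_mono) (auto simp: dist_norm norm_minus_commute)
    then have "1 \<le> 2 / r\<^sup>2 * ((y - \<phi> x0) \<bullet> (y - \<phi> x0)) + - 1"
      using r(1) by (simp add: power2_norm_eq_inner field_simps)
    then show ?thesis unfolding k_def by (rule \<psi>(3))
  qed
  have k_near: "k y = 1" if "y \<in> ball (\<phi> x0) (r / 2)" for y
  proof -
    have "(norm (y - \<phi> x0))\<^sup>2 \<le> (r / 2)\<^sup>2"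
      using that by (intro power_mono) (auto simp: dist_norm norm_minus_commute)
    then have "2 / r\<^sup>2 * ((y - \<phi> x0) \<bullet> (y - \<phi> x0)) + - 1 \<le> 2 / r\<^sup>2 * (r / 2)\<^sup>2 - 1"
      unfolding power2_norm_eq_inner by (simp add: divide_right_mono)
    also have "\<dots> \<le> 0" using r(1) by (simp add: power2_eq_square)
    finally show ?thesis unfolding k_def by (rule \<psi>(2))
  qed
  have h_off: "h x = 0" if "x \<notin> K" for x
  proof (cases "x \<in> W")
    case True
    then have "\<phi> x \<notin> cball (\<phi> x0) r" using that inv unfolding K_def by (metis imageI)
    then show ?thesis by (simp add: h_def k_far)
  qed (simp add: h_def)
  have "msmooth At UNIV h"
    unfolding msmooth_iff
  proof (intro allI impI, rule smooth_on_local)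
    fix W' \<phi>' z assume W': "(W', \<phi>') \<in> At" and "z \<in> \<phi>' ` (W' \<inter> UNIV)"
    then obtain x where x: "x \<in> W'" "z = \<phi>' x" by blast
    show "\<exists>T. open T \<and> z \<in> T \<and> smooth_on T (h \<circ> inv_into W' \<phi>')"
    proof (cases "x \<in> W")
      case True
      let ?T = "\<phi>' ` (W' \<inter> W)"
      have T: "open ?T" using chart_image_open[OF W' chart_open[OF W(1)]] .
      have tr: "smooth_on ?T (\<lambda>y. (\<phi> \<circ> inv_into W' \<phi>') y + - \<phi> x0)"
        by (intro smooth_on_add[OF T] smooth_on_const chart_transition[OF W' W(1)])
      have "smooth_on ?T (\<lambda>y. \<psi> (2 / r\<^sup>2 * (((\<phi> \<circ> inv_into W' \<phi>') y + - \<phi> x0) \<bullet>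
          ((\<phi> \<circ> inv_into W' \<phi>') y + - \<phi> x0)) + - 1))"
        by (intro smooth_on_real_compose[OF T \<psi>(1)] smooth_on_add[OF T] smooth_on_const
            smooth_on_bilinear[OF bounded_bilinear_mult T] smooth_on_bilinear[OF bounded_bilinear_inner T] tr)
      then have "smooth_on ?T (h \<circ> inv_into W' \<phi>')"
        by (rule smooth_on_cong[OF T, rotated]) (auto simp: h_def k_def chart_inv[OF W'])
      then show ?thesis using T x True by blast
    next
      case False
      let ?T = "\<phi>' ` (W' \<inter> - K)"
      have T: "open ?T" using chart_image_open[OF W'] \<open>closed K\<close> by blast
      have "smooth_on ?T (h \<circ> inv_into W' \<phi>')"
        by (rule smooth_on_cong[OF T _ smooth_on_const[of _ 0]]) (auto simp: chart_inv[OF W'] h_off)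
      moreover have "x \<notin> K" using False kN by blast
      ultimately show ?thesis using T x by blast
    qed
  qed
  moreover have "open V"
    unfolding V_def using chart_homeomorphism[OF W(1)] chart_open[OF W(1)]
    by (intro continuous_open_preimage) (auto simp: homeomorphism_def)
  moreover have "x0 \<in> V" using W(2) r(1) by (simp add: V_def)
  moreover have "V \<subseteq> N" using pull r(1) by (auto simp: V_def)
  moreover have "h x = 1" if "x \<in> V" for x
    using that k_near by (simp add: V_def h_def)
  ultimately show thesis
    using that[of h K V] \<open>closed K\<close> kN h_off by (auto simp: smooth_functions_iff)
qed

text \<open>\<open>U\<close> and the complement of \<open>K\<close> cover everything, and on each of
  them the function is visibly smooth. The second set \<open>U'\<close> is \<open>UNIV\<close> for
  functions and the domain of another frame for sections.\<close>

lemma bump_extend: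
  fixes g :: "'m \<Rightarrow> 'c::real_normed_vector"
  assumes "h \<in> C" "closed K" "K \<subseteq> U" "\<And>x. x \<notin> K \<Longrightarrow> h x = 0"
    and "open U" "open U'" "msmooth At (U \<inter> U') g"
  shows "msmooth At U' (\<lambda>x. if x \<in> U then h x *\<^sub>R g x else 0)"
proof (rule msmooth_localI[OF assms(6)])
  fix x assume "x \<in> U'"
  show "\<exists>N g'. open N \<and> x \<in> N \<and> msmooth At (U' \<inter> N) g' \<and>
      (\<forall>y\<in>U' \<inter> N. (if y \<in> U then h y *\<^sub>R g y else 0) = g' y)"
  proof (cases "x \<in> U")
    case True
    have "msmooth At (U' \<inter> U) (\<lambda>x. h x *\<^sub>R g x)"
      using assms by (intro msmooth_scaleR smooth_functions_msmooth) (auto simp: Int_commute)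
    then show ?thesis using True assms(5)
      by (intro exI[of _ U] exI[of _ "\<lambda>x. h x *\<^sub>R g x"]) auto
  next
    case False
    then have "x \<in> - K" using assms(3) by blast
    then show ?thesis using assms(2,4) msmooth_const
      by (intro exI[of _ "- K"] exI[of _ "\<lambda>x. 0"]) auto
  qed
qed

text \<open>\<open>Ck_on\<close> speaks of derivatives in constant directions only, whereas
  \<open>G\<close> moves; expanding \<open>G\<close> in an orthonormal basis leaves smooth
  coefficients times derivatives in constant directions.\<close>

lemma smooth_chart_vector:
  assumes "(W, \<phi>) \<in> At" "open U" "msmooth At (U \<inter> W) G" "f \<in> C"
  shows "smooth_on (\<phi> ` (W \<inter> U)) ((\<lambda>x. chart_vector At W \<phi> x (G x) f) \<circ> inv_into W \<phi>)"
proof -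
  let ?S = "\<phi> ` (W \<inter> U)" and ?i = "inv_into W \<phi>"
  have S: "open ?S" by (rule chart_image_open) fact+
  obtain B :: "'b set" where B: "finite B" "\<And>x. x = (\<Sum>b\<in>B. (x \<bullet> b) *\<^sub>R b)"
    using finite_orthonormal_basis by blast
  have F: "smooth_on (\<phi> ` W) (f \<circ> ?i)"
    using assms(1,4) unfolding smooth_functions_iff msmooth_iff by (metis Int_UNIV_right)
  have G: "smooth_on ?S (G \<circ> ?i)"
    using assms(1,3) unfolding msmooth_iff by (metis Int_left_absorb Int_commute)
  let ?D = "\<lambda>y. frechet_derivative (f \<circ> ?i) (at y)"
  have "smooth_on ?S (\<lambda>y. \<Sum>b\<in>B. ((G \<circ> ?i) y \<bullet> b) *\<^sub>R ?D y b)"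
    by (intro smooth_on_sum[OF S] smooth_on_bilinear[OF bounded_bilinear_scaleR S]
        smooth_on_bilinear[OF bounded_bilinear_inner S] smooth_on_const G
        smooth_on_subset[OF smooth_on_derivative[OF F]]) auto
  then show ?thesis
  proof (rule smooth_on_cong[OF S, rotated])
    fix y assume y: "y \<in> ?S"
    then have iy: "?i y \<in> W" "\<phi> (?i y) = y" using chart_inv[OF assms(1)] by auto
    have lin: "linear (?D y)"
      using y by (intro linear_frechet_derivative smooth_on_differentiable[OF F]) auto
    have "(\<Sum>b\<in>B. ((G \<circ> ?i) y \<bullet> b) *\<^sub>R ?D y b) = ?D y (\<Sum>b\<in>B. ((G \<circ> ?i) y \<bullet> b) *\<^sub>R b)"
      by (simp add: linear_sum[OF lin] linear_scale[OF lin])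
    also have "\<dots> = ?D y ((G \<circ> ?i) y)" using B(2)[of "(G \<circ> ?i) y"] by simp
    finally show "(\<Sum>b\<in>B. ((G \<circ> ?i) y \<bullet> b) *\<^sub>R ?D y b) =
        ((\<lambda>x. chart_vector At W \<phi> x (G x) f) \<circ> ?i) y"
      using assms(4) iy by (simp add: chart_vector_def)
  qed
qed

end

section \<open>Sections\<close>

lemma adjacent_swap_move:
  fixes f :: "'a list \<Rightarrow> real"
  assumes swap: "\<And>us v w vs. set (us @ v # w # vs) \<subseteq> S \<Longrightarrow> f (us @ v # w # vs) = - f (us @ w # v # vs)"
    and "set (us @ v # ys @ ws) \<subseteq> S"
  shows "f (us @ v # ys @ ws) = (-1) ^ length ys * f (us @ ys @ v # ws)"
  using assms(2)
proof (induction ys arbitrary: us)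
  case (Cons y ys)
  have "f (us @ v # y # ys @ ws) = - f ((us @ [y]) @ v # ys @ ws)"
    using swap[of us v y "ys @ ws"] Cons.prems by auto
  also have "f ((us @ [y]) @ v # ys @ ws) = (-1) ^ length ys * f ((us @ [y]) @ ys @ v # ws)"
    using Cons.prems by (intro Cons.IH) auto
  finally show ?case by simp
qed simp

text \<open>\<open>alternating_on\<close> demands the exchange of two arguments at any distance.
  Bringing \<open>v\<close> next to \<open>w\<close> and carrying \<open>w\<close> back cost the
  same sign, so that of the single exchange remains.\<close>

lemma adjacent_swap_imp_swap:
  fixes f :: "'a list \<Rightarrow> real"
  assumes swap: "\<And>us v w vs. set (us @ v # w # vs) \<subseteq> S \<Longrightarrow> f (us @ v # w # vs) = - f (us @ w # v # vs)"
    and S: "set (us @ v # vs @ w # ws) \<subseteq> S"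
  shows "f (us @ v # vs @ w # ws) = - f (us @ w # vs @ v # ws)"
proof -
  have "f (us @ v # vs @ w # ws) = (-1) ^ length vs * f ((us @ vs) @ v # w # ws)"
    using adjacent_swap_move[of S f, OF swap, of us v vs "w # ws"] S by simp
  also have "\<dots> = (-1) ^ length vs * - f ((us @ vs) @ w # v # ws)"
    by (subst swap) (use S in auto)
  also have "\<dots> = - f (us @ w # vs @ v # ws)"
    using adjacent_swap_move[of S f, OF swap, of us w vs "v # ws"] S by simp
  finally show ?thesis .
qed

text \<open>Alternation is assumed for all \<open>p\<close> at once, as holds for elements of
  \<open>Omega L\<close> and \<open>alternating_forms n\<close>, so that lengths need not be
  tracked.\<close>

lemma alternating_on_sum:
  assumes alt: "\<And>p. alternating_on S p \<omega>" and sub: "subspace S"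
    and "finite B" "set us \<subseteq> S" "set vs \<subseteq> S" "\<And>b. b \<in> B \<Longrightarrow> e b \<in> S"
  shows "\<omega> (us @ (\<Sum>b\<in>B. c b *\<^sub>R e b) # vs) = (\<Sum>b\<in>B. c b * \<omega> (us @ e b # vs))"
  using assms(3,6)
proof (induction B)
  case empty
  have "\<omega> (us @ (0 *\<^sub>R 0 + 0 *\<^sub>R 0) # vs) = 0 * \<omega> (us @ 0 # vs) + 0 * \<omega> (us @ 0 # vs)"
    using assms(4,5) subspace_0[OF sub]
    by (intro alt[of "int (length us + length vs + 1)", unfolded alternating_on_def, THEN conjunct1, rule_format]) auto
  then show ?case by simp
next
  case (insert b B)
  have "(\<Sum>b\<in>B. c b *\<^sub>R e b) \<in> S"
    using insert.prems by (intro subspace_sum[OF sub] subspace_scale[OF sub]) auto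
  then have "\<omega> (us @ (c b *\<^sub>R e b + 1 *\<^sub>R (\<Sum>b\<in>B. c b *\<^sub>R e b)) # vs) =
      c b * \<omega> (us @ e b # vs) + 1 * \<omega> (us @ (\<Sum>b\<in>B. c b *\<^sub>R e b) # vs)"
    using assms(4,5) insert.prems
    by (intro alt[of "int (length us + length vs + 1)", unfolded alternating_on_def, THEN conjunct1, rule_format]) auto
  then show ?case using insert by simp
qed

locale algebroid_context =
  fixes L :: "('m::{t2_space, second_countable_topology}, 'b::{real_inner, heine_borel},
      'v::real_vector, 'f::{real_inner, heine_borel}) algebroid"
  assumes lie: "lie_algebroid L"
begin

sublocale smooth_atlas "base L"
  using lie unfolding lie_algebroid_def by unfold_locales blast

abbreviation "At \<equiv> base L"
abbreviation "Frm \<equiv> frames (vec_bundle L)"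
abbreviation "Fib \<equiv> afibre L"
abbreviation "Sec \<equiv> sections L"
abbreviation "br \<equiv> bracket L"
abbreviation "\<Omega> \<equiv> Omega L"

lemma smooth_bundle: "smooth_vector_bundle At (vec_bundle L)"
  using lie unfolding lie_algebroid_def by blast

lemma subspace_fibre: "subspace (Fib x)"
  using smooth_bundle[unfolded smooth_vector_bundle_def, THEN conjunct1] by blast

lemma frame_around: obtains U \<theta> where "(U, \<theta>) \<in> Frm" "x \<in> U"
proof -
  have "x \<in> (\<Union>(U, \<theta>)\<in>Frm. U)"
    using smooth_bundle[unfolded smooth_vector_bundle_def, THEN conjunct2, THEN conjunct1] by (rule ssubst) simp
  then show thesis using that by (elim UN_E) (auto split: prod.splits)
qed

lemma frame_properties:
  assumes "(U, \<theta>) \<in> Frm"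
  shows "open U \<and> (\<forall>x\<in>U. linear (\<theta> x) \<and> bij_betw (\<theta> x) UNIV (Fib x))"
  by (rule bspec[OF smooth_bundle[unfolded smooth_vector_bundle_def, THEN conjunct2, THEN conjunct2,
        THEN conjunct1] assms, unfolded prod.case])

lemma frame_open: "(U, \<theta>) \<in> Frm \<Longrightarrow> open U"
  and frame_linear: "(U, \<theta>) \<in> Frm \<Longrightarrow> x \<in> U \<Longrightarrow> linear (\<theta> x)"
  and frame_bij: "(U, \<theta>) \<in> Frm \<Longrightarrow> x \<in> U \<Longrightarrow> bij_betw (\<theta> x) UNIV (Fib x)"
  using frame_properties by blast+

lemma frame_in_fibre: "(U, \<theta>) \<in> Frm \<Longrightarrow> x \<in> U \<Longrightarrow> \<theta> x w \<in> Fib x"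
  using frame_bij bij_betwE by blast

lemma frame_map_in_fibre: "(U, \<theta>) \<in> Frm \<Longrightarrow> x \<in> U \<Longrightarrow> set (map (\<theta> x) ws) \<subseteq> Fib x"
  using frame_in_fibre by auto

lemma frame_transition:
  assumes "(U, \<theta>) \<in> Frm" "(U', \<theta>') \<in> Frm"
  obtains g where "msmooth At (U \<inter> U') g" "\<And>x. x \<in> U \<inter> U' \<Longrightarrow> \<theta> x w = \<theta>' x (g x)"
proof -
  have "\<exists>g. msmooth At (U \<inter> U') g \<and> (\<forall>x\<in>U \<inter> U'. \<theta> x w = \<theta>' x (g x))"
    by (rule bspec[OF bspec[OF smooth_bundle[unfolded smooth_vector_bundle_def, THEN conjunct2,
        THEN conjunct2, THEN conjunct2] assms(1), unfolded prod.case] assms(2), unfolded prod.case, rule_format])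
  then show thesis using that by blast
qed

lemma section_in_fibre: "V \<in> Sec \<Longrightarrow> V x \<in> Fib x"
  unfolding smooth_sections_def by blast

lemma section_map_in_fibre: "set Vs \<subseteq> Sec \<Longrightarrow> set (map (\<lambda>V. V x) Vs) \<subseteq> Fib x"
  using section_in_fibre by auto

lemma section_frame:
  assumes "V \<in> Sec" "(U, \<theta>) \<in> Frm"
  obtains g where "msmooth At U g" "\<And>x. x \<in> U \<Longrightarrow> V x = \<theta> x (g x)"
proof -
  have "\<forall>(U, \<theta>)\<in>Frm. \<exists>g. msmooth At U g \<and> (\<forall>x\<in>U. V x = \<theta> x (g x))"
    using assms(1) unfolding smooth_sections_def by blast
  from bspec[OF this assms(2), unfolded prod.case] show thesis using that by blast
qed

lemma sectionI:
  assumes "\<And>x. V x \<in> Fib x"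
    and "\<And>U \<theta>. (U, \<theta>) \<in> Frm \<Longrightarrow> \<exists>g. msmooth At U g \<and> (\<forall>x\<in>U. V x = \<theta> x (g x))"
  shows "V \<in> Sec"
  unfolding smooth_sections_def using assms by auto

lemma section_combination:
  assumes "V \<in> Sec" "W \<in> Sec" "f \<in> C" "g \<in> C"
  shows "(\<lambda>x. f x *\<^sub>R V x + g x *\<^sub>R W x) \<in> Sec"
proof (rule sectionI)
  show "f x *\<^sub>R V x + g x *\<^sub>R W x \<in> Fib x" for x
    using assms section_in_fibre subspace_fibre by (simp add: subspace_add subspace_scale)
  fix U \<theta> assume U: "(U, \<theta>) \<in> Frm"
  obtain v where v: "msmooth At U v" "\<And>x. x \<in> U \<Longrightarrow> V x = \<theta> x (v x)"
    using section_frame[OF assms(1) U] by blast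
  obtain w where w: "msmooth At U w" "\<And>x. x \<in> U \<Longrightarrow> W x = \<theta> x (w x)"
    using section_frame[OF assms(2) U] by blast
  have "msmooth At U (\<lambda>x. f x *\<^sub>R v x + g x *\<^sub>R w x)"
    by (intro msmooth_add[OF frame_open[OF U]] msmooth_scaleR[OF frame_open[OF U]]
        smooth_functions_msmooth assms v w)
  moreover have "f x *\<^sub>R V x + g x *\<^sub>R W x = \<theta> x (f x *\<^sub>R v x + g x *\<^sub>R w x)" if "x \<in> U" for x
    using frame_linear[OF U that] v(2)[OF that] w(2)[OF that]
    by (simp add: linear_add linear_scale)
  ultimately show "\<exists>k. msmooth At U k \<and> (\<forall>x\<in>U. f x *\<^sub>R V x + g x *\<^sub>R W x = \<theta> x (k x))" by blast
qed

lemma section_add: "V \<in> Sec \<Longrightarrow> W \<in> Sec \<Longrightarrow> (\<lambda>x. V x + W x) \<in> Sec"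
  using section_combination[OF _ _ smooth_functions_const[of 1] smooth_functions_const[of 1]] by simp

lemma section_scale: "V \<in> Sec \<Longrightarrow> f \<in> C \<Longrightarrow> (\<lambda>x. f x *\<^sub>R V x) \<in> Sec"
  using section_combination[of V V f "\<lambda>x. 0"] smooth_functions_const by simp

lemma section_zero: "(\<lambda>x. 0) \<in> Sec"
proof (rule sectionI)
  show "0 \<in> Fib x" for x using subspace_0[OF subspace_fibre] .
  fix U \<theta> assume U: "(U, \<theta>) \<in> Frm"
  then show "\<exists>g. msmooth At U g \<and> (\<forall>x\<in>U. 0 = \<theta> x (g x))"
    using msmooth_const[of U 0] frame_linear[OF U] by (intro exI[of _ "\<lambda>x. 0"]) (auto simp: linear_0)
qed

lemma section_sum:
  assumes "\<And>i. i \<in> I \<Longrightarrow> V i \<in> Sec"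
  shows "(\<lambda>x. \<Sum>i\<in>I. V i x) \<in> Sec"
  using assms
proof (induction I rule: infinite_finite_induct)
  case (insert i I)
  then show ?case using section_add[of "V i" "\<lambda>x. \<Sum>i\<in>I. V i x"] by simp
qed (auto intro: section_zero)

text \<open>A real vector space is enough for the values, so one formula covers functions and
  sections, whose ambient space \<open>'v\<close> carries no norm.\<close>

definition extend :: "('m \<Rightarrow> real) \<Rightarrow> 'm set \<Rightarrow> ('m \<Rightarrow> 'c::real_vector) \<Rightarrow> 'm \<Rightarrow> 'c" where
  "extend h U g x = (if x \<in> U then h x *\<^sub>R g x else 0)"

lemma extend_frame:
  assumes U: "(U, \<theta>) \<in> Frm" and h: "h \<in> C" "closed K" "K \<subseteq> U" "\<And>x. x \<notin> K \<Longrightarrow> h x = 0"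
  shows "extend h U (\<lambda>x. \<theta> x w) \<in> Sec"
proof (rule sectionI)
  show "extend h U (\<lambda>x. \<theta> x w) x \<in> Fib x" for x
    using frame_in_fibre[OF U] subspace_fibre by (simp add: extend_def subspace_0 subspace_scale)
  fix U' \<theta>' assume U': "(U', \<theta>') \<in> Frm"
  obtain g where g: "msmooth At (U \<inter> U') g" "\<And>x. x \<in> U \<inter> U' \<Longrightarrow> \<theta> x w = \<theta>' x (g x)"
    using frame_transition[OF U U'] by blast
  have "msmooth At U' (\<lambda>x. if x \<in> U then h x *\<^sub>R g x else 0)"
    by (rule bump_extend[OF h frame_open[OF U] frame_open[OF U'] g(1)])
  moreover have "extend h U (\<lambda>x. \<theta> x w) x = \<theta>' x (if x \<in> U then h x *\<^sub>R g x else 0)" if "x \<in> U'" for x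
    using frame_linear[OF U' that] g(2) that by (simp add: extend_def linear_scale linear_0)
  ultimately show "\<exists>g. msmooth At U' g \<and> (\<forall>x\<in>U'. extend h U (\<lambda>x. \<theta> x w) x = \<theta>' x (g x))" by blast
qed

lemma extend_function:
  fixes g :: "'m \<Rightarrow> real"
  assumes h: "h \<in> C" "closed K" "K \<subseteq> U" "\<And>x. x \<notin> K \<Longrightarrow> h x = 0" and "open U" "msmooth At U g"
  shows "extend h U g \<in> C"
proof -
  have "msmooth At UNIV (\<lambda>x. if x \<in> U then h x *\<^sub>R g x else 0)"
    by (rule bump_extend[OF h assms(5) open_UNIV]) (simp_all add: assms(6))
  then show ?thesis by (simp add: smooth_functions_iff extend_def[abs_def])
qed

text \<open>One function \<open>h\<close> serves all frame vectors and all coefficients: on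
  \<open>N\<close> the resulting global sections and functions coincide with the local ones.\<close>

lemma local_extension:
  assumes U: "(U, \<theta>) \<in> Frm" and "x0 \<in> U"
  obtains h N where "h \<in> C" "open N" "x0 \<in> N" "N \<subseteq> U" "\<And>x. x \<in> N \<Longrightarrow> h x = 1"
    "\<And>x. x \<notin> U \<Longrightarrow> h x = 0" "\<And>w. extend h U (\<lambda>x. \<theta> x w) \<in> Sec"
    "\<And>g :: 'm \<Rightarrow> real. msmooth At U g \<Longrightarrow> extend h U g \<in> C"
proof -
  obtain h K V where hK: "h \<in> C" "closed K" "K \<subseteq> U" "\<And>x. x \<notin> K \<Longrightarrow> h x = 0"
    and V: "open V" "x0 \<in> V" "V \<subseteq> U" "\<And>x. x \<in> V \<Longrightarrow> h x = 1"
    using bump[OF frame_open[OF U] assms(2)] by metis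
  show thesis
    by (rule that[OF hK(1) V _ extend_frame[OF U hK] extend_function[OF hK frame_open[OF U]]])
      (use hK in blast)+
qed

text \<open>Sections reach every vector of a fibre; this is what reduces identities between forms to
  evaluation on sections.\<close>

lemma section_through:
  assumes "v \<in> Fib x"
  obtains V where "V \<in> Sec" "V x = v"
proof -
  obtain U \<theta> where U: "(U, \<theta>) \<in> Frm" "x \<in> U" by (rule frame_around)
  obtain h N where h: "x \<in> N" "\<And>x. x \<in> N \<Longrightarrow> h x = 1" "\<And>w. extend h U (\<lambda>x. \<theta> x w) \<in> Sec"
    using local_extension[OF U] by metis
  have "v \<in> range (\<theta> x)" using bij_betw_imp_surj_on[OF frame_bij[OF U]] assms by simp
  then obtain w where "\<theta> x w = v" by blast
  then show thesis using that[of "extend h U (\<lambda>x. \<theta> x w)"] h U(2) by (simp add: extend_def)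
qed

lemma sections_through:
  assumes "set vs \<subseteq> Fib x"
  obtains Vs where "set Vs \<subseteq> Sec" "map (\<lambda>V. V x) Vs = vs"
  using assms
proof (induction vs arbitrary: thesis)
  case (Cons v vs)
  obtain Vs where "set Vs \<subseteq> Sec" "map (\<lambda>V. V x) Vs = vs" using Cons by auto
  moreover obtain V where "V \<in> Sec" "V x = v" using section_through Cons.prems(2) by auto
  ultimately show ?case by (intro Cons.prems(1)[of "V # Vs"]) auto
qed simp

section \<open>The action of sections on functions\<close>

definition act :: "('m \<Rightarrow> 'v) \<Rightarrow> ('m \<Rightarrow> real) \<Rightarrow> 'm \<Rightarrow> real" where
  "act V f = (\<lambda>x. anchor L x (V x) f)"

lemma anchor_map: "smooth_bundle_map At (vec_bundle L) (tangent_bundle At) (anchor L)"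
  using lie unfolding lie_algebroid_def by blast

lemma anchor_tangent: "v \<in> Fib x \<Longrightarrow> anchor L x v \<in> tangent_space At x"
  using anchor_map[unfolded smooth_bundle_map_def, THEN conjunct1] by (simp add: tangent_bundle_def)

lemma anchor_linear:
  "v \<in> Fib x \<Longrightarrow> w \<in> Fib x \<Longrightarrow> anchor L x (a *\<^sub>R v + b *\<^sub>R w) f = a * anchor L x v f + b * anchor L x w f"
  using anchor_map[unfolded smooth_bundle_map_def, THEN conjunct2, THEN conjunct1] by simp

lemma anchor_sum:
  assumes "\<And>i. i \<in> I \<Longrightarrow> e i \<in> Fib x"
  shows "anchor L x (\<Sum>i\<in>I. c i *\<^sub>R e i) f = (\<Sum>i\<in>I. c i * anchor L x (e i) f)"
  using assms
proof (induction I rule: infinite_finite_induct)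
  case (insert i I)
  have "(\<Sum>i\<in>I. c i *\<^sub>R e i) \<in> Fib x"
    using insert.prems by (intro subspace_sum subspace_fibre subspace_scale) auto
  then show ?case using insert anchor_linear[of "e i" x "\<Sum>i\<in>I. c i *\<^sub>R e i" "c i" 1 f] by simp
qed (use anchor_linear[of 0 x 0 0 0 f] subspace_0[OF subspace_fibre] in auto)

lemma anchor_frame:
  assumes U: "(U, \<theta>) \<in> Frm" and W: "(W, \<phi>) \<in> At"
  obtains G where "msmooth At (U \<inter> W) G" "\<And>x. x \<in> U \<inter> W \<Longrightarrow> anchor L x (\<theta> x w) = chart_vector At W \<phi> x (G x)"
proof -
  have "(W, chart_vector At W \<phi>) \<in> frames (tangent_bundle At)"
    using W by (force simp: tangent_bundle_def)
  from bspec[OF bspec[OF anchor_map[unfolded smooth_bundle_map_def, THEN conjunct2, THEN conjunct2] U,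
        unfolded prod.case] this, unfolded prod.case, THEN spec, of w]
  show thesis using that by blast
qed

lemma anchor_frame_smooth:
  assumes U: "(U, \<theta>) \<in> Frm" and f: "f \<in> C"
  shows "msmooth At U (\<lambda>x. anchor L x (\<theta> x w) f)"
  unfolding msmooth_iff
proof (intro allI impI)
  fix W \<phi> assume W: "(W, \<phi>) \<in> At"
  obtain G where G: "msmooth At (U \<inter> W) G"
    "\<And>x. x \<in> U \<inter> W \<Longrightarrow> anchor L x (\<theta> x w) = chart_vector At W \<phi> x (G x)"
    using anchor_frame[OF U W] by blast
  show "smooth_on (\<phi> ` (W \<inter> U)) ((\<lambda>x. anchor L x (\<theta> x w) f) \<circ> inv_into W \<phi>)"
    by (rule smooth_on_cong[OF chart_image_open[OF W frame_open[OF U]] _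
          smooth_chart_vector[OF W frame_open[OF U] G(1) f]])
      (use G(2) chart_inv[OF W] in auto)
qed

text \<open>The anchor is known to be smooth on constant frame vectors only, so \<open>V\<close> is
  expanded in an orthonormal basis of the model fibre. The same expansion handles varying arguments
  of forms below.\<close>

lemma act_smooth:
  assumes V: "V \<in> Sec" and f: "f \<in> C"
  shows "act V f \<in> C"
proof (rule smooth_functions_localI)
  fix x
  obtain U \<theta> where U: "(U, \<theta>) \<in> Frm" "x \<in> U" by (rule frame_around)
  obtain g where g: "msmooth At U g" "\<And>x. x \<in> U \<Longrightarrow> V x = \<theta> x (g x)"
    using section_frame[OF V U(1)] by blast
  obtain B :: "'f set" where B: "finite B" "\<And>x. x = (\<Sum>b\<in>B. (x \<bullet> b) *\<^sub>R b)"
    using finite_orthonormal_basis by blast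
  note oU = frame_open[OF U(1)]
  have "msmooth At U (\<lambda>x. \<Sum>b\<in>B. (g x \<bullet> b) * anchor L x (\<theta> x b) f)"
    by (intro msmooth_sum[OF oU] msmooth_mult[OF oU] msmooth_inner[OF oU] msmooth_const g
        anchor_frame_smooth[OF U(1) f])
  moreover have "act V f y = (\<Sum>b\<in>B. (g y \<bullet> b) * anchor L y (\<theta> y b) f)" if "y \<in> U" for y
  proof -
    have "V y = \<theta> y (\<Sum>b\<in>B. (g y \<bullet> b) *\<^sub>R b)" using g(2)[OF that] B(2)[of "g y"] by simp
    also have "\<dots> = (\<Sum>b\<in>B. (g y \<bullet> b) *\<^sub>R \<theta> y b)"
      using frame_linear[OF U(1) that] by (simp add: linear_sum linear_scale)
    finally show ?thesis
      using anchor_sum[of B "\<theta> y" y] frame_in_fibre[OF U(1) that] by (simp add: act_def)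
  qed
  ultimately show "\<exists>N g. open N \<and> x \<in> N \<and> msmooth At N g \<and> (\<forall>y\<in>N. act V f y = g y)"
    using oU U(2) by blast
qed

lemma act_combination_left:
  "V \<in> Sec \<Longrightarrow> W \<in> Sec \<Longrightarrow>
    act (\<lambda>x. f x *\<^sub>R V x + g x *\<^sub>R W x) k = (\<lambda>x. f x * act V k x + g x * act W k x)"
  by (simp add: act_def anchor_linear section_in_fibre)

lemma act_combination:
  assumes "V \<in> Sec" "f \<in> C" "g \<in> C"
  shows "act V (\<lambda>x. a * f x + b * g x) = (\<lambda>x. a * act V f x + b * act V g x)"
proof
  fix x
  have "anchor L x (V x) (a *\<^sub>R f + b *\<^sub>R g) = a * anchor L x (V x) f + b * anchor L x (V x) g"
    using anchor_tangent[OF section_in_fibre[OF assms(1)], of x] assms(2,3)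
    unfolding tangent_space_def by blast
  moreover have "a *\<^sub>R f + b *\<^sub>R g = (\<lambda>x. a * f x + b * g x)" by (simp add: fun_eq_iff)
  ultimately show "act V (\<lambda>x. a * f x + b * g x) x = a * act V f x + b * act V g x"
    by (simp add: act_def)
qed

lemma act_diff: "V \<in> Sec \<Longrightarrow> f \<in> C \<Longrightarrow> g \<in> C \<Longrightarrow> act V (\<lambda>x. f x - g x) = (\<lambda>x. act V f x - act V g x)"
  using act_combination[of V f g 1 "-1"] by simp

lemma act_zero: "V \<in> Sec \<Longrightarrow> act V (\<lambda>x. 0) = (\<lambda>x. 0)"
  using act_combination[of V "\<lambda>x. 0" "\<lambda>x. 0" 0 0] smooth_functions_const by simp

lemma act_mult:
  assumes "V \<in> Sec" "f \<in> C" "g \<in> C"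
  shows "act V (\<lambda>x. f x * g x) = (\<lambda>x. f x * act V g x + g x * act V f x)"
proof
  fix x
  have "anchor L x (V x) (f * g) = f x * anchor L x (V x) g + g x * anchor L x (V x) f"
    using anchor_tangent[OF section_in_fibre[OF assms(1)], of x] assms(2,3)
    unfolding tangent_space_def by blast
  moreover have "f * g = (\<lambda>x. f x * g x)" by (simp add: fun_eq_iff)
  ultimately show "act V (\<lambda>x. f x * g x) x = f x * act V g x + g x * act V f x"
    by (simp add: act_def)
qed

text \<open>The usual argument for derivations: a bump function \<open>h\<close> makes h (f - g)
  vanish identically, and the Leibniz rule at \<open>x\<close>, where h = 1 and f = g, leaves the
  difference of the derivatives.\<close>

lemma act_local:
  assumes "V \<in> Sec" "f \<in> C" "g \<in> C" "open N" "x \<in> N" "\<And>y. y \<in> N \<Longrightarrow> f y = g y"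
  shows "act V f x = act V g x"
proof -
  obtain h K V' where h: "h \<in> C" "K \<subseteq> N" "\<And>x. x \<notin> K \<Longrightarrow> h x = 0" "x \<in> V'" "\<And>x. x \<in> V' \<Longrightarrow> h x = 1"
    using bump[OF assms(4,5)] by metis
  have "(\<lambda>y. h y * (f y - g y)) = (\<lambda>y. 0)"
    using h(2,3) assms(6) by (fastforce simp: fun_eq_iff)
  then have "act V (\<lambda>y. h y * (f y - g y)) = (\<lambda>y. 0)" using act_zero assms(1) by simp
  then have "h x * act V (\<lambda>y. f y - g y) x + (f x - g x) * act V h x = 0"
    using act_mult[OF assms(1) h(1) smooth_functions_diff[OF assms(2,3)]] by (metis)
  then show ?thesis using h(4,5) assms by (simp add: act_diff)
qed

section \<open>The bracket of sections\<close>

lemma bracket_lie: "lie_bracket_on Sec br"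
  using lie unfolding lie_algebroid_def by blast

lemma bracket_section: "V \<in> Sec \<Longrightarrow> W \<in> Sec \<Longrightarrow> br V W \<in> Sec"
  using bracket_lie unfolding lie_bracket_on_def by blast

lemma bracket_add_right:
  assumes "V \<in> Sec" "W \<in> Sec" "U \<in> Sec"
  shows "br U (\<lambda>x. V x + W x) = (\<lambda>x. br U V x + br U W x)"
proof -
  have "br U (1 *\<^sub>R V + 1 *\<^sub>R W) = 1 *\<^sub>R br U V + 1 *\<^sub>R br U W"
    using bracket_lie assms unfolding lie_bracket_on_def by blast
  then show ?thesis by (simp add: plus_fun_def)
qed

lemma bracket_add_left:
  assumes "V \<in> Sec" "W \<in> Sec" "U \<in> Sec"
  shows "br (\<lambda>x. V x + W x) U = (\<lambda>x. br V U x + br W U x)"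
proof -
  have "br (1 *\<^sub>R V + 1 *\<^sub>R W) U = 1 *\<^sub>R br V U + 1 *\<^sub>R br W U"
    using bracket_lie assms unfolding lie_bracket_on_def by blast
  then show ?thesis by (simp add: plus_fun_def)
qed

lemma bracket_self: "V \<in> Sec \<Longrightarrow> br V V = (\<lambda>x. 0)"
  using bracket_lie unfolding lie_bracket_on_def by (simp add: zero_fun_def)

lemma bracket_skew:
  assumes "V \<in> Sec" "W \<in> Sec"
  shows "br V W = (\<lambda>x. - br W V x)"
proof -
  have "br (\<lambda>x. V x + W x) (\<lambda>x. V x + W x) = (\<lambda>x. 0)"
    by (rule bracket_self[OF section_add[OF assms]])
  then have "(\<lambda>x. br V W x + br W V x) = (\<lambda>x. 0)"
    using assms by (simp add: bracket_add_left bracket_add_right section_add bracket_self fun_eq_iff)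
  then show ?thesis by (simp add: fun_eq_iff add_eq_0_iff)
qed

text \<open>Commutators of Lie derivatives call for the Jacobi identity in the form ad {V, W} =
  [ad V, ad W].\<close>

lemma bracket_jacobi:
  assumes "V \<in> Sec" "W \<in> Sec" "U \<in> Sec"
  shows "br (br V W) U = (\<lambda>x. br V (br W U) x - br W (br V U) x)"
proof -
  have "br V (br W U) + br W (br U V) + br U (br V W) = 0"
    using bracket_lie assms unfolding lie_bracket_on_def by blast
  then have j: "br V (br W U) x + br W (br U V) x + br U (br V W) x = 0" for x
    by (metis plus_fun_apply zero_fun_apply)
  have "br W (br U V) = (\<lambda>x. - br W (br V U) x)"
  proof -
    have "br W (br U V + br V U) = (\<lambda>x. br W (br U V) x + br W (br V U) x)"
      using bracket_add_right[of "br U V" "br V U" W] assms by (simp add: bracket_section plus_fun_def)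
    moreover have "br U V + br V U = (\<lambda>x. 0)"
      using bracket_skew[of U V] assms by (simp add: fun_eq_iff)
    moreover have "br W (\<lambda>x. 0) = (\<lambda>x. 0)"
      using bracket_add_right[of "\<lambda>x. 0" "\<lambda>x. 0" W] assms section_zero by (simp add: fun_eq_iff)
    ultimately show ?thesis by (simp add: fun_eq_iff add_eq_0_iff)
  qed
  moreover have "br (br V W) U = (\<lambda>x. - br U (br V W) x)"
    using bracket_skew assms bracket_section by blast
  ultimately show ?thesis using j by (auto simp: fun_eq_iff algebra_simps)
qed

lemma bracket_scale_right:
  "V \<in> Sec \<Longrightarrow> W \<in> Sec \<Longrightarrow> f \<in> C \<Longrightarrow> br V (\<lambda>x. f x *\<^sub>R W x) = (\<lambda>x. f x *\<^sub>R br V W x + act V f x *\<^sub>R W x)"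
  using lie unfolding lie_algebroid_def act_def by blast

lemma bracket_scale_left:
  assumes "V \<in> Sec" "W \<in> Sec" "f \<in> C"
  shows "br (\<lambda>x. f x *\<^sub>R V x) W = (\<lambda>x. f x *\<^sub>R br V W x + (- act W f x) *\<^sub>R V x)"
  using bracket_skew[OF section_scale[OF assms(1,3)] assms(2)] bracket_scale_right[OF assms(2,1,3)]
    bracket_skew[OF assms(1,2)] by simp

lemma act_bracket:
  assumes "V \<in> Sec" "W \<in> Sec" "f \<in> C"
  shows "act (br V W) f = (\<lambda>x. act V (act W f) x - act W (act V f) x)"
proof -
  have "(\<lambda>x. anchor L x (br V W x)) = vector_field_bracket At (\<lambda>x. anchor L x (V x)) (\<lambda>x. anchor L x (W x))"
    using lie assms unfolding lie_algebroid_def by blast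
  then show ?thesis using assms(3) by (simp add: act_def vector_field_bracket_def fun_eq_iff)
qed


section \<open>Forms of mixed degree\<close>

lemma alternating_on_triv:
  "(\<And>us. int (length us) = p \<Longrightarrow> \<omega> us = 0) \<Longrightarrow> alternating_on S p \<omega>"
  by (simp add: alternating_on_def)

lemma alternating_on_cong:
  assumes "alternating_on S p \<omega>" "\<And>us. int (length us) = p \<Longrightarrow> \<omega>' us = \<omega> us"
  shows "alternating_on S p \<omega>'"
  unfolding alternating_on_def
proof (intro conjI allI impI, goal_cases)
  case (1 us vs v w a b)
  note assms(1)[unfolded alternating_on_def, THEN conjunct1, rule_format, OF 1]
  then show ?case using 1 assms(2) by simp
next
  case (2 us vs ws v w)
  note assms(1)[unfolded alternating_on_def, THEN conjunct2, rule_format, OF 2]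
  then show ?case using 2 assms(2) by simp
qed

lemma forms_D:
  assumes "\<eta> \<in> forms L k"
  shows "alternating_on (Fib x) k (\<eta> x)"
    and "\<not> (set vs \<subseteq> Fib x \<and> int (length vs) = k) \<Longrightarrow> \<eta> x vs = 0"
    and "(U, \<theta>) \<in> Frm \<Longrightarrow> int (length ws) = k \<Longrightarrow> msmooth At U (\<lambda>x. \<eta> x (map (\<theta> x) ws))"
  using assms unfolding forms_def by auto

text \<open>With \<open>OmegaI\<close> this replaces the span by an intrinsic description of
  \<open>Omega L\<close>. A form of degree \<open>k\<close> is alternating in every degree, because
  it vanishes in the others; the bound on the length records that the direct sum has finitely many
  terms.\<close>

lemma OmegaD:
  assumes "\<eta> \<in> \<Omega>"
  shows "(\<forall>x p. alternating_on (Fib x) p (\<eta> x)) \<and> (\<forall>x vs. \<not> set vs \<subseteq> Fib x \<longrightarrow> \<eta> x vs = 0) \<and>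
    (\<exists>n. \<forall>x vs. n < length vs \<longrightarrow> \<eta> x vs = 0) \<and>
    (\<forall>U \<theta> ws. (U, \<theta>) \<in> Frm \<longrightarrow> msmooth At U (\<lambda>x. \<eta> x (map (\<theta> x) ws)))"
  using assms unfolding Omega_def
proof (induction rule: span_induct_alt)
  case base
  then show ?case by (simp add: alternating_on_triv msmooth_const)
next
  case (step c \<eta> \<zeta>)
  then obtain k where \<eta>: "\<eta> \<in> forms L k" by blast
  have alt: "alternating_on (Fib x) p (\<eta> x)" for x p
  proof (cases "p = k")
    case False
    then show ?thesis using forms_D(2)[OF \<eta>] by (intro alternating_on_triv) auto
  qed (use forms_D(1)[OF \<eta>] in simp)
  have sm: "msmooth At U (\<lambda>x. \<eta> x (map (\<theta> x) ws))" if "(U, \<theta>) \<in> Frm" for U \<theta> ws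
  proof (cases "int (length ws) = k")
    case False
    then have "(\<lambda>x. \<eta> x (map (\<theta> x) ws)) = (\<lambda>x. 0)" using forms_D(2)[OF \<eta>] by auto
    then show ?thesis by (simp add: msmooth_const)
  qed (use forms_D(3)[OF \<eta> that] in simp)
  obtain n where n: "\<And>x vs. n < length vs \<Longrightarrow> \<zeta> x vs = 0" using step by blast
  have "\<eta> x vs = 0" if "nat k < length vs" for x vs
    by (rule forms_D(2)[OF \<eta>]) (use that in linarith)
  then have "(c *\<^sub>R \<eta> + \<zeta>) x vs = 0" if "max n (nat k) < length vs" for x vs
    using that n by simp
  moreover have "alternating_on (Fib x) p ((c *\<^sub>R \<eta> + \<zeta>) x)" for x p
    using alternating_on_combination[OF alt, of x p "\<zeta> x" c] step(2) by (simp add: plus_fun_def)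
  moreover have "msmooth At U (\<lambda>x. (c *\<^sub>R \<eta> + \<zeta>) x (map (\<theta> x) ws))" if "(U, \<theta>) \<in> Frm" for U \<theta> ws
    using msmooth_add[OF frame_open[OF that] msmooth_mult[OF frame_open[OF that] msmooth_const[of _ c] sm[OF that]]]
      step(2) that by simp
  moreover have "(c *\<^sub>R \<eta> + \<zeta>) x vs = 0" if "\<not> set vs \<subseteq> Fib x" for x vs
    using forms_D(2)[OF \<eta>, of vs x] step(2) that by simp
  ultimately show ?case by blast
qed

lemma Omega_alternating: "\<eta> \<in> \<Omega> \<Longrightarrow> alternating_on (Fib x) p (\<eta> x)"
  and Omega_outside: "\<eta> \<in> \<Omega> \<Longrightarrow> \<not> set vs \<subseteq> Fib x \<Longrightarrow> \<eta> x vs = 0"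
  and Omega_bounded: "\<eta> \<in> \<Omega> \<Longrightarrow> \<exists>n. \<forall>x vs. n < length vs \<longrightarrow> \<eta> x vs = 0"
  and Omega_smooth: "\<eta> \<in> \<Omega> \<Longrightarrow> (U, \<theta>) \<in> Frm \<Longrightarrow> msmooth At U (\<lambda>x. \<eta> x (map (\<theta> x) ws))"
  using OmegaD by blast+

text \<open>Cutting by list length produces the homogeneous components, finitely many by the bound
  \<open>n\<close>.\<close>

lemma OmegaI:
  assumes alt: "\<And>x p. alternating_on (Fib x) p (\<eta> x)"
    and out: "\<And>x vs. \<not> set vs \<subseteq> Fib x \<Longrightarrow> \<eta> x vs = 0"
    and bd: "\<And>x vs. n < length vs \<Longrightarrow> \<eta> x vs = 0"
    and sm: "\<And>U \<theta> ws. (U, \<theta>) \<in> Frm \<Longrightarrow> msmooth At U (\<lambda>x. \<eta> x (map (\<theta> x) ws))"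
  shows "\<eta> \<in> \<Omega>"
proof -
  define comp where "comp = (\<lambda>k x vs. if length vs = k then \<eta> x vs else 0)"
  have "comp k \<in> forms L (int k)" for k
  proof -
    have "alternating_on (Fib x) (int k) (comp k x)" for x
      by (rule alternating_on_cong[OF alt[of x]]) (simp add: comp_def)
    then show ?thesis unfolding forms_def using out sm by (auto simp: comp_def)
  qed
  then have "(\<Sum>k\<le>n. comp k) \<in> span (\<Union>p. forms L p)"
    by (intro span_sum span_base) blast
  moreover have "(\<Sum>k\<le>n. comp k) = \<eta>"
  proof (intro ext)
    fix x vs
    have "(\<Sum>k\<le>n. comp k) x vs = (\<Sum>k\<le>n. comp k x vs)"
      by (induction n) simp_all
    also have "\<dots> = (if length vs \<le> n then \<eta> x vs else 0)"
      by (simp add: comp_def)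
    also have "\<dots> = \<eta> x vs" using bd[of vs x] by auto
    finally show "(\<Sum>k\<le>n. comp k) x vs = \<eta> x vs" .
  qed
  ultimately show ?thesis by (simp add: Omega_def)
qed

lemma Omega_combination:
  assumes "\<eta> \<in> \<Omega>" "\<zeta> \<in> \<Omega>" "f \<in> C" "g \<in> C"
  shows "(\<lambda>x vs. f x * \<eta> x vs + g x * \<zeta> x vs) \<in> \<Omega>"
proof -
  obtain n where n: "\<And>x vs. n < length vs \<Longrightarrow> \<eta> x vs = 0" using Omega_bounded[OF assms(1)] by blast
  obtain m where m: "\<And>x vs. m < length vs \<Longrightarrow> \<zeta> x vs = 0" using Omega_bounded[OF assms(2)] by blast
  show ?thesis
  proof (rule OmegaI[of _ "max n m"])
    fix x p
    have z: "alternating_on (Fib x) p (\<lambda>us. g x * \<zeta> x us + 0)"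
      by (rule alternating_on_combination[OF Omega_alternating[OF assms(2)] alternating_on_triv]) simp
    show "alternating_on (Fib x) p (\<lambda>vs. f x * \<eta> x vs + g x * \<zeta> x vs)"
      using alternating_on_combination[OF Omega_alternating[OF assms(1)] z] by simp
  next
    fix U \<theta> ws assume U: "(U, \<theta>) \<in> Frm"
    show "msmooth At U (\<lambda>x. f x * \<eta> x (map (\<theta> x) ws) + g x * \<zeta> x (map (\<theta> x) ws))"
      by (intro msmooth_add[OF frame_open[OF U]] msmooth_mult[OF frame_open[OF U]]
          smooth_functions_msmooth assms Omega_smooth U)
  qed (use n m Omega_outside[OF assms(1)] Omega_outside[OF assms(2)] in auto)
qed

lemma Omega_mult: "\<eta> \<in> \<Omega> \<Longrightarrow> f \<in> C \<Longrightarrow> (\<lambda>x vs. f x * \<eta> x vs) \<in> \<Omega>"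
  using Omega_combination[of \<eta> \<eta> f "\<lambda>x. 0"] smooth_functions_const by simp

lemma subspace_Omega: "subspace \<Omega>"
  by (simp add: Omega_def)

lemma Omega_eqI:
  assumes "\<eta> \<in> \<Omega>" "\<zeta> \<in> \<Omega>" "\<And>Vs. set Vs \<subseteq> Sec \<Longrightarrow> eval_form \<eta> Vs = eval_form \<zeta> Vs"
  shows "\<eta> = \<zeta>"
proof (intro ext)
  fix x vs
  show "\<eta> x vs = \<zeta> x vs"
  proof (cases "set vs \<subseteq> Fib x")
    case True
    then obtain Vs where "set Vs \<subseteq> Sec" "map (\<lambda>V. V x) Vs = vs" using sections_through by blast
    then show ?thesis using assms(3)[of Vs] by (auto simp: eval_form_def fun_eq_iff)
  qed (simp add: Omega_outside[OF assms(1)] Omega_outside[OF assms(2)])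
qed

lemma Omega_slot:
  assumes "\<eta> \<in> \<Omega>" "set us \<subseteq> Fib x" "set vs \<subseteq> Fib x" "v \<in> Fib x" "w \<in> Fib x"
  shows "\<eta> x (us @ (a *\<^sub>R v + b *\<^sub>R w) # vs) = a * \<eta> x (us @ v # vs) + b * \<eta> x (us @ w # vs)"
  using assms Omega_alternating[OF assms(1), of x "int (length us + length vs + 1)"]
  unfolding alternating_on_def by blast

lemma Omega_swap:
  assumes "\<eta> \<in> \<Omega>" "set us \<subseteq> Fib x" "set vs \<subseteq> Fib x" "v \<in> Fib x" "w \<in> Fib x"
  shows "\<eta> x (us @ v # w # vs) = - \<eta> x (us @ w # v # vs)"
  using assms Omega_alternating[OF assms(1), of x "int (length us + length ([] :: 'v list) + length vs + 2)",
    unfolded alternating_on_def, THEN conjunct2, rule_format, of us "[]" vs v w] by simp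

text \<open>The mixed list of frame vectors and sections is the induction invariant: each step
  expands the first section and moves it among the frame vectors.\<close>

lemma Omega_frame_section_smooth:
  assumes \<eta>: "\<eta> \<in> \<Omega>" and U: "(U, \<theta>) \<in> Frm" and "set Vs \<subseteq> Sec"
  shows "msmooth At U (\<lambda>x. \<eta> x (map (\<theta> x) ws @ map (\<lambda>V. V x) Vs))"
  using assms(3)
proof (induction Vs arbitrary: ws)
  case Nil
  then show ?case using Omega_smooth[OF \<eta> U] by simp
next
  case (Cons V Vs)
  note oU = frame_open[OF U]
  obtain B :: "'f set" where B: "finite B" "\<And>x. x = (\<Sum>b\<in>B. (x \<bullet> b) *\<^sub>R b)"
    using finite_orthonormal_basis by blast
  obtain g where g: "msmooth At U g" "\<And>x. x \<in> U \<Longrightarrow> V x = \<theta> x (g x)"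
    using section_frame[OF _ U] Cons.prems by (metis insert_subset list.set(2))
  have "msmooth At U (\<lambda>x. \<Sum>b\<in>B. (g x \<bullet> b) * \<eta> x (map (\<theta> x) (ws @ [b]) @ map (\<lambda>V. V x) Vs))"
    using Cons.prems
    by (intro msmooth_sum[OF oU] msmooth_mult[OF oU] msmooth_inner[OF oU] msmooth_const g Cons.IH) auto
  then show ?case
  proof (rule msmooth_cong[OF oU])
    fix x assume x: "x \<in> U"
    have "V x = \<theta> x (\<Sum>b\<in>B. (g x \<bullet> b) *\<^sub>R b)" using g(2)[OF x] B(2)[of "g x"] by simp
    also have "\<dots> = (\<Sum>b\<in>B. (g x \<bullet> b) *\<^sub>R \<theta> x b)"
      using frame_linear[OF U x] by (simp add: linear_sum linear_scale)
    finally have V: "V x = (\<Sum>b\<in>B. (g x \<bullet> b) *\<^sub>R \<theta> x b)" .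
    show "\<eta> x (map (\<theta> x) ws @ map (\<lambda>V. V x) (V # Vs)) =
        (\<Sum>b\<in>B. (g x \<bullet> b) * \<eta> x (map (\<theta> x) (ws @ [b]) @ map (\<lambda>V. V x) Vs))"
      using alternating_on_sum[OF Omega_alternating[OF \<eta>] subspace_fibre B(1)
          frame_map_in_fibre[OF U x] section_map_in_fibre, of Vs "\<theta> x"] Cons.prems frame_in_fibre[OF U x]
      by (simp add: V)
  qed
qed

lemma eval_form_smooth:
  assumes "\<eta> \<in> \<Omega>" "set Vs \<subseteq> Sec"
  shows "eval_form \<eta> Vs \<in> C"
proof (rule smooth_functions_localI)
  fix x
  obtain U \<theta> where U: "(U, \<theta>) \<in> Frm" "x \<in> U" by (rule frame_around)
  have "msmooth At U (\<lambda>x. \<eta> x (map (\<theta> x) [] @ map (\<lambda>V. V x) Vs))"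
    by (rule Omega_frame_section_smooth[OF assms(1) U(1) assms(2)])
  then show "\<exists>N g. open N \<and> x \<in> N \<and> msmooth At N g \<and> (\<forall>y\<in>N. eval_form \<eta> Vs y = g y)"
    using frame_open[OF U(1)] U(2) by (auto simp: eval_form_def)
qed

section \<open>Cochains\<close>

text \<open>Linearity is asked of the first argument only; exchanges of neighbours carry it to the
  others. Lists of all lengths are handled together, like forms of mixed degree, and nothing is
  required off lists of sections.\<close>

definition cochain :: "(('m \<Rightarrow> 'v) list \<Rightarrow> 'm \<Rightarrow> real) \<Rightarrow> bool" where
  "cochain c \<longleftrightarrow> (\<forall>Vs. set Vs \<subseteq> Sec \<longrightarrow> c Vs \<in> C) \<and>
    (\<forall>V W Vs. set (V # W # Vs) \<subseteq> Sec \<longrightarrow> c ((\<lambda>x. V x + W x) # Vs) = (\<lambda>x. c (V # Vs) x + c (W # Vs) x)) \<and>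
    (\<forall>V Vs. \<forall>f\<in>C. set (V # Vs) \<subseteq> Sec \<longrightarrow> c ((\<lambda>x. f x *\<^sub>R V x) # Vs) = (\<lambda>x. f x * c (V # Vs) x)) \<and>
    (\<forall>Us V W Vs. set (Us @ V # W # Vs) \<subseteq> Sec \<longrightarrow> c (Us @ V # W # Vs) = (\<lambda>x. - c (Us @ W # V # Vs) x))"

lemma cochain_smooth: "cochain c \<Longrightarrow> set Vs \<subseteq> Sec \<Longrightarrow> c Vs \<in> C"
  unfolding cochain_def by blast

lemma cochain_add:
  assumes "cochain c" "V \<in> Sec" "W \<in> Sec" "set Vs \<subseteq> Sec"
  shows "c ((\<lambda>x. V x + W x) # Vs) = (\<lambda>x. c (V # Vs) x + c (W # Vs) x)"
  by (rule assms(1)[unfolded cochain_def, THEN conjunct2, THEN conjunct1, rule_format]) (use assms in simp)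

lemma cochain_scale:
  assumes "cochain c" "f \<in> C" "V \<in> Sec" "set Vs \<subseteq> Sec"
  shows "c ((\<lambda>x. f x *\<^sub>R V x) # Vs) = (\<lambda>x. f x * c (V # Vs) x)"
  by (rule assms(1)[unfolded cochain_def, THEN conjunct2, THEN conjunct2, THEN conjunct1, rule_format])
    (use assms in simp_all)

lemma cochain_swap:
  assumes "cochain c" "set Us \<subseteq> Sec" "V \<in> Sec" "W \<in> Sec" "set Vs \<subseteq> Sec"
  shows "c (Us @ V # W # Vs) = (\<lambda>x. - c (Us @ W # V # Vs) x)"
  by (rule assms(1)[unfolded cochain_def, THEN conjunct2, THEN conjunct2, THEN conjunct2, rule_format])
    (use assms in simp)

lemma cochain_eval_form:
  assumes "\<eta> \<in> \<Omega>"
  shows "cochain (eval_form \<eta>)"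
  unfolding cochain_def
proof (intro conjI allI ballI impI ext, goal_cases)
  case (1 Vs)
  then show ?case by (rule eval_form_smooth[OF assms])
next
  case (2 V W Vs x)
  then show ?case
    using Omega_slot[OF assms, of "[]" x "map (\<lambda>V. V x) Vs" "V x" "W x" 1 1] section_in_fibre
    by (auto simp: eval_form_def image_subset_iff subset_iff)
next
  case (3 V Vs f x)
  then show ?case
    using Omega_slot[OF assms, of "[]" x "map (\<lambda>V. V x) Vs" "V x" "V x" "f x" 0] section_in_fibre
    by (auto simp: eval_form_def image_subset_iff subset_iff)
next
  case (4 Us V W Vs x)
  then show ?case
    using Omega_swap[OF assms, of "map (\<lambda>V. V x) Us" x "map (\<lambda>V. V x) Vs" "V x" "W x"] section_in_fibre
    by (auto simp: eval_form_def image_subset_iff subset_iff)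
qed

lemma cochain_move:
  assumes "cochain c" "set Us \<subseteq> Sec" "V \<in> Sec" "set Vs \<subseteq> Sec"
  shows "c (V # Us @ Vs) x = (-1) ^ length Us * c (Us @ V # Vs) x"
proof -
  have "c (Us' @ V' # W' # Vs') x = - c (Us' @ W' # V' # Vs') x" if "set (Us' @ V' # W' # Vs') \<subseteq> Sec" for Us' V' W' Vs'
    using cochain_swap[OF assms(1), of Us' V' W' Vs'] that by simp
  from adjacent_swap_move[of Sec "\<lambda>Vs. c Vs x", OF this, of "[]" V Us Vs] show ?thesis
    using assms by simp
qed

lemma cochain_sum:
  assumes "cochain c" "finite I" "set Vs \<subseteq> Sec" "\<And>i. i \<in> I \<Longrightarrow> f i \<in> C" "\<And>i. i \<in> I \<Longrightarrow> e i \<in> Sec"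
  shows "c ((\<lambda>x. \<Sum>i\<in>I. f i x *\<^sub>R e i x) # Vs) = (\<lambda>x. \<Sum>i\<in>I. f i x * c (e i # Vs) x)"
  using assms(2,4,5)
proof (induction I)
  case empty
  have "c ((\<lambda>x. 0 *\<^sub>R (\<lambda>x. 0) x) # Vs) = (\<lambda>x. 0 * c ((\<lambda>x. 0) # Vs) x)"
    by (rule cochain_scale[OF assms(1) smooth_functions_const section_zero assms(3)])
  then show ?case by simp
next
  case (insert i I)
  have "c ((\<lambda>x. (\<lambda>x. f i x *\<^sub>R e i x) x + (\<lambda>x. \<Sum>i\<in>I. f i x *\<^sub>R e i x) x) # Vs) =
      (\<lambda>x. c ((\<lambda>x. f i x *\<^sub>R e i x) # Vs) x + c ((\<lambda>x. \<Sum>i\<in>I. f i x *\<^sub>R e i x) # Vs) x)"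
    using insert.prems by (intro cochain_add[OF assms(1) _ _ assms(3)] section_sum section_scale) auto
  then show ?case
    using insert cochain_scale[OF assms(1) _ _ assms(3)] by simp
qed

text \<open>Writing a section that vanishes at \<open>x\<close> in a local frame shows that a function-multilinear map
  only sees the values of its arguments at \<open>x\<close>.\<close>

lemma cochain_vanish:
  assumes c: "cochain c" and V: "V \<in> Sec" "V x = 0" and Vs: "set Vs \<subseteq> Sec"
  shows "c (V # Vs) x = 0"
proof -
  obtain U \<theta> where U: "(U, \<theta>) \<in> Frm" "x \<in> U" by (rule frame_around)
  obtain h N where h: "h \<in> C" "x \<in> N" "\<And>x. x \<in> N \<Longrightarrow> h x = 1" "\<And>w. extend h U (\<lambda>x. \<theta> x w) \<in> Sec"
    and N: "\<And>x. x \<notin> U \<Longrightarrow> h x = 0"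
    and ext: "\<And>g :: 'm \<Rightarrow> real. msmooth At U g \<Longrightarrow> extend h U g \<in> C"
    using local_extension[OF U] by metis
  obtain B :: "'f set" where B: "finite B" "\<And>x. x = (\<Sum>b\<in>B. (x \<bullet> b) *\<^sub>R b)"
    using finite_orthonormal_basis by blast
  obtain g where g: "msmooth At U g" "\<And>x. x \<in> U \<Longrightarrow> V x = \<theta> x (g x)"
    using section_frame[OF V(1) U(1)] by blast
  define f where "f = (\<lambda>b. extend h U (\<lambda>x. g x \<bullet> b))"
  define e where "e = (\<lambda>b. extend h U (\<lambda>x. \<theta> x b))"
  have fC: "f b \<in> C" for b
    unfolding f_def by (intro ext msmooth_inner[OF frame_open[OF U(1)]] g msmooth_const)
  have "(\<lambda>y. (h y * h y) *\<^sub>R V y) = (\<lambda>y. \<Sum>b\<in>B. f b y *\<^sub>R e b y)"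
  proof
    fix y
    show "(h y * h y) *\<^sub>R V y = (\<Sum>b\<in>B. f b y *\<^sub>R e b y)"
    proof (cases "y \<in> U")
      case True
      have "V y = \<theta> y (\<Sum>b\<in>B. (g y \<bullet> b) *\<^sub>R b)" using g(2)[OF True] B(2)[of "g y"] by simp
      also have "\<dots> = (\<Sum>b\<in>B. (g y \<bullet> b) *\<^sub>R \<theta> y b)"
        using frame_linear[OF U(1) True] by (simp add: linear_sum linear_scale)
      finally show ?thesis using True
        by (simp add: f_def e_def extend_def scaleR_sum_right algebra_simps)
    qed (simp add: N f_def extend_def)
  qed
  then have "c ((\<lambda>y. (h y * h y) *\<^sub>R V y) # Vs) = (\<lambda>x. \<Sum>b\<in>B. f b x * c (e b # Vs) x)"
    using cochain_sum[OF c B(1) Vs, of f e] fC h(4) by (simp add: e_def)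
  moreover have "c ((\<lambda>y. (h y * h y) *\<^sub>R V y) # Vs) = (\<lambda>y. (h y * h y) * c (V # Vs) y)"
    by (rule cochain_scale[OF c smooth_functions_mult[OF h(1) h(1)] V(1) Vs])
  ultimately have eq: "(h x * h x) * c (V # Vs) x = (\<Sum>b\<in>B. f b x * c (e b # Vs) x)" by metis
  have "\<theta> x (g x) = \<theta> x 0"
    using g(2)[OF U(2)] V(2) linear_0[OF frame_linear[OF U]] by simp
  then have "g x = 0" using bij_betw_imp_inj_on[OF frame_bij[OF U]] by (auto dest: injD)
  then have "f b x = 0" for b using U(2) by (simp add: f_def extend_def)
  then show ?thesis using eq h(3)[OF h(2)] by simp
qed

lemma cochain_value_first:
  assumes c: "cochain c" and V: "V \<in> Sec" "W \<in> Sec" "V x = W x" and Vs: "set Vs \<subseteq> Sec"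
  shows "c (V # Vs) x = c (W # Vs) x"
proof -
  let ?Z = "\<lambda>x. V x + (-1) *\<^sub>R W x"
  have mW: "(\<lambda>x. (-1) *\<^sub>R W x) \<in> Sec"
    using section_scale[OF V(2) smooth_functions_const[of "-1"]] by simp
  have "c (?Z # Vs) x = c (V # Vs) x + c ((\<lambda>x. (-1) *\<^sub>R W x) # Vs) x"
    by (subst cochain_add[OF c V(1) mW Vs]) simp
  also have "c ((\<lambda>x. (-1) *\<^sub>R W x) # Vs) x = - c (W # Vs) x"
    by (subst cochain_scale[OF c smooth_functions_const V(2) Vs]) simp
  finally have "c (?Z # Vs) x = c (V # Vs) x - c (W # Vs) x" by simp
  moreover have "c (?Z # Vs) x = 0"
    by (rule cochain_vanish[OF c section_add[OF V(1) mW] _ Vs]) (simp add: V(3))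
  ultimately show ?thesis by simp
qed

text \<open>The arguments are replaced one after the other, each carried to the front and back at
  the cost of cancelling signs.\<close>

lemma cochain_value:
  assumes c: "cochain c" and "set Us \<subseteq> Sec" "set Vs \<subseteq> Sec" "set Ws \<subseteq> Sec"
    and "map (\<lambda>V. V x) Vs = map (\<lambda>V. V x) Ws"
  shows "c (Us @ Vs) x = c (Us @ Ws) x"
  using assms(2-)
proof (induction Vs arbitrary: Us Ws)
  case (Cons V Vs)
  then obtain W Ws' where W: "Ws = W # Ws'" "V x = W x" "map (\<lambda>V. V x) Vs = map (\<lambda>V. V x) Ws'" by auto
  have "(-1) ^ length Us * c (Us @ V # Vs) x = c (V # Us @ Vs) x"
    using Cons.prems by (subst cochain_move[OF c]) auto
  also have "\<dots> = c (W # Us @ Vs) x"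
    using Cons.prems W by (intro cochain_value_first[OF c]) auto
  also have "\<dots> = (-1) ^ length Us * c (Us @ W # Vs) x"
    using Cons.prems W by (subst cochain_move[OF c]) auto
  finally have "c (Us @ V # Vs) x = c ((Us @ [W]) @ Vs) x" by simp
  also have "\<dots> = c ((Us @ [W]) @ Ws') x"
    using Cons.prems W by (intro Cons.IH) auto
  finally show ?case using W by simp
qed simp

text \<open>Converse of \<open>cochain_eval_form\<close>: values at a point depend only on the
  values of the sections there, so the map descends to the fibres. This is how
  \<open>d \<eta>\<close> comes into being as a form.\<close>

lemma cochain_realize:
  assumes c: "cochain c" and bd: "\<And>Vs. set Vs \<subseteq> Sec \<Longrightarrow> n < length Vs \<Longrightarrow> c Vs = (\<lambda>x. 0)"
  obtains \<zeta> where "\<zeta> \<in> \<Omega>" "\<And>Vs. set Vs \<subseteq> Sec \<Longrightarrow> eval_form \<zeta> Vs = c Vs"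
proof
  \<comment> \<open>The sections through \<open>vs\<close> are chosen; \<open>cochain_value\<close>
    makes the choice immaterial. Outside the fibre the value is 0, as \<open>forms\<close>
    prescribes.\<close>
  define \<zeta> where "\<zeta> = (\<lambda>x vs. if set vs \<subseteq> Fib x
    then c (SOME Vs. set Vs \<subseteq> Sec \<and> map (\<lambda>V. V x) Vs = vs) x else 0)"
  have val: "\<zeta> x (map (\<lambda>V. V x) Vs) = c Vs x" if Vs: "set Vs \<subseteq> Sec" for x Vs
  proof -
    define Ws where "Ws = (SOME Ws. set Ws \<subseteq> Sec \<and> map (\<lambda>V. V x) Ws = map (\<lambda>V. V x) Vs)"
    have "set Ws \<subseteq> Sec \<and> map (\<lambda>V. V x) Ws = map (\<lambda>V. V x) Vs"
      unfolding Ws_def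
      by (rule someI[of "\<lambda>Ws. set Ws \<subseteq> Sec \<and> map (\<lambda>V. V x) Ws = map (\<lambda>V. V x) Vs" Vs]) (simp add: Vs)
    then have "c ([] @ Ws) x = c ([] @ Vs) x" using Vs by (intro cochain_value[OF c]) auto
    then show ?thesis
      unfolding \<zeta>_def Ws_def[symmetric] using section_map_in_fibre[OF Vs] by simp
  qed
  show "eval_form \<zeta> Vs = c Vs" if "set Vs \<subseteq> Sec" for Vs
    using val[OF that] by (simp add: eval_form_def fun_eq_iff)
  show "\<zeta> \<in> \<Omega>"
  proof (rule OmegaI[of _ n])
    show "\<zeta> x vs = 0" if "\<not> set vs \<subseteq> Fib x" for x vs using that by (simp add: \<zeta>_def)
    show "\<zeta> x vs = 0" if n: "n < length vs" for x vs
    proof (cases "set vs \<subseteq> Fib x")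
      case True
      then obtain Vs where "set Vs \<subseteq> Sec" "map (\<lambda>V. V x) Vs = vs" using sections_through by blast
      then show ?thesis using val[of Vs x] bd[of Vs] n by auto
    qed (simp add: \<zeta>_def)
    have move: "\<zeta> x (us @ v # w # vs) = - \<zeta> x (us @ w # v # vs)"
      if S: "set (us @ v # w # vs) \<subseteq> Fib x" for x us v w vs
    proof -
      obtain Us where Us: "set Us \<subseteq> Sec" "map (\<lambda>V. V x) Us = us" using sections_through[of us x] S by auto
      obtain Vs where Vs: "set Vs \<subseteq> Sec" "map (\<lambda>V. V x) Vs = vs" using sections_through[of vs x] S by auto
      obtain V where V: "V \<in> Sec" "V x = v" using section_through[of v x] S by auto
      obtain W where W: "W \<in> Sec" "W x = w" using section_through[of w x] S by auto
      show ?thesis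
        using val[of "Us @ V # W # Vs" x] val[of "Us @ W # V # Vs" x]
          cochain_swap[OF c Us(1) V(1) W(1) Vs(1)] Us Vs V W by simp
    qed
    show "alternating_on (Fib x) p (\<zeta> x)" for x p
      unfolding alternating_on_def
    proof (intro conjI allI impI, goal_cases)
      case (1 us vs v w a b)
      obtain Us where Us: "set Us \<subseteq> Sec" "map (\<lambda>V. V x) Us = us" using sections_through[of us x] 1 by auto
      obtain Vs where Vs: "set Vs \<subseteq> Sec" "map (\<lambda>V. V x) Vs = vs" using sections_through[of vs x] 1 by auto
      obtain V where V: "V \<in> Sec" "V x = v" using section_through[of v x] 1 by auto
      obtain W where W: "W \<in> Sec" "W x = w" using section_through[of w x] 1 by auto
      have aV: "(\<lambda>x. a *\<^sub>R V x) \<in> Sec" "(\<lambda>x. b *\<^sub>R W x) \<in> Sec"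
        using section_scale[OF _ smooth_functions_const] V W by auto
      let ?Z = "\<lambda>x. a *\<^sub>R V x + b *\<^sub>R W x"
      have Z: "?Z \<in> Sec" by (rule section_add[OF aV])
      have UV: "set (Us @ Vs) \<subseteq> Sec" using Us Vs by simp
      have "c (?Z # Us @ Vs) x = a * c (V # Us @ Vs) x + b * c (W # Us @ Vs) x"
        using cochain_add[OF c aV UV] cochain_scale[OF c smooth_functions_const V(1) UV]
          cochain_scale[OF c smooth_functions_const W(1) UV] by simp
      then have "(-1) ^ length Us * c (Us @ ?Z # Vs) x =
          (-1) ^ length Us * (a * c (Us @ V # Vs) x + b * c (Us @ W # Vs) x)"
        by (simp add: cochain_move[OF c Us(1) _ Vs(1)] Z V W algebra_simps)
      then show ?case
        using val[of "Us @ ?Z # Vs" x] val[of "Us @ V # Vs" x] val[of "Us @ W # Vs" x] Us Vs V W Z by simp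
    next
      case (2 us vs ws v w)
      then show ?case
        by (intro adjacent_swap_imp_swap[of "Fib x"] move) auto
    qed
    fix U \<theta> ws assume U: "(U, \<theta>) \<in> Frm"
    show "msmooth At U (\<lambda>x. \<zeta> x (map (\<theta> x) ws))"
    proof (rule msmooth_localI[OF frame_open[OF U]])
      fix x assume x: "x \<in> U"
      obtain h N where h: "open N" "x \<in> N" "N \<subseteq> U" "\<And>x. x \<in> N \<Longrightarrow> h x = 1" "\<And>w. extend h U (\<lambda>x. \<theta> x w) \<in> Sec"
        using local_extension[OF U x] by metis
      \<comment> \<open>Constant frame vectors, extended to global sections, turn the coefficient
        near \<open>x\<close> into the smooth function \<open>c Ws\<close>.\<close>
      define Ws where "Ws = map (\<lambda>w. extend h U (\<lambda>x. \<theta> x w)) ws"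
      have "set Ws \<subseteq> Sec" using h(5) by (auto simp: Ws_def)
      moreover have "map (\<lambda>V. V y) Ws = map (\<theta> y) ws" if "y \<in> N" for y
        using h(3,4) that by (auto simp: Ws_def extend_def)
      ultimately have "\<forall>y\<in>U \<inter> N. \<zeta> y (map (\<theta> y) ws) = c Ws y" "c Ws \<in> C"
        using val[of Ws] cochain_smooth[OF c, of Ws] by (metis IntD2, blast)
      then show "\<exists>N g'. open N \<and> x \<in> N \<and> msmooth At (U \<inter> N) g' \<and>
          (\<forall>y\<in>U \<inter> N. \<zeta> y (map (\<theta> y) ws) = g' y)"
        using h(1,2) smooth_functions_msmooth by blast
    qed
  qed
qed


section \<open>Lie derivative and exterior derivative of cochains\<close>

text \<open>Both operators are defined by recursion on the list of arguments, through
  \<open>i(W) \<circ> L(V) = L(V) \<circ> i(W) - i({V, W})\<close> and \<open>i(W) \<circ> d = L(W) - d \<circ> i(W)\<close>. This turns all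
  identities of Cartan's calculus into inductions over that list.\<close>

type_synonym ('n, 'u) cochain = "('n \<Rightarrow> 'u) list \<Rightarrow> 'n \<Rightarrow> real"

fun cochain_lie :: "('m \<Rightarrow> 'v) \<Rightarrow> ('m, 'v) cochain \<Rightarrow> ('m, 'v) cochain" where
  "cochain_lie V c [] = act V (c [])"
| "cochain_lie V c (W # Vs) = (\<lambda>x. cochain_lie V (\<lambda>Us. c (W # Us)) Vs x - c (br V W # Vs) x)"

fun cochain_d :: "('m, 'v) cochain \<Rightarrow> ('m, 'v) cochain" where
  "cochain_d c [] = (\<lambda>x. 0)"
| "cochain_d c (W # Vs) = (\<lambda>x. cochain_lie W c Vs x - cochain_d (\<lambda>Us. c (W # Us)) Vs x)"

text \<open>\<open>act V\<close> is linear on smooth functions only. This is the part of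
  \<open>cochain\<close> that linearity needs, and it passes to \<open>cochain_lie V c\<close> and
  \<open>cochain_d c\<close> without a proof of multilinearity.\<close>

definition smooth_valued :: "('m, 'v) cochain \<Rightarrow> bool" where
  "smooth_valued c \<longleftrightarrow> (\<forall>Vs. set Vs \<subseteq> Sec \<longrightarrow> c Vs \<in> C)"

lemma smooth_valuedD: "smooth_valued c \<Longrightarrow> set Vs \<subseteq> Sec \<Longrightarrow> c Vs \<in> C"
  by (simp add: smooth_valued_def)

lemma smooth_valued_insert: "smooth_valued c \<Longrightarrow> U \<in> Sec \<Longrightarrow> smooth_valued (\<lambda>Us. c (U # Us))"
  by (simp add: smooth_valued_def)

lemma smooth_valued_insert2:
  "smooth_valued c \<Longrightarrow> V \<in> Sec \<Longrightarrow> W \<in> Sec \<Longrightarrow> smooth_valued (\<lambda>Us. c (V # W # Us))"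
  by (simp add: smooth_valued_def)

lemma cochain_smooth_valued: "cochain c \<Longrightarrow> smooth_valued c"
  by (simp add: smooth_valued_def cochain_smooth)

text \<open>The new first argument is the second argument of \<open>c\<close>, reached by one
  exchange with \<open>U\<close>.\<close>

lemma cochain_insert:
  assumes c: "cochain c" and U: "U \<in> Sec"
  shows "cochain (\<lambda>Us. c (U # Us))"
  unfolding cochain_def
proof (intro conjI allI ballI impI, goal_cases)
  case (1 Vs)
  then show ?case using cochain_smooth[OF c] U by simp
next
  case (2 V W Vs)
  have sw: "c (U # X # Vs) = (\<lambda>x. - c (X # U # Vs) x)" if "X \<in> Sec" for X
    using cochain_swap[OF c, of "[]" U X Vs] 2 U that by simp
  show ?case
    using cochain_add[OF c, of V W "U # Vs"] 2 U by (simp add: sw section_add)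
next
  case (3 V Vs f)
  have sw: "c (U # X # Vs) = (\<lambda>x. - c (X # U # Vs) x)" if "X \<in> Sec" for X
    using cochain_swap[OF c, of "[]" U X Vs] 3 U that by simp
  show ?case
    using cochain_scale[OF c, of f V "U # Vs"] 3 U by (simp add: sw section_scale)
next
  case (4 Us V W Vs)
  then show ?case using cochain_swap[OF c, of "U # Us" V W Vs] U by simp
qed

text \<open>The recursion evaluates \<open>c\<close> on lists of sections only, brackets of sections
  being sections; elsewhere \<open>c\<close> may be arbitrary.\<close>

lemma cochain_lie_cong:
  "(\<And>Us. set Us \<subseteq> Sec \<Longrightarrow> c Us = c' Us) \<Longrightarrow> V \<in> Sec \<Longrightarrow> set Vs \<subseteq> Sec \<Longrightarrow>
    cochain_lie V c Vs = cochain_lie V c' Vs"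
proof (induction Vs arbitrary: c c')
  case (Cons W Vs)
  have "cochain_lie V (\<lambda>Us. c (W # Us)) Vs = cochain_lie V (\<lambda>Us. c' (W # Us)) Vs"
    by (rule Cons.IH) (use Cons.prems in auto)
  then show ?case using Cons.prems bracket_section by simp
qed simp

lemma cochain_d_cong:
  "(\<And>Us. set Us \<subseteq> Sec \<Longrightarrow> c Us = c' Us) \<Longrightarrow> set Vs \<subseteq> Sec \<Longrightarrow> cochain_d c Vs = cochain_d c' Vs"
proof (induction Vs arbitrary: c c')
  case (Cons W Vs)
  have "cochain_d (\<lambda>Us. c (W # Us)) Vs = cochain_d (\<lambda>Us. c' (W # Us)) Vs"
    by (rule Cons.IH) (use Cons.prems in auto)
  moreover have "cochain_lie W c Vs = cochain_lie W c' Vs"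
    by (rule cochain_lie_cong) (use Cons.prems in auto)
  ultimately show ?case by simp
qed simp

lemma cochain_lie_smooth: "smooth_valued c \<Longrightarrow> V \<in> Sec \<Longrightarrow> smooth_valued (cochain_lie V c)"
proof -
  have "set Vs \<subseteq> Sec \<Longrightarrow> smooth_valued c \<Longrightarrow> V \<in> Sec \<Longrightarrow> cochain_lie V c Vs \<in> C" for Vs
  proof (induction Vs arbitrary: c)
    case (Cons W Vs)
    then have "cochain_lie V (\<lambda>Us. c (W # Us)) Vs \<in> C"
      by (intro Cons.IH smooth_valued_insert[of c W]) auto
    moreover have "c (br V W # Vs) \<in> C"
      using Cons.prems bracket_section by (intro smooth_valuedD) auto
    ultimately show ?case by (simp add: smooth_functions_diff)
  qed (simp add: act_smooth smooth_valuedD)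
  then show "smooth_valued c \<Longrightarrow> V \<in> Sec \<Longrightarrow> smooth_valued (cochain_lie V c)"
    by (simp add: smooth_valued_def[of "cochain_lie V c"])
qed

lemma cochain_d_smooth: "smooth_valued c \<Longrightarrow> smooth_valued (cochain_d c)"
proof -
  have "set Vs \<subseteq> Sec \<Longrightarrow> smooth_valued c \<Longrightarrow> cochain_d c Vs \<in> C" for Vs
  proof (induction Vs arbitrary: c)
    case (Cons W Vs)
    then have "cochain_d (\<lambda>Us. c (W # Us)) Vs \<in> C"
      by (intro Cons.IH smooth_valued_insert[of c W]) auto
    moreover have "cochain_lie W c Vs \<in> C"
      using Cons.prems by (intro smooth_valuedD[OF cochain_lie_smooth]) auto
    ultimately show ?case by (simp add: smooth_functions_diff)
  qed (simp add: smooth_functions_const)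
  then show "smooth_valued c \<Longrightarrow> smooth_valued (cochain_d c)"
    by (simp add: smooth_valued_def[of "cochain_d c"])
qed

lemma cochain_lie_linear:
  "smooth_valued c \<Longrightarrow> smooth_valued c' \<Longrightarrow> V \<in> Sec \<Longrightarrow> set Vs \<subseteq> Sec \<Longrightarrow>
    cochain_lie V (\<lambda>Us x. a * c Us x + b * c' Us x) Vs =
      (\<lambda>x. a * cochain_lie V c Vs x + b * cochain_lie V c' Vs x)"
proof (induction Vs arbitrary: c c')
  case Nil
  then show ?case using act_combination smooth_valuedD by auto
next
  case (Cons W Vs)
  have "cochain_lie V (\<lambda>Us x. a * c (W # Us) x + b * c' (W # Us) x) Vs =
      (\<lambda>x. a * cochain_lie V (\<lambda>Us. c (W # Us)) Vs x + b * cochain_lie V (\<lambda>Us. c' (W # Us)) Vs x)"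
    by (rule Cons.IH) (use Cons.prems in \<open>auto intro: smooth_valued_insert\<close>)
  then show ?case by (simp add: algebra_simps)
qed

lemma cochain_d_linear:
  "smooth_valued c \<Longrightarrow> smooth_valued c' \<Longrightarrow> set Vs \<subseteq> Sec \<Longrightarrow>
    cochain_d (\<lambda>Us x. a * c Us x + b * c' Us x) Vs =
      (\<lambda>x. a * cochain_d c Vs x + b * cochain_d c' Vs x)"
proof (induction Vs arbitrary: c c')
  case (Cons W Vs)
  have "cochain_d (\<lambda>Us x. a * c (W # Us) x + b * c' (W # Us) x) Vs =
      (\<lambda>x. a * cochain_d (\<lambda>Us. c (W # Us)) Vs x + b * cochain_d (\<lambda>Us. c' (W # Us)) Vs x)"
    by (rule Cons.IH) (use Cons.prems in \<open>auto intro: smooth_valued_insert\<close>)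
  moreover have "cochain_lie W (\<lambda>Us x. a * c Us x + b * c' Us x) Vs =
      (\<lambda>x. a * cochain_lie W c Vs x + b * cochain_lie W c' Vs x)"
    by (rule cochain_lie_linear) (use Cons.prems in auto)
  ultimately show ?case by (simp add: algebra_simps)
qed simp

lemma cochain_lie_diff:
  assumes "smooth_valued c" "smooth_valued c'" "V \<in> Sec" "set Vs \<subseteq> Sec"
  shows "cochain_lie V (\<lambda>Us x. c Us x - c' Us x) Vs =
    (\<lambda>x. cochain_lie V c Vs x - cochain_lie V c' Vs x)"
  using cochain_lie_linear[OF assms, of 1 "-1"] by simp

lemma cochain_d_diff:
  assumes "smooth_valued c" "smooth_valued c'" "set Vs \<subseteq> Sec"
  shows "cochain_d (\<lambda>Us x. c Us x - c' Us x) Vs = (\<lambda>x. cochain_d c Vs x - cochain_d c' Vs x)"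
  using cochain_d_linear[OF assms, of 1 "-1"] by simp

lemma cochain_lie_minus:
  assumes "smooth_valued c" "V \<in> Sec" "set Vs \<subseteq> Sec"
  shows "cochain_lie V (\<lambda>Us x. - c Us x) Vs = (\<lambda>x. - cochain_lie V c Vs x)"
  using cochain_lie_linear[OF assms(1,1,2,3), of "-1" 0] by simp

lemma cochain_d_minus:
  assumes "smooth_valued c" "set Vs \<subseteq> Sec"
  shows "cochain_d (\<lambda>Us x. - c Us x) Vs = (\<lambda>x. - cochain_d c Vs x)"
  using cochain_d_linear[OF assms(1,1,2), of "-1" 0] by simp

section \<open>Skew symmetry and linearity over functions of the exterior derivative\<close>

lemma cochain_swap_first:
  "cochain c \<Longrightarrow> V \<in> Sec \<Longrightarrow> W \<in> Sec \<Longrightarrow> set Vs \<subseteq> Sec \<Longrightarrow> c (V # W # Vs) = (\<lambda>x. - c (W # V # Vs) x)"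
  using cochain_swap[of c "[]" V W Vs] by simp

text \<open>Only the exchange of the first two arguments has content: the bracket terms
  \<open>c (br V W1 # W2 # Vs)\<close> and \<open>c (W1 # br V W2 # Vs)\<close> trade roles.\<close>

lemma cochain_lie_swap:
  assumes "V \<in> Sec" "W1 \<in> Sec" "W2 \<in> Sec" "set Vs \<subseteq> Sec"
  shows "cochain c \<Longrightarrow> set Us \<subseteq> Sec \<Longrightarrow>
    cochain_lie V c (Us @ W1 # W2 # Vs) = (\<lambda>x. - cochain_lie V c (Us @ W2 # W1 # Vs) x)"
proof (induction Us arbitrary: c)
  case Nil
  have "cochain_lie V (\<lambda>Us. c (W1 # W2 # Us)) Vs = cochain_lie V (\<lambda>Us x. - c (W2 # W1 # Us) x) Vs"
    by (rule cochain_lie_cong[OF cochain_swap_first[OF Nil(1) assms(2,3)] assms(1,4)])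
  also have "\<dots> = (\<lambda>x. - cochain_lie V (\<lambda>Us. c (W2 # W1 # Us)) Vs x)"
    by (rule cochain_lie_minus[OF smooth_valued_insert2[OF cochain_smooth_valued[OF Nil(1)]]])
      (use assms in auto)
  finally show ?case
    using cochain_swap_first[OF Nil(1), of W1 "br V W2" Vs] cochain_swap_first[OF Nil(1), of W2 "br V W1" Vs]
      assms by (simp add: bracket_section fun_eq_iff)
next
  case (Cons U Us)
  have "cochain_lie V (\<lambda>Us. c (U # Us)) (Us @ W1 # W2 # Vs) =
      (\<lambda>x. - cochain_lie V (\<lambda>Us. c (U # Us)) (Us @ W2 # W1 # Vs) x)"
    by (rule Cons.IH) (use Cons.prems cochain_insert in auto)
  moreover have "c ((br V U # Us) @ W1 # W2 # Vs) = (\<lambda>x. - c ((br V U # Us) @ W2 # W1 # Vs) x)"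
    by (rule cochain_swap) (use Cons.prems assms bracket_section in auto)
  ultimately show ?case by (simp add: fun_eq_iff)
qed

text \<open>Unfolded twice, the derivative reads L(W1) i(W2) c - L(W2) i(W1) c - i({W1, W2}) c + d
  i(W2) i(W1) c: the first two terms trade places, the others are skew by themselves.\<close>

lemma cochain_d_swap:
  assumes "W1 \<in> Sec" "W2 \<in> Sec" "set Vs \<subseteq> Sec"
  shows "cochain c \<Longrightarrow> set Us \<subseteq> Sec \<Longrightarrow>
    cochain_d c (Us @ W1 # W2 # Vs) = (\<lambda>x. - cochain_d c (Us @ W2 # W1 # Vs) x)"
proof (induction Us arbitrary: c)
  case Nil
  have "cochain_d (\<lambda>Us. c (W1 # W2 # Us)) Vs = cochain_d (\<lambda>Us x. - c (W2 # W1 # Us) x) Vs"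
    by (rule cochain_d_cong[OF cochain_swap_first[OF Nil(1) assms(1,2)] assms(3)])
  also have "\<dots> = (\<lambda>x. - cochain_d (\<lambda>Us. c (W2 # W1 # Us)) Vs x)"
    by (rule cochain_d_minus[OF smooth_valued_insert2[OF cochain_smooth_valued[OF Nil(1)]]])
      (use assms in auto)
  moreover have "c (br W1 W2 # Vs) = (\<lambda>x. - c (br W2 W1 # Vs) x)"
    using cochain_scale[OF Nil(1) smooth_functions_const[of "-1"] bracket_section[OF assms(2,1)] assms(3)]
      bracket_skew[OF assms(1,2)] by simp
  ultimately show ?case by (simp add: fun_eq_iff)
next
  case (Cons U Us)
  have "cochain_d (\<lambda>Us. c (U # Us)) (Us @ W1 # W2 # Vs) =
      (\<lambda>x. - cochain_d (\<lambda>Us. c (U # Us)) (Us @ W2 # W1 # Vs) x)"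
    by (rule Cons.IH) (use Cons.prems cochain_insert in auto)
  then show ?case
    using cochain_lie_swap[OF _ assms, of U c Us] Cons.prems by (simp add: fun_eq_iff)
qed

lemma cochain_lie_add:
  "V \<in> Sec \<Longrightarrow> V' \<in> Sec \<Longrightarrow> cochain c \<Longrightarrow> set Vs \<subseteq> Sec \<Longrightarrow>
    cochain_lie (\<lambda>x. V x + V' x) c Vs = (\<lambda>x. cochain_lie V c Vs x + cochain_lie V' c Vs x)"
proof (induction Vs arbitrary: c)
  case Nil
  then show ?case using act_combination_left[of V V' "\<lambda>x. 1" "\<lambda>x. 1"] by simp
next
  case (Cons W Vs)
  have "cochain_lie (\<lambda>x. V x + V' x) (\<lambda>Us. c (W # Us)) Vs =
      (\<lambda>x. cochain_lie V (\<lambda>Us. c (W # Us)) Vs x + cochain_lie V' (\<lambda>Us. c (W # Us)) Vs x)"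
    by (rule Cons.IH) (use Cons.prems cochain_insert in auto)
  moreover have "c (br (\<lambda>x. V x + V' x) W # Vs) = (\<lambda>x. c (br V W # Vs) x + c (br V' W # Vs) x)"
    using Cons.prems by (simp add: bracket_add_left bracket_section cochain_add)
  ultimately show ?case by (simp add: fun_eq_iff)
qed

lemma cochain_lie_mult:
  "f \<in> C \<Longrightarrow> V \<in> Sec \<Longrightarrow> smooth_valued c \<Longrightarrow> set Vs \<subseteq> Sec \<Longrightarrow>
    cochain_lie V (\<lambda>Us x. f x * c Us x) Vs = (\<lambda>x. f x * cochain_lie V c Vs x + act V f x * c Vs x)"
proof (induction Vs arbitrary: c)
  case Nil
  then show ?case using act_mult[of V f "c []"] smooth_valuedD[of c "[]"] by (simp add: mult.commute)
next
  case (Cons W Vs)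
  have "cochain_lie V (\<lambda>Us x. f x * c (W # Us) x) Vs =
      (\<lambda>x. f x * cochain_lie V (\<lambda>Us. c (W # Us)) Vs x + act V f x * c (W # Vs) x)"
    by (rule Cons.IH) (use Cons.prems smooth_valued_insert in auto)
  then show ?case by (simp add: algebra_simps)
qed

text \<open>The defect of \<open>d(f c) = f d c\<close>, that is \<open>df \<and> c\<close>.\<close>

definition cochain_e :: "('m \<Rightarrow> real) \<Rightarrow> ('m, 'v) cochain \<Rightarrow> ('m, 'v) cochain" where
  "cochain_e f c Vs = (\<lambda>x. cochain_d (\<lambda>Us x. f x * c Us x) Vs x - f x * cochain_d c Vs x)"

lemma cochain_e_Nil: "cochain_e f c [] = (\<lambda>x. 0)"
  by (simp add: cochain_e_def)

text \<open>The derivatives of \<open>c\<close> cancel in the defect, and the antiderivation rule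
  i(U) (df \<and> c) = U(f) c - df \<and> i(U) c remains.\<close>

lemma cochain_e_Cons:
  assumes "f \<in> C" "smooth_valued c" "U \<in> Sec" "set Vs \<subseteq> Sec"
  shows "cochain_e f c (U # Vs) = (\<lambda>x. act U f x * c Vs x - cochain_e f (\<lambda>Us. c (U # Us)) Vs x)"
  using assms by (simp add: cochain_e_def cochain_lie_mult algebra_simps)

lemma smooth_valued_mult: "smooth_valued c \<Longrightarrow> f \<in> C \<Longrightarrow> smooth_valued (\<lambda>Us x. f x * c Us x)"
  by (simp add: smooth_valued_def smooth_functions_mult)

lemma cochain_e_swap_first:
  assumes "f \<in> C" "cochain c" "V \<in> Sec" "W \<in> Sec" "set Vs \<subseteq> Sec"
  shows "cochain_e f (\<lambda>Us. c (V # W # Us)) Vs = (\<lambda>x. - cochain_e f (\<lambda>Us. c (W # V # Us)) Vs x)"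
proof -
  have sm: "smooth_valued (\<lambda>Us. c (W # V # Us))"
    by (rule smooth_valued_insert2[OF cochain_smooth_valued]) (use assms in auto)
  have "cochain_d (\<lambda>Us. c (V # W # Us)) Vs = cochain_d (\<lambda>Us x. - c (W # V # Us) x) Vs"
    by (rule cochain_d_cong) (simp_all add: cochain_swap_first[OF assms(2,3,4)] assms(5))
  moreover have "cochain_d (\<lambda>Us x. f x * c (V # W # Us) x) Vs = cochain_d (\<lambda>Us x. - (f x * c (W # V # Us) x)) Vs"
    by (rule cochain_d_cong) (simp_all add: cochain_swap_first[OF assms(2,3,4)] assms(5))
  ultimately show ?thesis
    using cochain_d_minus[OF sm assms(5)] cochain_d_minus[OF smooth_valued_mult[OF sm assms(1)] assms(5)]
    by (simp add: cochain_e_def algebra_simps)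
qed

text \<open>L(f W) = f L(W) + df \<and> i(W). The second term is what d(f i(W) c) contributes beyond
  f d i(W) c, and the two cancel in the first argument of \<open>cochain_d c\<close>.\<close>

lemma cochain_lie_scale:
  "f \<in> C \<Longrightarrow> W \<in> Sec \<Longrightarrow> cochain c \<Longrightarrow> set Vs \<subseteq> Sec \<Longrightarrow>
    cochain_lie (\<lambda>x. f x *\<^sub>R W x) c Vs =
      (\<lambda>x. f x * cochain_lie W c Vs x + cochain_e f (\<lambda>Us. c (W # Us)) Vs x)"
proof (induction Vs arbitrary: c)
  case Nil
  then show ?case using act_combination_left[of W W f "\<lambda>x. 0"] by (simp add: cochain_e_Nil)
next
  case (Cons U Vs)
  have IH: "cochain_lie (\<lambda>x. f x *\<^sub>R W x) (\<lambda>Us. c (U # Us)) Vs =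
      (\<lambda>x. f x * cochain_lie W (\<lambda>Us. c (U # Us)) Vs x + cochain_e f (\<lambda>Us. c (U # W # Us)) Vs x)"
    using Cons.prems cochain_insert by (intro Cons.IH) auto
  have "c (br (\<lambda>x. f x *\<^sub>R W x) U # Vs) =
      c ((\<lambda>x. (\<lambda>x. f x *\<^sub>R br W U x) x + (\<lambda>x. (- act U f x) *\<^sub>R W x) x) # Vs)"
    using Cons.prems by (simp add: bracket_scale_left)
  also have "\<dots> = (\<lambda>x. c ((\<lambda>x. f x *\<^sub>R br W U x) # Vs) x + c ((\<lambda>x. (- act U f x) *\<^sub>R W x) # Vs) x)"
    using Cons.prems by (intro cochain_add section_scale bracket_section smooth_functions_minus act_smooth) auto
  also have "c ((\<lambda>x. f x *\<^sub>R br W U x) # Vs) = (\<lambda>x. f x * c (br W U # Vs) x)"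
    using Cons.prems by (intro cochain_scale bracket_section) auto
  also have "c ((\<lambda>x. (- act U f x) *\<^sub>R W x) # Vs) = (\<lambda>x. (- act U f x) * c (W # Vs) x)"
    using Cons.prems by (intro cochain_scale smooth_functions_minus act_smooth) auto
  finally have br: "c (br (\<lambda>x. f x *\<^sub>R W x) U # Vs) = (\<lambda>x. f x * c (br W U # Vs) x + (- act U f x) * c (W # Vs) x)" .
  have "cochain_e f (\<lambda>Us. c (W # Us)) (U # Vs) =
      (\<lambda>x. act U f x * c (W # Vs) x - cochain_e f (\<lambda>Us. c (W # U # Us)) Vs x)"
    using Cons.prems by (intro cochain_e_Cons smooth_valued_insert cochain_smooth_valued) auto
  moreover have "cochain_e f (\<lambda>Us. c (U # W # Us)) Vs = (\<lambda>x. - cochain_e f (\<lambda>Us. c (W # U # Us)) Vs x)"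
    using Cons.prems by (intro cochain_e_swap_first) auto
  ultimately show ?case using IH br by (simp add: algebra_simps)
qed

lemma cochain_cochain_d:
  assumes c: "cochain c"
  shows "cochain (cochain_d c)"
  unfolding cochain_def
proof (intro conjI allI ballI impI, goal_cases)
  case (1 Vs)
  then show ?case using cochain_d_smooth[OF cochain_smooth_valued[OF c]] smooth_valuedD by blast
next
  case (2 V W Vs)
  then have S: "V \<in> Sec" "W \<in> Sec" "set Vs \<subseteq> Sec" by auto
  have "cochain_d (\<lambda>Us. c ((\<lambda>x. V x + W x) # Us)) Vs =
      cochain_d (\<lambda>Us x. 1 * c (V # Us) x + 1 * c (W # Us) x) Vs"
    by (rule cochain_d_cong) (use S cochain_add[OF c] in auto)
  also have "\<dots> = (\<lambda>x. 1 * cochain_d (\<lambda>Us. c (V # Us)) Vs x + 1 * cochain_d (\<lambda>Us. c (W # Us)) Vs x)"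
    by (intro cochain_d_linear smooth_valued_insert cochain_smooth_valued c S)
  finally show ?case
    using cochain_lie_add[OF S(1,2) c S(3)] by (simp add: fun_eq_iff)
next
  case (3 V Vs f)
  then have S: "V \<in> Sec" "set Vs \<subseteq> Sec" by auto
  have "cochain_d (\<lambda>Us. c ((\<lambda>x. f x *\<^sub>R V x) # Us)) Vs = cochain_d (\<lambda>Us x. f x * c (V # Us) x) Vs"
    by (rule cochain_d_cong) (use S 3 cochain_scale[OF c] in auto)
  then show ?case
    using cochain_lie_scale[OF 3(1) S(1) c S(2)] by (simp add: cochain_e_def algebra_simps)
next
  case (4 Us V W Vs)
  then show ?case by (intro cochain_d_swap c) auto
qed

section \<open>Commutation relations of L and d, and d d = 0\<close>

lemma cochain_lie_commute:
  "V \<in> Sec \<Longrightarrow> W \<in> Sec \<Longrightarrow> cochain c \<Longrightarrow> set Vs \<subseteq> Sec \<Longrightarrow>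
    cochain_lie (br V W) c Vs =
      (\<lambda>x. cochain_lie V (cochain_lie W c) Vs x - cochain_lie W (cochain_lie V c) Vs x)"
proof (induction Vs arbitrary: c)
  case Nil
  then show ?case using act_bracket cochain_smooth by simp
next
  case (Cons U Vs)
  then have S: "V \<in> Sec" "W \<in> Sec" "U \<in> Sec" "set Vs \<subseteq> Sec" and c: "cochain c" by auto
  \<comment> \<open>The two middle terms together are symmetric in \<open>X\<close> and
    \<open>Y\<close> and drop out of the commutator; the double brackets are left for the Jacobi
    identity.\<close>
  have exp: "cochain_lie X (cochain_lie Y c) (U # Vs) =
      (\<lambda>x. cochain_lie X (cochain_lie Y (\<lambda>Us. c (U # Us))) Vs x - cochain_lie X (\<lambda>Us. c (br Y U # Us)) Vs x
        - cochain_lie Y (\<lambda>Us. c (br X U # Us)) Vs x + c (br Y (br X U) # Vs) x)"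
    if "X \<in> Sec" "Y \<in> Sec" for X Y
  proof -
    have "cochain_lie X (\<lambda>Us. cochain_lie Y c (U # Us)) Vs =
        (\<lambda>x. cochain_lie X (cochain_lie Y (\<lambda>Us. c (U # Us))) Vs x - cochain_lie X (\<lambda>Us. c (br Y U # Us)) Vs x)"
      unfolding cochain_lie.simps
      by (intro cochain_lie_diff cochain_lie_smooth smooth_valued_insert cochain_smooth_valued
          bracket_section c S that)
    then show ?thesis by (simp add: algebra_simps)
  qed
  have IH: "cochain_lie (br V W) (\<lambda>Us. c (U # Us)) Vs = (\<lambda>x. cochain_lie V (cochain_lie W (\<lambda>Us. c (U # Us))) Vs x
      - cochain_lie W (cochain_lie V (\<lambda>Us. c (U # Us))) Vs x)"
    by (rule Cons.IH[OF S(1,2) cochain_insert[OF c S(3)] S(4)])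
  have "c (br (br V W) U # Vs) = c ((\<lambda>x. br V (br W U) x + (\<lambda>x. (-1) *\<^sub>R br W (br V U) x) x) # Vs)"
    using bracket_jacobi[OF S(1,2,3)] by simp
  also have "\<dots> = (\<lambda>x. c (br V (br W U) # Vs) x + c ((\<lambda>x. (-1) *\<^sub>R br W (br V U) x) # Vs) x)"
    by (intro cochain_add section_scale[OF _ smooth_functions_const] bracket_section c S)
  also have "\<dots> = (\<lambda>x. c (br V (br W U) # Vs) x - c (br W (br V U) # Vs) x)"
    using cochain_scale[OF c smooth_functions_const[of "-1"] bracket_section[OF S(2) bracket_section[OF S(1,3)]] S(4)]
    by simp
  finally show ?case using IH exp[OF S(1,2)] exp[OF S(2,1)] by (simp add: fun_eq_iff)
qed

text \<open>After inserting \<open>U\<close>, the induction hypothesis matches d L(V) i(U) with L(V)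
  d i(U), the terms d i({V, U}) agree, and what remains is the commutator formula for L(V) and
  L(U).\<close>

lemma cochain_lie_d_commute:
  "V \<in> Sec \<Longrightarrow> cochain c \<Longrightarrow> set Vs \<subseteq> Sec \<Longrightarrow> cochain_d (cochain_lie V c) Vs = cochain_lie V (cochain_d c) Vs"
proof (induction Vs arbitrary: c)
  case Nil
  then show ?case by (simp add: act_zero)
next
  case (Cons U Vs)
  then have S: "V \<in> Sec" "U \<in> Sec" "set Vs \<subseteq> Sec" and c: "cochain c" by auto
  have IH: "cochain_d (cochain_lie V (\<lambda>Us. c (U # Us))) Vs = cochain_lie V (cochain_d (\<lambda>Us. c (U # Us))) Vs"
    by (rule Cons.IH[OF S(1) cochain_insert[OF c S(2)] S(3)])
  have "cochain_d (\<lambda>Us. cochain_lie V c (U # Us)) Vs =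
      (\<lambda>x. cochain_d (cochain_lie V (\<lambda>Us. c (U # Us))) Vs x - cochain_d (\<lambda>Us. c (br V U # Us)) Vs x)"
    unfolding cochain_lie.simps
    by (intro cochain_d_diff cochain_lie_smooth smooth_valued_insert cochain_smooth_valued bracket_section c S)
  moreover have "cochain_lie V (\<lambda>Us. cochain_d c (U # Us)) Vs =
      (\<lambda>x. cochain_lie V (cochain_lie U c) Vs x - cochain_lie V (cochain_d (\<lambda>Us. c (U # Us))) Vs x)"
    unfolding cochain_d.simps
    by (intro cochain_lie_diff cochain_lie_smooth cochain_d_smooth smooth_valued_insert cochain_smooth_valued c S)
  ultimately show ?case
    using IH cochain_lie_commute[OF S(1,2) c S(3)] by (simp add: fun_eq_iff)
qed

text \<open>i(U) d d = L(U) d - d i(U) d = L(U) d - d L(U) + d d i(U); the first two terms cancel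
  and the last falls under the induction hypothesis.\<close>

lemma cochain_d_d:
  "cochain c \<Longrightarrow> set Vs \<subseteq> Sec \<Longrightarrow> cochain_d (cochain_d c) Vs = (\<lambda>x. 0)"
proof (induction Vs arbitrary: c)
  case (Cons U Vs)
  then have S: "U \<in> Sec" "set Vs \<subseteq> Sec" and c: "cochain c" by auto
  have "cochain_d (\<lambda>Us. cochain_d c (U # Us)) Vs =
      (\<lambda>x. cochain_d (cochain_lie U c) Vs x - cochain_d (cochain_d (\<lambda>Us. c (U # Us))) Vs x)"
    unfolding cochain_d.simps
    by (intro cochain_d_diff cochain_lie_smooth cochain_d_smooth smooth_valued_insert cochain_smooth_valued c S)
  then show ?case
    using Cons.IH[OF cochain_insert[OF c S(1)] S(2)] cochain_lie_d_commute[OF S(1) c S(2)] by simp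
qed simp

section \<open>Degree bounds and agreement with the classical alternating sum\<close>

lemma cochain_lie_bounded:
  "V \<in> Sec \<Longrightarrow> set Vs \<subseteq> Sec \<Longrightarrow> (\<And>Us. set Us \<subseteq> Sec \<Longrightarrow> length Vs \<le> length Us \<Longrightarrow> c Us = (\<lambda>x. 0)) \<Longrightarrow>
    cochain_lie V c Vs = (\<lambda>x. 0)"
proof (induction Vs arbitrary: c)
  case Nil
  then show ?case by (simp add: act_zero)
next
  case (Cons W Vs)
  have "cochain_lie V (\<lambda>Us. c (W # Us)) Vs = (\<lambda>x. 0)"
    by (rule Cons.IH) (use Cons.prems in auto)
  then show ?case using Cons.prems bracket_section by simp
qed

lemma cochain_d_bounded:
  "set Vs \<subseteq> Sec \<Longrightarrow> (\<And>Us. set Us \<subseteq> Sec \<Longrightarrow> length Vs \<le> Suc (length Us) \<Longrightarrow> c Us = (\<lambda>x. 0)) \<Longrightarrow>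
    cochain_d c Vs = (\<lambda>x. 0)"
proof (induction Vs arbitrary: c)
  case (Cons W Vs)
  have "cochain_d (\<lambda>Us. c (W # Us)) Vs = (\<lambda>x. 0)"
    by (rule Cons.IH) (use Cons.prems in auto)
  moreover have "cochain_lie W c Vs = (\<lambda>x. 0)"
    by (rule cochain_lie_bounded) (use Cons.prems in auto)
  ultimately show ?case by simp
qed simp

lemma omit_0 [simp]: "omit 0 (V # Vs) = Vs"
  and omit_Suc [simp]: "omit (Suc i) (V # Vs) = V # omit i Vs"
  by (simp_all add: omit_def)

lemma set_omit: "set (omit i Vs) \<subseteq> set Vs"
  unfolding omit_def using set_take_subset set_drop_subset by fastforce

text \<open>The recursion leaves the bracket in the position of the argument it replaces; carrying
  it to the front gives the sign (-1)^j.\<close>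

lemma cochain_lie_expand:
  "V \<in> Sec \<Longrightarrow> cochain c \<Longrightarrow> set Vs \<subseteq> Sec \<Longrightarrow>
    cochain_lie V c Vs x = act V (c Vs) x - (\<Sum>j<length Vs. (-1) ^ j * c (br V (Vs ! j) # omit j Vs) x)"
proof (induction Vs arbitrary: c)
  case (Cons W Vs)
  then have S: "V \<in> Sec" "W \<in> Sec" "set Vs \<subseteq> Sec" and c: "cochain c" by auto
  have IH: "cochain_lie V (\<lambda>Us. c (W # Us)) Vs x = act V (c (W # Vs)) x -
      (\<Sum>j<length Vs. (-1) ^ j * c (W # br V (Vs ! j) # omit j Vs) x)"
    by (rule Cons.IH[OF S(1) cochain_insert[OF c S(2)] S(3)])
  have sw: "c (W # br V (Vs ! j) # omit j Vs) x = - c (br V (Vs ! j) # W # omit j Vs) x" if "j < length Vs" for j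
    using cochain_swap_first[OF c S(2) bracket_section[OF S(1)], of "Vs ! j" "omit j Vs"] set_omit[of j Vs] S that
    by (auto simp: subset_iff)
  have "(\<Sum>j<length Vs. (-1) ^ j * c (W # br V (Vs ! j) # omit j Vs) x) =
      (\<Sum>j<length Vs. (-1) ^ Suc j * c (br V (Vs ! j) # W # omit j Vs) x)"
    by (intro sum.cong) (auto simp: sw)
  then show ?case using IH by (simp add: sum.lessThan_Suc_shift sum_negf del: sum.lessThan_Suc)
qed simp

definition section_interior :: "('m \<Rightarrow> 'v) \<Rightarrow> ('m \<Rightarrow> 'v list \<Rightarrow> real) \<Rightarrow> 'm \<Rightarrow> 'v list \<Rightarrow> real" where
  "section_interior V \<eta> = (\<lambda>x. contract (V x) (\<eta> x))"

lemma section_interior_apply: "section_interior V \<eta> x vs = \<eta> x (V x # vs)"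
  by (simp add: section_interior_def contract_def)

lemma eval_section_interior: "eval_form (section_interior V \<eta>) Vs = eval_form \<eta> (V # Vs)"
  by (simp add: eval_form_def section_interior_apply)

lemma eval_section_interior': "eval_form (section_interior V \<eta>) = (\<lambda>Vs. eval_form \<eta> (V # Vs))"
  by (rule ext) (rule eval_section_interior)

lemma section_interior_Omega:
  assumes \<eta>: "\<eta> \<in> \<Omega>" and V: "V \<in> Sec"
  shows "section_interior V \<eta> \<in> \<Omega>"
proof -
  obtain n where n: "\<And>x vs. n < length vs \<Longrightarrow> \<eta> x vs = 0" using Omega_bounded[OF \<eta>] by blast
  obtain \<zeta> where \<zeta>: "\<zeta> \<in> \<Omega>" "\<And>Vs. set Vs \<subseteq> Sec \<Longrightarrow> eval_form \<zeta> Vs = eval_form \<eta> (V # Vs)"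
  proof (rule cochain_realize[OF cochain_insert[OF cochain_eval_form[OF \<eta>] V], of n])
    show "eval_form \<eta> (V # Vs) = (\<lambda>x. 0)" if "n < length Vs" for Vs
      using n that by (simp add: eval_form_def)
  qed (rule that)
  have "section_interior V \<eta> = \<zeta>"
  proof (intro ext)
    fix x vs
    show "section_interior V \<eta> x vs = \<zeta> x vs"
    proof (cases "set vs \<subseteq> Fib x")
      case True
      then obtain Vs where "set Vs \<subseteq> Sec" "map (\<lambda>V. V x) Vs = vs" using sections_through by blast
      then show ?thesis
        using \<zeta>(2)[of Vs] by (auto simp: eval_form_def fun_eq_iff section_interior_apply)
    next
      case False
      then have "\<not> set (V x # vs) \<subseteq> Fib x" by simp
      then show ?thesis
        using Omega_outside[OF \<zeta>(1) False] Omega_outside[OF \<eta>] by (simp add: section_interior_apply del: list.set)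
    qed
  qed
  then show ?thesis using \<zeta>(1) by simp
qed

text \<open>In the alternating sum the terms that differentiate along the first argument
  \<open>W\<close> or bracket with it assemble to L(W), by \<open>cochain_lie_expand\<close>; the
  others form minus the sum for i(W) \<eta>. The induction is therefore general in \<eta>.\<close>

lemma cochain_d_cartan:
  "\<eta> \<in> \<Omega> \<Longrightarrow> set Vs \<subseteq> Sec \<Longrightarrow> cochain_d (eval_form \<eta>) Vs x = cartan_formula L \<eta> Vs x"
proof (induction Vs arbitrary: \<eta>)
  case Nil
  then show ?case by (simp add: cartan_formula_def)
next
  case (Cons W Vs)
  then have S: "W \<in> Sec" "set Vs \<subseteq> Sec" and \<eta>: "\<eta> \<in> \<Omega>" by auto
  note c = cochain_eval_form[OF \<eta>]
  have IH: "cochain_d (\<lambda>Us. eval_form \<eta> (W # Us)) Vs x = cartan_formula L (section_interior W \<eta>) Vs x"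
    using Cons.IH[OF section_interior_Omega[OF \<eta> S(1)] S(2)] by (simp add: eval_section_interior')
  have sw: "eval_form \<eta> (br (Vs ! i) (Vs ! j) # W # omit i (omit j Vs)) x =
      - eval_form \<eta> (W # br (Vs ! i) (Vs ! j) # omit i (omit j Vs)) x" if "j < length Vs" "i < j" for i j
  proof -
    have "set (omit i (omit j Vs)) \<subseteq> Sec" "Vs ! i \<in> Sec" "Vs ! j \<in> Sec"
      using S(2) that set_omit[of i "omit j Vs"] set_omit[of j Vs] by (auto simp: subset_iff)
    then show ?thesis
      using cochain_swap_first[OF c bracket_section S(1), of "Vs ! i" "Vs ! j" "omit i (omit j Vs)"] by simp
  qed
  have 1: "(\<Sum>i<length (W # Vs). (-1) ^ i * anchor L x (((W # Vs) ! i) x) (eval_form \<eta> (omit i (W # Vs)))) =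
      act W (eval_form \<eta> Vs) x -
      (\<Sum>i<length Vs. (-1) ^ i * anchor L x ((Vs ! i) x) (eval_form \<eta> (W # omit i Vs)))"
    by (simp add: sum.lessThan_Suc_shift act_def sum_negf del: sum.lessThan_Suc)
  have "(\<Sum>j<length (W # Vs). \<Sum>i<j. (-1) ^ (i + j) *
        eval_form \<eta> (br ((W # Vs) ! i) ((W # Vs) ! j) # omit i (omit j (W # Vs))) x) =
      (\<Sum>j<length Vs. - ((-1) ^ j * eval_form \<eta> (br W (Vs ! j) # omit j Vs) x) +
        (\<Sum>i<j. (-1) ^ (i + j) * eval_form \<eta> (br (Vs ! i) (Vs ! j) # W # omit i (omit j Vs)) x))"
    by (simp add: sum.lessThan_Suc_shift del: sum.lessThan_Suc)
  also have "\<dots> = (\<Sum>j<length Vs. - ((-1) ^ j * eval_form \<eta> (br W (Vs ! j) # omit j Vs) x) -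
        (\<Sum>i<j. (-1) ^ (i + j) * eval_form \<eta> (W # br (Vs ! i) (Vs ! j) # omit i (omit j Vs)) x))"
    by (intro sum.cong refl) (simp add: sw sum_negf[symmetric])
  finally show ?case
    unfolding cartan_formula_def 1
    using IH cochain_lie_expand[OF S(1) c S(2), of x]
    by (simp add: cartan_formula_def eval_section_interior' sum_subtractf sum_negf)
qed

section \<open>The exterior derivative\<close>

abbreviation "d \<equiv> exterior_derivative L"

text \<open>Existence comes from \<open>cochain_realize\<close>, uniqueness from the fact that a
  form is determined by its values on sections; the condition \<open>\<zeta> x [] = 0\<close>
  settles degree 0, where the description excludes the alternating sum.\<close>

lemma exterior_derivative_eval:
  assumes \<eta>: "\<eta> \<in> \<Omega>"
  shows "d \<eta> \<in> \<Omega> \<and> (\<forall>Vs. set Vs \<subseteq> Sec \<longrightarrow> eval_form (d \<eta>) Vs = cochain_d (eval_form \<eta>) Vs)"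
proof -
  note c = cochain_eval_form[OF \<eta>]
  obtain n where n: "\<And>x vs. n < length vs \<Longrightarrow> \<eta> x vs = 0" using Omega_bounded[OF \<eta>] by blast
  obtain \<zeta> where \<zeta>: "\<zeta> \<in> \<Omega>" "\<And>Vs. set Vs \<subseteq> Sec \<Longrightarrow> eval_form \<zeta> Vs = cochain_d (eval_form \<eta>) Vs"
  proof (rule cochain_realize[OF cochain_cochain_d[OF c], of "Suc n"])
    show "cochain_d (eval_form \<eta>) Vs = (\<lambda>x. 0)" if "set Vs \<subseteq> Sec" "Suc n < length Vs" for Vs
      by (rule cochain_d_bounded[OF that(1)]) (use n that(2) in \<open>auto simp: eval_form_def\<close>)
  qed (rule that)
  have "d \<eta> = \<zeta>"
    unfolding exterior_derivative_def
  proof (rule the_equality)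
    show "\<zeta> \<in> \<Omega> \<and> (\<forall>x. \<zeta> x [] = 0) \<and>
        (\<forall>Vs. Vs \<noteq> [] \<and> set Vs \<subseteq> Sec \<longrightarrow> eval_form \<zeta> Vs = cartan_formula L \<eta> Vs)"
      using \<zeta>(1) \<zeta>(2)[of "[]"] \<zeta>(2) cochain_d_cartan[OF \<eta>] by (auto simp: fun_eq_iff eval_form_def)
    show "\<xi> = \<zeta>" if \<xi>: "\<xi> \<in> \<Omega> \<and> (\<forall>x. \<xi> x [] = 0) \<and>
        (\<forall>Vs. Vs \<noteq> [] \<and> set Vs \<subseteq> Sec \<longrightarrow> eval_form \<xi> Vs = cartan_formula L \<eta> Vs)" for \<xi>
    proof (rule Omega_eqI[OF _ \<zeta>(1)])
      show "eval_form \<xi> Vs = eval_form \<zeta> Vs" if "set Vs \<subseteq> Sec" for Vs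
      proof (cases Vs)
        case Nil
        then show ?thesis using \<xi> \<zeta>(2)[of "[]"] by (auto simp: eval_form_def fun_eq_iff)
      next
        case (Cons V Vs')
        then show ?thesis
          using \<xi> \<zeta>(2)[OF that] cochain_d_cartan[OF \<eta> that] that by (auto simp: fun_eq_iff)
      qed
    qed (use \<xi> in blast)
  qed
  then show ?thesis using \<zeta> by simp
qed

lemma d_Omega: "\<eta> \<in> \<Omega> \<Longrightarrow> d \<eta> \<in> \<Omega>"
  and eval_d: "\<eta> \<in> \<Omega> \<Longrightarrow> set Vs \<subseteq> Sec \<Longrightarrow> eval_form (d \<eta>) Vs = cochain_d (eval_form \<eta>) Vs"
  using exterior_derivative_eval by blast+

lemma Omega_linear: "\<eta> \<in> \<Omega> \<Longrightarrow> \<zeta> \<in> \<Omega> \<Longrightarrow> (\<lambda>x vs. a * \<eta> x vs + b * \<zeta> x vs) \<in> \<Omega>"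
  using Omega_combination[OF _ _ smooth_functions_const smooth_functions_const] .

lemma d_linear:
  assumes "\<eta> \<in> \<Omega>" "\<zeta> \<in> \<Omega>"
  shows "d (\<lambda>x vs. a * \<eta> x vs + b * \<zeta> x vs) = (\<lambda>x vs. a * d \<eta> x vs + b * d \<zeta> x vs)"
proof (rule Omega_eqI)
  show "eval_form (d (\<lambda>x vs. a * \<eta> x vs + b * \<zeta> x vs)) Vs = eval_form (\<lambda>x vs. a * d \<eta> x vs + b * d \<zeta> x vs) Vs"
    if Vs: "set Vs \<subseteq> Sec" for Vs
  proof -
    have "eval_form (\<lambda>x vs. a * \<eta> x vs + b * \<zeta> x vs) = (\<lambda>Us x. a * eval_form \<eta> Us x + b * eval_form \<zeta> Us x)"
      by (simp add: eval_form_def fun_eq_iff)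
    then have "eval_form (d (\<lambda>x vs. a * \<eta> x vs + b * \<zeta> x vs)) Vs =
        (\<lambda>x. a * eval_form (d \<eta>) Vs x + b * eval_form (d \<zeta>) Vs x)"
      using cochain_d_linear[OF cochain_smooth_valued cochain_smooth_valued Vs] Omega_linear[OF assms] assms
      by (simp add: eval_d Vs cochain_eval_form)
    then show ?thesis by (simp add: eval_form_def)
  qed
qed (intro d_Omega Omega_linear assms)+

lemma d_d:
  assumes "\<eta> \<in> \<Omega>"
  shows "d (d \<eta>) = (\<lambda>x vs. 0)"
proof (rule Omega_eqI)
  show "(\<lambda>x vs. 0) \<in> \<Omega>" using Omega_linear[OF assms assms, of 0 0] by simp
  show "eval_form (d (d \<eta>)) Vs = eval_form (\<lambda>x vs. 0) Vs" if Vs: "set Vs \<subseteq> Sec" for Vs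
  proof -
    have "eval_form (d (d \<eta>)) Vs = cochain_d (eval_form (d \<eta>)) Vs"
      by (rule eval_d[OF d_Omega[OF assms] Vs])
    also have "\<dots> = cochain_d (cochain_d (eval_form \<eta>)) Vs"
      by (rule cochain_d_cong[OF eval_d[OF assms] Vs])
    finally show ?thesis
      using cochain_d_d[OF cochain_eval_form[OF assms] Vs] by (simp add: eval_form_def)
  qed
qed (intro d_Omega assms)


section \<open>Cartan calculus on forms\<close>

abbreviation "\<iota> \<equiv> section_interior"

lemma Omega_scale: "\<eta> \<in> \<Omega> \<Longrightarrow> (\<lambda>x vs. a * \<eta> x vs) \<in> \<Omega>"
  using Omega_linear[of \<eta> \<eta> a 0] by simp

lemma Omega_add: "\<eta> \<in> \<Omega> \<Longrightarrow> \<zeta> \<in> \<Omega> \<Longrightarrow> (\<lambda>x vs. \<eta> x vs + \<zeta> x vs) \<in> \<Omega>"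
  using Omega_linear[of \<eta> \<zeta> 1 1] by simp

lemma Omega_diff: "\<eta> \<in> \<Omega> \<Longrightarrow> \<zeta> \<in> \<Omega> \<Longrightarrow> (\<lambda>x vs. \<eta> x vs - \<zeta> x vs) \<in> \<Omega>"
  using Omega_linear[of \<eta> \<zeta> 1 "-1"] by simp

lemma Omega_zero: "(\<lambda>x vs. 0) \<in> \<Omega>"
  using subspace_0[OF subspace_Omega] by (simp add: zero_fun_def)

lemma d_scale: "\<eta> \<in> \<Omega> \<Longrightarrow> d (\<lambda>x vs. a * \<eta> x vs) = (\<lambda>x vs. a * d \<eta> x vs)"
  using d_linear[of \<eta> \<eta> a 0] by simp

lemma d_zero: "d (\<lambda>x vs. 0) = (\<lambda>x vs. 0)"
  using d_scale[OF Omega_zero, of 0] by simp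

definition lie :: "('m \<Rightarrow> 'v) \<Rightarrow> ('m \<Rightarrow> 'v list \<Rightarrow> real) \<Rightarrow> 'm \<Rightarrow> 'v list \<Rightarrow> real" where
  "lie V \<eta> = (\<lambda>x vs. \<iota> V (d \<eta>) x vs + d (\<iota> V \<eta>) x vs)"

lemma lie_Omega: "\<eta> \<in> \<Omega> \<Longrightarrow> V \<in> Sec \<Longrightarrow> lie V \<eta> \<in> \<Omega>"
  unfolding lie_def by (intro Omega_add section_interior_Omega d_Omega)

lemma eval_lie:
  assumes "\<eta> \<in> \<Omega>" "V \<in> Sec" "set Vs \<subseteq> Sec"
  shows "eval_form (lie V \<eta>) Vs = cochain_lie V (eval_form \<eta>) Vs"
proof -
  have "eval_form (lie V \<eta>) Vs = (\<lambda>x. eval_form (d \<eta>) (V # Vs) x + eval_form (d (\<iota> V \<eta>)) Vs x)"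
    by (simp add: eval_form_def lie_def section_interior_apply)
  also have "\<dots> = cochain_lie V (eval_form \<eta>) Vs"
    using assms by (simp add: eval_d section_interior_Omega eval_section_interior')
  finally show ?thesis .
qed

lemma interior_linear:
  "\<iota> V (\<lambda>x vs. f x * \<eta> x vs + g x * \<zeta> x vs) = (\<lambda>x vs. f x * \<iota> V \<eta> x vs + g x * \<iota> V \<zeta> x vs)"
  by (simp add: section_interior_apply fun_eq_iff)

lemma interior_scale: "\<iota> V (\<lambda>x vs. a * \<eta> x vs) = (\<lambda>x vs. a * \<iota> V \<eta> x vs)"
  and interior_diff: "\<iota> V (\<lambda>x vs. \<eta> x vs - \<zeta> x vs) = (\<lambda>x vs. \<iota> V \<eta> x vs - \<iota> V \<zeta> x vs)"
  by (simp_all add: section_interior_apply fun_eq_iff)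

lemma lie_linear:
  assumes "\<eta> \<in> \<Omega>" "\<zeta> \<in> \<Omega>" "V \<in> Sec"
  shows "lie V (\<lambda>x vs. a * \<eta> x vs + b * \<zeta> x vs) = (\<lambda>x vs. a * lie V \<eta> x vs + b * lie V \<zeta> x vs)"
  using assms by (simp add: lie_def d_linear section_interior_Omega
      interior_linear[of V "\<lambda>x. a" _ "\<lambda>x. b"] algebra_simps)

lemma lie_scale: "\<eta> \<in> \<Omega> \<Longrightarrow> V \<in> Sec \<Longrightarrow> lie V (\<lambda>x vs. a * \<eta> x vs) = (\<lambda>x vs. a * lie V \<eta> x vs)"
  using lie_linear[of \<eta> \<eta> V a 0] by simp

lemma interior_interior:
  assumes "\<eta> \<in> \<Omega>" "V \<in> Sec" "W \<in> Sec"
  shows "\<iota> V (\<iota> W \<eta>) = (\<lambda>x vs. - \<iota> W (\<iota> V \<eta>) x vs)"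
proof (rule Omega_eqI)
  show "(\<lambda>x vs. - \<iota> W (\<iota> V \<eta>) x vs) \<in> \<Omega>"
    using Omega_scale[of "\<iota> W (\<iota> V \<eta>)" "-1"] assms section_interior_Omega by simp
  show "eval_form (\<iota> V (\<iota> W \<eta>)) Vs = eval_form (\<lambda>x vs. - \<iota> W (\<iota> V \<eta>) x vs) Vs" if "set Vs \<subseteq> Sec" for Vs
  proof -
    have "eval_form (\<iota> V (\<iota> W \<eta>)) Vs = (\<lambda>x. - eval_form (\<iota> W (\<iota> V \<eta>)) Vs x)"
      using cochain_swap_first[OF cochain_eval_form[OF assms(1)] assms(3,2) that]
      by (simp only: eval_section_interior)
    then show ?thesis by (simp add: eval_form_def)
  qed
qed (intro section_interior_Omega assms)

lemma lie_interior:
  assumes "\<eta> \<in> \<Omega>" "V \<in> Sec" "W \<in> Sec"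
  shows "lie V (\<iota> W \<eta>) = (\<lambda>x vs. \<iota> W (lie V \<eta>) x vs + \<iota> (br V W) \<eta> x vs)"
proof (rule Omega_eqI)
  show "eval_form (lie V (\<iota> W \<eta>)) Vs = eval_form (\<lambda>x vs. \<iota> W (lie V \<eta>) x vs + \<iota> (br V W) \<eta> x vs) Vs"
    if Vs: "set Vs \<subseteq> Sec" for Vs
  proof -
    have "eval_form (lie V (\<iota> W \<eta>)) Vs = cochain_lie V (\<lambda>Us. eval_form \<eta> (W # Us)) Vs"
      using eval_lie[OF section_interior_Omega[OF assms(1,3)] assms(2) Vs] by (simp add: eval_section_interior')
    also have "\<dots> = (\<lambda>x. eval_form (lie V \<eta>) (W # Vs) x + eval_form \<eta> (br V W # Vs) x)"
      using eval_lie[OF assms(1,2), of "W # Vs"] assms(3) Vs by simp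
    finally show ?thesis by (simp add: eval_form_def section_interior_apply)
  qed
qed (intro lie_Omega section_interior_Omega Omega_add bracket_section assms)+

lemma eval_form_mult: "eval_form (\<lambda>x vs. f x * \<eta> x vs) = (\<lambda>Us x. f x * eval_form \<eta> Us x)"
  by (simp add: eval_form_def fun_eq_iff)

lemma lie_mult:
  assumes "\<eta> \<in> \<Omega>" "V \<in> Sec" "f \<in> C"
  shows "lie V (\<lambda>x vs. f x * \<eta> x vs) = (\<lambda>x vs. f x * lie V \<eta> x vs + act V f x * \<eta> x vs)"
proof (rule Omega_eqI)
  show "eval_form (lie V (\<lambda>x vs. f x * \<eta> x vs)) Vs =
      eval_form (\<lambda>x vs. f x * lie V \<eta> x vs + act V f x * \<eta> x vs) Vs" if Vs: "set Vs \<subseteq> Sec" for Vs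
  proof -
    have "eval_form (lie V (\<lambda>x vs. f x * \<eta> x vs)) Vs =
        (\<lambda>x. f x * eval_form (lie V \<eta>) Vs x + act V f x * eval_form \<eta> Vs x)"
      using cochain_lie_mult[OF assms(3,2) cochain_smooth_valued[OF cochain_eval_form[OF assms(1)]] Vs]
        eval_lie[OF Omega_mult[OF assms(1,3)] assms(2) Vs] eval_lie[OF assms(1,2) Vs]
      by (simp add: eval_form_mult)
    then show ?thesis by (simp add: eval_form_def)
  qed
qed (intro lie_Omega Omega_mult Omega_combination act_smooth assms)+

text \<open>The product df \<and> \<eta>, written as a defect of \<open>d\<close> so that no
  exterior product of forms has to be set up.\<close>

definition ext :: "('m \<Rightarrow> real) \<Rightarrow> ('m \<Rightarrow> 'v list \<Rightarrow> real) \<Rightarrow> 'm \<Rightarrow> 'v list \<Rightarrow> real" where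
  "ext f \<eta> = (\<lambda>x vs. d (\<lambda>x vs. f x * \<eta> x vs) x vs - f x * d \<eta> x vs)"

lemma ext_Omega: "\<eta> \<in> \<Omega> \<Longrightarrow> f \<in> C \<Longrightarrow> ext f \<eta> \<in> \<Omega>"
  unfolding ext_def by (intro Omega_diff d_Omega Omega_mult)

lemma eval_ext:
  assumes "\<eta> \<in> \<Omega>" "f \<in> C" "set Vs \<subseteq> Sec"
  shows "eval_form (ext f \<eta>) Vs = cochain_e f (eval_form \<eta>) Vs"
proof -
  have "eval_form (ext f \<eta>) Vs = (\<lambda>x. eval_form (d (\<lambda>x vs. f x * \<eta> x vs)) Vs x - f x * eval_form (d \<eta>) Vs x)"
    by (simp add: eval_form_def ext_def)
  then show ?thesis using assms by (simp add: eval_d Omega_mult eval_form_mult cochain_e_def)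
qed

lemma interior_ext:
  assumes "\<eta> \<in> \<Omega>" "f \<in> C" "W \<in> Sec"
  shows "ext f (\<iota> W \<eta>) = (\<lambda>x vs. act W f x * \<eta> x vs - \<iota> W (ext f \<eta>) x vs)"
proof (rule Omega_eqI)
  show "eval_form (ext f (\<iota> W \<eta>)) Vs = eval_form (\<lambda>x vs. act W f x * \<eta> x vs - \<iota> W (ext f \<eta>) x vs) Vs"
    if Vs: "set Vs \<subseteq> Sec" for Vs
  proof -
    have "eval_form (ext f \<eta>) (W # Vs) = (\<lambda>x. act W f x * eval_form \<eta> Vs x - eval_form (ext f (\<iota> W \<eta>)) Vs x)"
      using cochain_e_Cons[OF assms(2) cochain_smooth_valued[OF cochain_eval_form[OF assms(1)]] assms(3) Vs]
        eval_ext[OF assms(1,2), of "W # Vs"] eval_ext[OF section_interior_Omega[OF assms(1,3)] assms(2) Vs] assms(3) Vs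
      by (simp add: eval_section_interior')
    then show ?thesis by (simp add: eval_form_def section_interior_apply fun_eq_iff)
  qed
qed (intro ext_Omega section_interior_Omega Omega_diff Omega_mult act_smooth assms)+

text \<open>Linearity over functions is hidden in the definition of \<open>cochain_e\<close> as a
  defect of \<open>cochain_d\<close>; the recursion \<open>cochain_e_Cons\<close> exhibits
  it.\<close>

lemma cochain_e_mult:
  "f \<in> C \<Longrightarrow> g \<in> C \<Longrightarrow> smooth_valued c \<Longrightarrow> set Vs \<subseteq> Sec \<Longrightarrow>
    cochain_e f (\<lambda>Us x. g x * c Us x) Vs = (\<lambda>x. g x * cochain_e f c Vs x)"
proof (induction Vs arbitrary: c)
  case (Cons U Vs)
  have "cochain_e f (\<lambda>Us x. g x * c (U # Us) x) Vs = (\<lambda>x. g x * cochain_e f (\<lambda>Us. c (U # Us)) Vs x)"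
    by (rule Cons.IH) (use Cons.prems smooth_valued_insert in auto)
  then show ?case
    using Cons.prems by (simp add: cochain_e_Cons smooth_valued_mult algebra_simps)
qed (simp add: cochain_e_Nil)

lemma ext_mult:
  assumes "\<eta> \<in> \<Omega>" "f \<in> C" "g \<in> C"
  shows "ext f (\<lambda>x vs. g x * \<eta> x vs) = (\<lambda>x vs. g x * ext f \<eta> x vs)"
proof (rule Omega_eqI)
  show "eval_form (ext f (\<lambda>x vs. g x * \<eta> x vs)) Vs = eval_form (\<lambda>x vs. g x * ext f \<eta> x vs) Vs"
    if Vs: "set Vs \<subseteq> Sec" for Vs
    using cochain_e_mult[OF assms(2,3) cochain_smooth_valued[OF cochain_eval_form[OF assms(1)]] Vs] assms Vs
    by (simp add: eval_ext Omega_mult eval_form_mult)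
qed (intro ext_Omega Omega_mult assms)+

section \<open>The algebra of contraction operators\<close>

definition sg :: "int \<Rightarrow> real" where
  "sg k = (-1) powi k"

lemma sg_0 [simp]: "sg 0 = 1" and sg_1 [simp]: "sg 1 = -1" and sg_minus [simp]: "sg (- k) = sg k"
  and sg_add: "sg (k + l) = sg k * sg l" and sg_square [simp]: "sg k * sg k = 1"
  by (simp_all add: sg_def power_int_add power_int_minus_one_minus power_int_mult_distrib[symmetric])

lemma sg_square_left [simp]: "sg k * (sg k * a) = a"
  by (simp add: mult.assoc[symmetric])

text \<open>Off \<open>\<Omega>\<close> the values of an operator are junk, hence the rule \<open>congr\<close>.\<close>

inductive contr :: "int \<Rightarrow> (('m \<Rightarrow> 'v list \<Rightarrow> real) \<Rightarrow> 'm \<Rightarrow> 'v list \<Rightarrow> real) \<Rightarrow> bool" where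
  zero: "contr k (\<lambda>\<eta> x vs. 0)"
| mult: "f \<in> C \<Longrightarrow> contr 0 (\<lambda>\<eta> x vs. f x * \<eta> x vs)"
| step: "contr k F \<Longrightarrow> V \<in> Sec \<Longrightarrow> contr (k + 1) (\<lambda>\<eta>. \<iota> V (F \<eta>))"
| linear: "contr k F \<Longrightarrow> contr k G \<Longrightarrow> contr k (\<lambda>\<eta> x vs. a * F \<eta> x vs + b * G \<eta> x vs)"
| congr: "contr k F \<Longrightarrow> (\<And>\<eta>. \<eta> \<in> \<Omega> \<Longrightarrow> F' \<eta> = F \<eta>) \<Longrightarrow> contr k F'"

lemma contr_Omega: "contr k F \<Longrightarrow> \<eta> \<in> \<Omega> \<Longrightarrow> F \<eta> \<in> \<Omega>"
  by (induction arbitrary: rule: contr.induct)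
    (simp_all add: Omega_zero Omega_mult section_interior_Omega Omega_linear)

lemma contr_linear:
  "contr k F \<Longrightarrow> \<eta> \<in> \<Omega> \<Longrightarrow> \<zeta> \<in> \<Omega> \<Longrightarrow>
    F (\<lambda>x vs. a * \<eta> x vs + b * \<zeta> x vs) = (\<lambda>x vs. a * F \<eta> x vs + b * F \<zeta> x vs)"
  by (induction rule: contr.induct)
    (simp_all add: Omega_linear interior_linear[of _ "\<lambda>x. a" _ "\<lambda>x. b"] algebra_simps)

lemma contr_scale: "contr k F \<Longrightarrow> \<eta> \<in> \<Omega> \<Longrightarrow> F (\<lambda>x vs. a * \<eta> x vs) = (\<lambda>x vs. a * F \<eta> x vs)"
  using contr_linear[of k F \<eta> \<eta> a 0] by simp

lemma contr_function:
  "contr k F \<Longrightarrow> \<eta> \<in> \<Omega> \<Longrightarrow> f \<in> C \<Longrightarrow> F (\<lambda>x vs. f x * \<eta> x vs) = (\<lambda>x vs. f x * F \<eta> x vs)"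
  by (induction rule: contr.induct)
    (simp_all add: Omega_mult section_interior_apply fun_eq_iff algebra_simps)

text \<open>Generators act fibrewise. Hence agreement at one point suffices under a contraction,
  whereas \<open>d\<close> needs agreement on a neighbourhood.\<close>

lemma contr_pointwise:
  "contr k F \<Longrightarrow> \<eta> \<in> \<Omega> \<Longrightarrow> \<zeta> \<in> \<Omega> \<Longrightarrow> \<eta> x = \<zeta> x \<Longrightarrow> F \<eta> x = F \<zeta> x"
  by (induction rule: contr.induct) (simp_all add: section_interior_def)

lemma contr_mult: "contr k F \<Longrightarrow> f \<in> C \<Longrightarrow> contr k (\<lambda>\<eta> x vs. f x * F \<eta> x vs)"
proof (induction rule: contr.induct)
  case (zero k)
  show ?case by (rule contr.congr[OF contr.zero]) simp
next
  case (mult g)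
  show ?case
    by (rule contr.congr[OF contr.mult[OF smooth_functions_mult[OF mult(2,1)]]]) (simp add: mult.assoc)
next
  case (step k F V)
  show ?case
    by (rule contr.congr[OF contr.step[OF step.IH[OF step.prems] step.hyps(2)]])
      (simp add: section_interior_apply fun_eq_iff)
next
  case (linear k F G a b)
  show ?case
    by (rule contr.congr[OF contr.linear[OF linear.IH(1)[OF linear.prems] linear.IH(2)[OF linear.prems], of a b]])
      (simp add: algebra_simps)
next
  case (congr k F F')
  show ?case by (rule contr.congr[OF congr.IH[OF congr.prems]]) (simp add: congr.hyps(2))
qed

lemma contr_scale_op: "contr k F \<Longrightarrow> contr k (\<lambda>\<eta> x vs. a * F \<eta> x vs)"
  by (rule contr_mult[OF _ smooth_functions_const])

lemma contr_add_op: "contr k F \<Longrightarrow> contr k G \<Longrightarrow> contr k (\<lambda>\<eta> x vs. F \<eta> x vs + G \<eta> x vs)"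
  using contr.linear[of k F G 1 1] by simp

lemma contr_comp: "contr k F \<Longrightarrow> contr l G \<Longrightarrow> contr (k + l) (\<lambda>\<eta>. F (G \<eta>))"
proof (induction rule: contr.induct)
  case (zero k)
  show ?case by (rule contr.zero)
next
  case (mult f)
  then show ?case using contr_mult by simp
next
  case (step k F V)
  then show ?case using contr.step[OF step.IH[OF step.prems] step.hyps(2)] by (simp add: algebra_simps)
next
  case (linear k F G' a b)
  then show ?case by (simp add: contr.linear)
next
  case (congr k F F')
  show ?case by (rule contr.congr[OF congr.IH[OF congr.prems]]) (simp add: congr.hyps(2) contr_Omega[OF congr.prems])
qed

lemma contr_interior:
  "contr k F \<Longrightarrow> \<eta> \<in> \<Omega> \<Longrightarrow> V \<in> Sec \<Longrightarrow> F (\<iota> V \<eta>) = (\<lambda>x vs. sg k * \<iota> V (F \<eta>) x vs)"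
proof (induction rule: contr.induct)
  case (step k F W)
  then have "\<iota> W (F (\<iota> V \<eta>)) = (\<lambda>x vs. sg k * \<iota> W (\<iota> V (F \<eta>)) x vs)"
    by (simp add: interior_scale)
  then show ?case
    using interior_interior[OF contr_Omega[OF step.hyps(1) step.prems(1)] step.hyps(2) step.prems(2)]
    by (simp add: sg_add)
qed (simp_all add: section_interior_apply section_interior_Omega fun_eq_iff algebra_simps)

text \<open>Multiplications by functions are central and interior products anticommute, so the
  generated algebra is graded commutative; \<open>contr_interior\<close> is the case of one factor
  i(V).\<close>

lemma contr_commute:
  "contr k F \<Longrightarrow> contr l G \<Longrightarrow> \<eta> \<in> \<Omega> \<Longrightarrow> F (G \<eta>) = (\<lambda>x vs. sg (k * l) * G (F \<eta>) x vs)"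
proof (induction rule: contr.induct)
  case (zero k)
  then show ?case using contr_scale[OF zero(1) Omega_zero, of 0] by simp
next
  case (mult f)
  then show ?case using contr_function by simp
next
  case (step k F V)
  have "\<iota> V (F (G \<eta>)) = (\<lambda>x vs. sg (k * l) * \<iota> V (G (F \<eta>)) x vs)"
    using step by (simp add: interior_scale)
  moreover have "G (\<iota> V (F \<eta>)) = (\<lambda>x vs. sg l * \<iota> V (G (F \<eta>)) x vs)"
    by (rule contr_interior[OF step.prems(1) contr_Omega[OF step.hyps(1) step.prems(2)] step.hyps(2)])
  ultimately show ?case by (simp add: sg_add distrib_right mult.assoc)
next
  case (linear k F G' a b)
  then show ?case
    by (simp add: contr_linear[OF linear.prems(1)] contr_Omega[OF linear.hyps(1)] contr_Omega[OF linear.hyps(2)] algebra_simps)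
next
  case (congr k F F')
  then show ?case by (simp add: contr_Omega[OF congr.prems(1)])
qed

text \<open>[L(V), -] is a derivation sending the generators f and i(W) to V(f) and i({V, W}), again
  generators.\<close>

lemma contr_lie:
  "contr l G \<Longrightarrow> V \<in> Sec \<Longrightarrow> contr l (\<lambda>\<eta> x vs. lie V (G \<eta>) x vs - G (lie V \<eta>) x vs)"
proof (induction rule: contr.induct)
  case (zero k)
  have "lie V (\<lambda>x vs. 0) = (\<lambda>x vs. 0)" using lie_scale[OF Omega_zero zero, of 0] by simp
  then show ?case by (intro contr.congr[OF contr.zero]) simp
next
  case (mult f)
  show ?case
    by (rule contr.congr[OF contr.mult[OF act_smooth[OF mult(2,1)]]]) (simp add: lie_mult mult)
next
  case (step k G W)
  have 1: "contr (k + 1) (\<lambda>\<eta>. \<iota> W (\<lambda>x vs. lie V (G \<eta>) x vs - G (lie V \<eta>) x vs))"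
    by (rule contr.step[OF step.IH[OF step.prems] step.hyps(2)])
  have 2: "contr (k + 1) (\<lambda>\<eta>. \<iota> (br V W) (G \<eta>))"
    by (rule contr.step[OF step.hyps(1) bracket_section[OF step.prems step.hyps(2)]])
  show ?case
    by (rule contr.congr[OF contr_add_op[OF 1 2]])
      (simp add: lie_interior[OF contr_Omega[OF step.hyps(1)] step.prems step.hyps(2)] interior_diff algebra_simps)
next
  case (linear k F G a b)
  show ?case
    by (rule contr.congr[OF contr.linear[OF linear.IH(1)[OF linear.prems] linear.IH(2)[OF linear.prems], of a b]])
      (simp add: lie_linear[OF contr_Omega[OF linear.hyps(1)] contr_Omega[OF linear.hyps(2)] linear.prems] algebra_simps)
next
  case (congr k F F')
  show ?case by (rule contr.congr[OF congr.IH[OF congr.prems]]) (simp add: congr.hyps(2) lie_Omega congr.prems)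
qed

text \<open>The bracket with df \<and> annihilates functions and sends i(W) to multiplication by
  W(f), hence lowers the degree by one and stays in the algebra.\<close>

lemma contr_ext:
  "contr l G \<Longrightarrow> f \<in> C \<Longrightarrow> contr (l - 1) (\<lambda>\<eta> x vs. ext f (G \<eta>) x vs - sg l * G (ext f \<eta>) x vs)"
proof (induction rule: contr.induct)
  case (zero k)
  have "ext f (\<lambda>x vs. 0) = (\<lambda>x vs. 0)" by (simp add: ext_def d_zero)
  then show ?case by (intro contr.congr[OF contr.zero]) simp
next
  case (mult g)
  show ?case by (rule contr.congr[OF contr.zero]) (simp add: ext_mult mult)
next
  case (step k G W)
  have 1: "contr (k - 1 + 1) (\<lambda>\<eta>. \<iota> W (\<lambda>x vs. ext f (G \<eta>) x vs - sg k * G (ext f \<eta>) x vs))"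
    by (rule contr.step[OF step.IH[OF step.prems] step.hyps(2)])
  have 2: "contr (k - 1 + 1) (\<lambda>\<eta> x vs. act W f x * G \<eta> x vs)"
    using contr_mult[OF step.hyps(1) act_smooth[OF step.hyps(2) step.prems]] by simp
  have "contr (k - 1 + 1) (\<lambda>\<eta> x vs. ext f (\<iota> W (G \<eta>)) x vs - sg (k + 1) * \<iota> W (G (ext f \<eta>)) x vs)"
    by (rule contr.congr[OF contr.linear[OF 1 2, of "-1" 1]])
      (simp add: interior_ext[OF contr_Omega[OF step.hyps(1)] step.prems step.hyps(2)] interior_diff interior_scale sg_add algebra_simps)
  then show ?case by simp
next
  case (linear k F G a b)
  have lin: "ext f (\<lambda>x vs. a * F \<eta> x vs + b * G \<eta> x vs) = (\<lambda>x vs. a * ext f (F \<eta>) x vs + b * ext f (G \<eta>) x vs)"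
    if "\<eta> \<in> \<Omega>" for \<eta>
    using d_linear[OF contr_Omega[OF linear.hyps(1) that] contr_Omega[OF linear.hyps(2) that], of a b]
      d_linear[OF Omega_mult[OF contr_Omega[OF linear.hyps(1) that] linear.prems]
        Omega_mult[OF contr_Omega[OF linear.hyps(2) that] linear.prems], of a b]
    by (simp add: ext_def algebra_simps)
  show ?case
    by (rule contr.congr[OF contr.linear[OF linear.IH(1)[OF linear.prems] linear.IH(2)[OF linear.prems], of a b]])
      (simp add: lin algebra_simps)
next
  case (congr k F F')
  show ?case by (rule contr.congr[OF congr.IH[OF congr.prems]]) (simp add: congr.hyps(2) ext_Omega congr.prems)
qed

text \<open>The double bracket \<open>[[F, d], G]\<close> for contraction operators \<open>F\<close>, \<open>G\<close> of degrees \<open>-p\<close>, \<open>-q\<close>.\<close>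

definition dbl where
  "dbl p q F G \<eta> = (\<lambda>x vs. F (d (G \<eta>)) x vs - sg p * d (F (G \<eta>)) x vs
    - sg (q + p * q) * (G (F (d \<eta>)) x vs - sg p * G (d (F \<eta>)) x vs))"

lemma d_interior: "d (\<iota> V \<eta>) = (\<lambda>x vs. lie V \<eta> x vs - \<iota> V (d \<eta>) x vs)"
  by (simp add: lie_def)

lemma contr_diff: "contr k F \<Longrightarrow> \<eta> \<in> \<Omega> \<Longrightarrow> \<zeta> \<in> \<Omega> \<Longrightarrow>
    F (\<lambda>x vs. \<eta> x vs - \<zeta> x vs) = (\<lambda>x vs. F \<eta> x vs - F \<zeta> x vs)"
  using contr_linear[of k F \<eta> \<zeta> 1 "-1"] by simp

text \<open>The induction step is the derivation property of \<open>[[\<cdot>, d], G]\<close>, with \<open>[i(V), d] = L(V)\<close>.\<close>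

lemma contr_dbl:
  assumes G: "contr q G"
  shows "contr p F \<Longrightarrow> contr (p + q - 1) (dbl p q F G)"
proof (induction rule: contr.induct)
  case (zero k)
  have "G (\<lambda>x vs. 0) = (\<lambda>x vs. 0)" using contr_scale[OF G Omega_zero, of 0] by simp
  then show ?case by (intro contr.congr[OF contr.zero]) (simp add: dbl_def d_zero)
next
  case (mult f)
  \<comment> \<open>The identity [f, d] = - df \<and> reduces multiplications to
    \<open>contr_ext\<close>.\<close>
  have eq: "dbl 0 q (\<lambda>\<eta> x vs. f x * \<eta> x vs) G \<eta> =
      (\<lambda>x vs. (-1) * (ext f (G \<eta>) x vs - sg q * G (ext f \<eta>) x vs))" if \<eta>: "\<eta> \<in> \<Omega>" for \<eta>
  proof -
    have "G (ext f \<eta>) = (\<lambda>x vs. G (d (\<lambda>x vs. f x * \<eta> x vs)) x vs - G (\<lambda>x vs. f x * d \<eta> x vs) x vs)"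
      unfolding ext_def by (intro contr_diff[OF G] d_Omega Omega_mult \<eta> mult)
    then show ?thesis by (simp add: dbl_def ext_def algebra_simps)
  qed
  show ?case using contr.congr[OF contr_scale_op[OF contr_ext[OF G mult], of "-1"] eq] by simp
next
  case (step p F V)
  have 1: "contr (p + q - 1 + 1) (\<lambda>\<eta>. \<iota> V (dbl p q F G \<eta>))"
    by (rule contr.step[OF step.IH step.hyps(2)])
  have 2: "contr (p + q - 1 + 1) (\<lambda>\<eta> x vs. lie V (G (F \<eta>)) x vs - G (lie V (F \<eta>)) x vs)"
    using contr_comp[OF contr_lie[OF G step.hyps(2)] step.hyps(1)] by (simp add: algebra_simps)
  have "contr (p + q - 1 + 1) (dbl (p + 1) q (\<lambda>\<eta>. \<iota> V (F \<eta>)) G)"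
  \<comment> \<open>The factor \<open>sg p\<close> comes from [i(V) F, d] = i(V) [F, d] + (-1)^p
    L(V) F, the factor \<open>sg (p * q)\<close> from exchanging \<open>F\<close> and
    \<open>G\<close>.\<close>
  proof (rule contr.congr[OF contr.linear[OF 1 2, of 1 "sg p * sg (p * q)"]])
    fix \<eta> assume \<eta>: "\<eta> \<in> \<Omega>"
    note \<Omega> = contr_Omega[OF step.hyps(1)] contr_Omega[OF G] d_Omega lie_Omega section_interior_Omega \<eta> step.hyps(2)
    have a: "G (\<iota> V (F (d \<eta>))) = (\<lambda>x vs. sg q * \<iota> V (G (F (d \<eta>))) x vs)"
      by (intro contr_interior[OF G] \<Omega>)
    have "G (d (\<iota> V (F \<eta>))) = (\<lambda>x vs. G (lie V (F \<eta>)) x vs - G (\<iota> V (d (F \<eta>))) x vs)"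
      unfolding d_interior by (intro contr_diff[OF G] \<Omega>)
    also have "G (\<iota> V (d (F \<eta>))) = (\<lambda>x vs. sg q * \<iota> V (G (d (F \<eta>))) x vs)"
      by (intro contr_interior[OF G] \<Omega>)
    finally have b: "G (d (\<iota> V (F \<eta>))) = (\<lambda>x vs. G (lie V (F \<eta>)) x vs - sg q * \<iota> V (G (d (F \<eta>))) x vs)" .
    have "lie V (F (G \<eta>)) = lie V (\<lambda>x vs. sg (p * q) * G (F \<eta>) x vs)"
      using contr_commute[OF step.hyps(1) G \<eta>] by simp
    also have "\<dots> = (\<lambda>x vs. sg (p * q) * lie V (G (F \<eta>)) x vs)"
      by (intro lie_scale \<Omega>)
    finally have e: "lie V (F (G \<eta>)) = (\<lambda>x vs. sg (p * q) * lie V (G (F \<eta>)) x vs)" .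
    have "sg ((p + 1) * q) = sg (p * q) * sg q"
      by (simp only: sg_add distrib_right mult_1)
    then have sgn: "sg (q + (p + 1) * q) = sg (p * q)" "sg (p + 1) = - sg p" "sg (q + p * q) = sg q * sg (p * q)"
      by (simp_all add: sg_add mult.left_commute)
    show "dbl (p + 1) q (\<lambda>\<eta>. \<iota> V (F \<eta>)) G \<eta> = (\<lambda>x vs. 1 * \<iota> V (dbl p q F G \<eta>) x vs +
        (sg p * sg (p * q)) * (lie V (G (F \<eta>)) x vs - G (lie V (F \<eta>)) x vs))"
      unfolding dbl_def a b d_interior[of V "F (G \<eta>)"] e sgn
      by (simp add: fun_eq_iff section_interior_apply algebra_simps)
  qed
  then show ?case by (simp add: algebra_simps)
next
  case (linear k F F' a b)
  show ?case
  proof (rule contr.congr[OF contr.linear[OF linear.IH(1) linear.IH(2), of a b]])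
    fix \<eta> assume \<eta>: "\<eta> \<in> \<Omega>"
    note \<Omega> = contr_Omega[OF linear.hyps(1)] contr_Omega[OF linear.hyps(2)] contr_Omega[OF G] d_Omega \<eta>
    show "dbl k q (\<lambda>\<eta> x vs. a * F \<eta> x vs + b * F' \<eta> x vs) G \<eta> =
        (\<lambda>x vs. a * dbl k q F G \<eta> x vs + b * dbl k q F' G \<eta> x vs)"
      by (simp add: dbl_def d_linear contr_linear[OF G] \<Omega> algebra_simps)
  qed
next
  case (congr k F F')
  show ?case
    by (rule contr.congr[OF congr.IH]) (simp add: dbl_def congr.hyps(2) d_Omega contr_Omega[OF G])
qed

end

section \<open>Alternating forms and exterior powers\<close>

lemma alternating_on_zero: "alternating_on S p (\<lambda>us. 0)"
  by (simp add: alternating_on_def)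

lemma alternating_on_linear:
  assumes "alternating_on S p \<omega>" "alternating_on S p \<omega>'"
  shows "alternating_on S p (\<lambda>us. a * \<omega> us + b * \<omega>' us)"
  using alternating_on_combination[OF assms(1)
      alternating_on_combination[OF assms(2) alternating_on_zero], of a b] by simp

lemma alternating_on_weighted_sum:
  assumes "\<And>i. i \<in> I \<Longrightarrow> alternating_on S p (\<omega> i)"
  shows "alternating_on S p (\<lambda>us. \<Sum>i\<in>I. a i * \<omega> i us)"
  using assms
proof (induction I rule: infinite_finite_induct)
  case (insert i I)
  then show ?case
    using alternating_on_linear[of S p "\<omega> i" "\<lambda>us. \<Sum>i\<in>I. a i * \<omega> i us" "a i" 1] by simp
qed (simp_all add: alternating_on_zero)

lemma alternating_on_Cons:
  assumes "alternating_on S (p + 1) \<omega>" "v \<in> S"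
  shows "alternating_on S p (\<lambda>us. \<omega> (v # us))"
  unfolding alternating_on_def
proof (intro conjI allI impI, goal_cases)
  case (1 us vs w w' a b)
  then show ?case
    using assms(1)[unfolded alternating_on_def, THEN conjunct1, rule_format, of "v # us" vs w w' a b] assms(2)
    by simp
next
  case (2 us vs ws w w')
  then show ?case
    using assms(1)[unfolded alternating_on_def, THEN conjunct2, rule_format, of "v # us" vs ws w w'] assms(2)
    by simp
qed

lemma alternating_on_rev:
  assumes "alternating_on S p \<omega>"
  shows "alternating_on S p (\<lambda>us. \<omega> (rev us))"
  unfolding alternating_on_def
proof (intro conjI allI impI, goal_cases)
  case (1 us vs w w' a b)
  then show ?case
    using assms[unfolded alternating_on_def, THEN conjunct1, rule_format, of "rev vs" "rev us" w w' a b]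
    by (simp add: add.commute)
next
  case (2 us vs ws w w')
  then have "\<omega> (rev ws @ w' # rev vs @ w # rev us) = - \<omega> (rev ws @ w # rev vs @ w' # rev us)"
    by (intro assms[unfolded alternating_on_def, THEN conjunct2, rule_format]) (simp add: algebra_simps)
  then show ?case by simp
qed

lemma exterior_power_linear:
  assumes "R \<in> exterior_power S k" "alternating_on S k \<omega>" "alternating_on S k \<omega>'"
  shows "R (\<lambda>us. a * \<omega> us + b * \<omega>' us) = a * R \<omega> + b * R \<omega>'"
  using assms(1) unfolding exterior_power_def
proof (induction rule: span_induct_alt)
  case (step c w R)
  then obtain vs where "w = wedge S vs" "int (length vs) = k" by blast
  then show ?case using step(2) assms(2,3) alternating_on_linear[OF assms(2,3)]
    by (simp add: wedge_def algebra_simps)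
qed simp

lemma exterior_power_cong:
  assumes "R \<in> exterior_power S k" "alternating_on S k \<omega>" "alternating_on S k \<omega>'"
    and "\<And>us. set us \<subseteq> S \<Longrightarrow> int (length us) = k \<Longrightarrow> \<omega> us = \<omega>' us"
  shows "R \<omega> = R \<omega>'"
  using assms(1) unfolding exterior_power_def
proof (induction rule: span_induct_alt)
  case (step c w R)
  then obtain vs where "w = wedge S vs" "int (length vs) = k" "set vs \<subseteq> S" by blast
  then show ?case using step(2) assms by (simp add: wedge_def)
qed simp

lemma exterior_power_not_alternating:
  assumes "R \<in> exterior_power S k" "\<not> alternating_on S k \<omega>"
  shows "R \<omega> = 0"
  using assms(1) unfolding exterior_power_def
proof (induction rule: span_induct_alt)
  case (step c w R)
  then show ?case using assms(2) by (auto simp: wedge_def)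
qed simp

lemma exterior_power_zero_form: "R \<in> exterior_power S k \<Longrightarrow> R (\<lambda>us. 0) = 0"
  using exterior_power_linear[OF _ alternating_on_zero alternating_on_zero, of R S k 0 0] by simp

lemma exterior_power_sum:
  assumes "R \<in> exterior_power S k" "\<And>i. i \<in> I \<Longrightarrow> alternating_on S k (\<omega> i)"
  shows "R (\<lambda>us. \<Sum>i\<in>I. a i * \<omega> i us) = (\<Sum>i\<in>I. a i * R (\<omega> i))"
  using assms(2)
proof (induction I rule: infinite_finite_induct)
  case (insert i I)
  have "R (\<lambda>us. a i * \<omega> i us + 1 * (\<Sum>i\<in>I. a i * \<omega> i us)) = a i * R (\<omega> i) + 1 * R (\<lambda>us. \<Sum>i\<in>I. a i * \<omega> i us)"
    using insert.prems by (intro exterior_power_linear[OF assms(1)] alternating_on_weighted_sum) auto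
  then show ?case using insert by simp
qed (simp_all add: exterior_power_zero_form[OF assms(1)])

lemma exterior_power_negative: "k < 0 \<Longrightarrow> exterior_power S k = {0}"
  by (simp add: exterior_power_def)

text \<open>The new functional is \<open>v\<close> \<and> \<open>R\<close>; contraction of forms
  with \<open>v\<close> is the transpose of this exterior multiplication.\<close>

lemma exterior_power_wedge_left:
  assumes "R \<in> exterior_power S k" "v \<in> S"
  shows "\<exists>R'\<in>exterior_power S (k + 1). \<forall>\<omega>. alternating_on S (k + 1) \<omega> \<longrightarrow> R' \<omega> = R (\<lambda>us. \<omega> (v # us))"
  using assms(1) unfolding exterior_power_def
proof (induction rule: span_induct_alt)
  case base
  then show ?case by (intro bexI[OF _ span_zero]) simp
next
  case (step c w R)
  then obtain vs where vs: "w = wedge S vs" "int (length vs) = k" "set vs \<subseteq> S" by blast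
  obtain R' where R': "R' \<in> span (wedge S ` {vs. set vs \<subseteq> S \<and> int (length vs) = k + 1})"
    "\<And>\<omega>. alternating_on S (k + 1) \<omega> \<Longrightarrow> R' \<omega> = R (\<lambda>us. \<omega> (v # us))"
    using step(2) by blast
  have "wedge S (v # vs) \<in> span (wedge S ` {vs. set vs \<subseteq> S \<and> int (length vs) = k + 1})"
    using vs assms(2) by (intro span_base imageI) auto
  then have "c *\<^sub>R wedge S (v # vs) + R' \<in> span (wedge S ` {vs. set vs \<subseteq> S \<and> int (length vs) = k + 1})"
    using R'(1) by (intro span_add span_scale)
  moreover have "(c *\<^sub>R wedge S (v # vs) + R') \<omega> = (c *\<^sub>R w + R) (\<lambda>us. \<omega> (v # us))"
    if "alternating_on S (k + 1) \<omega>" for \<omega>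
    using R'(2)[OF that] vs(1,2) that alternating_on_Cons[OF that assms(2)] by (auto simp: wedge_def add.commute)
  ultimately show ?case by blast
qed

text \<open>Reconstruction from finitely many values, where the points of \<open>T\<close> may be
  redundant. Thus all lists of basis vectors can serve as test points, and no increasing lists have
  to be singled out. The induction splits off one point \<open>s\<close> and passes to the functions
  vanishing there.\<close>

lemma dual_family:
  fixes A :: "('x \<Rightarrow> real) set"
  assumes "finite T" "subspace A" "\<And>\<omega>. \<omega> \<in> A \<Longrightarrow> (\<forall>t\<in>T. \<omega> t = 0) \<Longrightarrow> \<omega> = 0"
  shows "\<exists>\<epsilon>. (\<forall>t\<in>T. \<epsilon> t \<in> A) \<and> (\<forall>\<omega>\<in>A. \<omega> = (\<Sum>t\<in>T. \<omega> t *\<^sub>R \<epsilon> t))"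
  using assms
proof (induction T arbitrary: A)
  case empty
  then show ?case by auto
next
  case (insert s T)
  define A' where "A' = {\<omega> \<in> A. \<omega> s = 0}"
  have "subspace A'"
    using insert.prems(1) by (auto simp: A'_def subspace_def)
  moreover have "\<omega> = 0" if "\<omega> \<in> A'" "\<forall>t\<in>T. \<omega> t = 0" for \<omega>
    using that by (intro insert.prems(2)) (auto simp: A'_def)
  ultimately obtain \<epsilon> where \<epsilon>: "\<forall>t\<in>T. \<epsilon> t \<in> A'" "\<And>\<omega>. \<omega> \<in> A' \<Longrightarrow> \<omega> = (\<Sum>t\<in>T. \<omega> t *\<^sub>R \<epsilon> t)"
    using insert.IH[of A'] by blast
  show ?case
  proof (cases "A' = A")
    case True
    \<comment> \<open>All functions of \<open>A\<close> vanish at \<open>s\<close>, so any element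
      of \<open>A\<close> could be attached to it; 0 is at hand.\<close>
    have "\<omega> = (\<Sum>t\<in>insert s T. \<omega> t *\<^sub>R (\<epsilon>(s := 0)) t)" if "\<omega> \<in> A" for \<omega>
    proof -
      have "(\<Sum>t\<in>insert s T. \<omega> t *\<^sub>R (\<epsilon>(s := 0)) t) = (\<Sum>t\<in>T. \<omega> t *\<^sub>R \<epsilon> t)"
        using insert.hyps by (auto intro!: sum.cong)
      then show ?thesis using \<epsilon>(2)[of \<omega>] True that by simp
    qed
    moreover have "(\<epsilon>(s := 0)) t \<in> A" if "t \<in> insert s T" for t
      using that \<epsilon>(1) True subspace_0[OF insert.prems(1)] by auto
    ultimately show ?thesis by blast
  next
    case False
    then obtain \<kappa> where \<kappa>: "\<kappa> \<in> A" "\<kappa> s \<noteq> 0" by (auto simp: A'_def)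
    define \<nu> where "\<nu> = inverse (\<kappa> s) *\<^sub>R \<kappa>"
    have \<nu>: "\<nu> \<in> A" "\<nu> s = 1"
      using \<kappa> subspace_scale[OF insert.prems(1)] by (auto simp: \<nu>_def)
    \<comment> \<open>Any \<omega> is the sum of \<open>\<omega> s\<close> times \<nu> and an
      element of \<open>A'\<close>; expanding that element over \<open>T\<close> collects the
      multiples of \<open>\<omega> s\<close> in the new member.\<close>
    define \<delta> where "\<delta> = \<epsilon>(s := \<nu> - (\<Sum>t\<in>T. \<nu> t *\<^sub>R \<epsilon> t))"
    have "\<delta> t \<in> A" if "t \<in> insert s T" for t
      using that \<nu>(1) \<epsilon>(1) insert.prems(1)
      by (auto simp: \<delta>_def A'_def intro!: subspace_diff subspace_sum subspace_scale)
    moreover have "\<omega> = (\<Sum>t\<in>insert s T. \<omega> t *\<^sub>R \<delta> t)" if \<omega>: "\<omega> \<in> A" for \<omega>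
    proof -
      have "\<omega> - \<omega> s *\<^sub>R \<nu> \<in> A'"
        using \<omega> \<nu> insert.prems(1) by (auto simp: A'_def intro!: subspace_diff subspace_scale)
      from \<epsilon>(2)[OF this] have "\<omega> - \<omega> s *\<^sub>R \<nu> = (\<Sum>t\<in>T. \<omega> t *\<^sub>R \<epsilon> t) - \<omega> s *\<^sub>R (\<Sum>t\<in>T. \<nu> t *\<^sub>R \<epsilon> t)"
        by (simp add: scaleR_diff_left sum_subtractf scaleR_sum_right)
      then have "\<omega> = \<omega> s *\<^sub>R \<nu> + ((\<Sum>t\<in>T. \<omega> t *\<^sub>R \<epsilon> t) - \<omega> s *\<^sub>R (\<Sum>t\<in>T. \<nu> t *\<^sub>R \<epsilon> t))"
        by (simp only: diff_eq_eq add.commute)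
      also have "\<dots> = \<omega> s *\<^sub>R \<delta> s + (\<Sum>t\<in>T. \<omega> t *\<^sub>R \<epsilon> t)"
        by (simp add: \<delta>_def scaleR_diff_right)
      also have "(\<Sum>t\<in>T. \<omega> t *\<^sub>R \<epsilon> t) = (\<Sum>t\<in>T. \<omega> t *\<^sub>R \<delta> t)"
        using insert.hyps by (auto simp: \<delta>_def intro!: sum.cong)
      also have "\<omega> s *\<^sub>R \<delta> s + (\<Sum>t\<in>T. \<omega> t *\<^sub>R \<delta> t) = (\<Sum>t\<in>insert s T. \<omega> t *\<^sub>R \<delta> t)"
        using insert.hyps by simp
      finally show ?thesis .
    qed
    ultimately show ?thesis by blast
  qed
qed

text \<open>Vanishing on lists of other lengths makes such a function alternating in every degree
  and determined by its degree-\<open>n\<close> part, so that finitely many values fix it.\<close>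

definition alternating_forms :: "nat \<Rightarrow> ('f::real_vector list \<Rightarrow> real) set" where
  "alternating_forms n = {\<omega>. alternating_on UNIV (int n) \<omega> \<and> (\<forall>us. length us \<noteq> n \<longrightarrow> \<omega> us = 0)}"

lemma alternating_forms_all:
  assumes "\<omega> \<in> alternating_forms n"
  shows "alternating_on UNIV p \<omega>"
proof (cases "p = int n")
  case False
  then have "\<omega> us = 0" if "int (length us) = p" for us
    using assms that by (auto simp: alternating_forms_def)
  then show ?thesis by (simp add: alternating_on_def)
qed (use assms in \<open>simp add: alternating_forms_def\<close>)

lemma alternating_forms_dual:
  obtains T and \<epsilon> :: "'f::{real_inner, heine_borel} list \<Rightarrow> 'f list \<Rightarrow> real"
  where "finite T" "\<And>ws. ws \<in> T \<Longrightarrow> length ws = n" "\<And>ws. ws \<in> T \<Longrightarrow> \<epsilon> ws \<in> alternating_forms n"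
    "\<And>\<omega> us. \<omega> \<in> alternating_forms n \<Longrightarrow> \<omega> us = (\<Sum>ws\<in>T. \<omega> ws * \<epsilon> ws us)"
proof -
  obtain B :: "'f set" where B: "finite B" "\<And>x. x = (\<Sum>b\<in>B. (x \<bullet> b) *\<^sub>R b)"
    using finite_orthonormal_basis by blast
  define T where "T = {ws. set ws \<subseteq> B \<and> length ws = n}"
  have T: "finite T" unfolding T_def by (rule finite_lists_length_eq[OF B(1)])
  have sep: "\<omega> = 0" if \<omega>: "\<omega> \<in> alternating_forms n" and 0: "\<forall>ws\<in>T. \<omega> ws = 0" for \<omega>
  proof
    fix us
    \<comment> \<open>\<open>ws\<close> already consists of basis vectors; the arguments in
      \<open>vs\<close> are expanded one by one.\<close>
    have "\<omega> (ws @ vs) = 0" if "set ws \<subseteq> B" "length (ws @ vs) = n" for ws vs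
      using that
    proof (induction vs arbitrary: ws)
      case Nil
      then show ?case using 0 by (simp add: T_def)
    next
      case (Cons v vs)
      have "\<omega> (ws @ v # vs) = \<omega> (ws @ (\<Sum>b\<in>B. (v \<bullet> b) *\<^sub>R b) # vs)" using B(2)[of v] by simp
      also have "\<dots> = (\<Sum>b\<in>B. (v \<bullet> b) * \<omega> (ws @ b # vs))"
        by (rule alternating_on_sum[OF alternating_forms_all[OF \<omega>]]) (use B(1) in auto)
      also have "\<dots> = 0"
      proof (rule sum.neutral, rule ballI)
        fix b assume "b \<in> B"
        then show "(v \<bullet> b) * \<omega> (ws @ b # vs) = 0"
          using Cons.IH[of "ws @ [b]"] Cons.prems by simp
      qed
      finally show ?case .
    qed
    from this[of "[]" us] show "\<omega> us = 0 us"
      using \<omega> by (cases "length us = n") (auto simp: alternating_forms_def)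
  qed
  have sub: "subspace (alternating_forms n :: ('f list \<Rightarrow> real) set)"
    unfolding subspace_def
  proof (intro conjI ballI allI)
    show "(0 :: 'f list \<Rightarrow> real) \<in> alternating_forms n"
      by (simp add: alternating_forms_def alternating_on_def)
    show "\<omega> + \<omega>' \<in> alternating_forms n"
      if "\<omega> \<in> alternating_forms n" "\<omega>' \<in> alternating_forms n" for \<omega> \<omega>' :: "'f list \<Rightarrow> real"
      using that alternating_on_linear[of UNIV "int n" \<omega> \<omega>' 1 1]
      by (auto simp: alternating_forms_def plus_fun_def)
    show "c *\<^sub>R \<omega> \<in> alternating_forms n" if "\<omega> \<in> alternating_forms n" for c and \<omega> :: "'f list \<Rightarrow> real"
      using that alternating_on_linear[of UNIV "int n" \<omega> \<omega> c 0]
      by (auto simp: alternating_forms_def scaleR_fun_def)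
  qed
  obtain \<epsilon> where \<epsilon>: "\<forall>t\<in>T. \<epsilon> t \<in> alternating_forms n"
    "\<forall>\<omega>\<in>alternating_forms n. \<omega> = (\<Sum>t\<in>T. \<omega> t *\<^sub>R \<epsilon> t)"
    using dual_family[OF T sub sep] by blast
  have app: "(\<Sum>t\<in>S. \<omega> t *\<^sub>R \<epsilon> t) us = (\<Sum>t\<in>S. \<omega> t * \<epsilon> t us)" if "finite S" for S \<omega> us
    using that by (induction S) auto
  show thesis
  proof (rule that[OF T, of \<epsilon>])
    show "\<omega> us = (\<Sum>ws\<in>T. \<omega> ws * \<epsilon> ws us)" if "\<omega> \<in> alternating_forms n" for \<omega> us
      using \<epsilon>(2) that app[OF T, of \<omega> us] by metis
  qed (use \<epsilon>(1) in \<open>auto simp: T_def\<close>)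
qed

context algebroid_context
begin

section \<open>Forms with constant coefficients in a frame\<close>

lemma multilinear_smooth:
  fixes \<omega> :: "'f list \<Rightarrow> real"
  assumes alt: "\<And>p. alternating_on UNIV p \<omega>" and U: "open U"
  shows "(\<And>g. g \<in> set gs \<Longrightarrow> msmooth At U g) \<Longrightarrow> msmooth At U (\<lambda>x. \<omega> (ws @ map (\<lambda>g. g x) gs))"
proof (induction gs arbitrary: ws)
  case Nil
  then show ?case by (simp add: msmooth_const)
next
  case (Cons g gs)
  obtain B :: "'f set" where B: "finite B" "\<And>x. x = (\<Sum>b\<in>B. (x \<bullet> b) *\<^sub>R b)"
    using finite_orthonormal_basis by blast
  have "msmooth At U (\<lambda>x. \<Sum>b\<in>B. (g x \<bullet> b) * \<omega> ((ws @ [b]) @ map (\<lambda>g. g x) gs))"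
    using Cons.prems by (intro msmooth_sum[OF U] msmooth_mult[OF U] msmooth_inner[OF U] msmooth_const Cons.IH) auto
  then show ?case
  proof (rule msmooth_cong[OF U])
    fix x
    have "\<omega> (ws @ g x # map (\<lambda>g. g x) gs) = \<omega> (ws @ (\<Sum>b\<in>B. (g x \<bullet> b) *\<^sub>R b) # map (\<lambda>g. g x) gs)"
      using B(2)[of "g x"] by simp
    also have "\<dots> = (\<Sum>b\<in>B. (g x \<bullet> b) * \<omega> (ws @ b # map (\<lambda>g. g x) gs))"
      by (rule alternating_on_sum[OF alt]) (use B(1) in auto)
    finally show "\<omega> (ws @ map (\<lambda>g. g x) (g # gs)) = (\<Sum>b\<in>B. (g x \<bullet> b) * \<omega> ((ws @ [b]) @ map (\<lambda>g. g x) gs))"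
      by simp
  qed
qed

text \<open>\<open>inv (\<theta> x)\<close> is the trivialisation on the fibre and arbitrary off it,
  hence the restriction to vectors of \<open>Fib x\<close> in what follows.\<close>

definition pull :: "('m \<Rightarrow> 'f \<Rightarrow> 'v) \<Rightarrow> 'm \<Rightarrow> ('f list \<Rightarrow> real) \<Rightarrow> 'v list \<Rightarrow> real" where
  "pull \<theta> x \<omega> = (\<lambda>us. \<omega> (map (inv (\<theta> x)) us))"

lemma frame_inv: "(U, \<theta>) \<in> Frm \<Longrightarrow> x \<in> U \<Longrightarrow> inv (\<theta> x) (\<theta> x w) = w"
  using bij_betw_imp_inj_on[OF frame_bij] by (simp add: inv_f_f)

lemma frame_inv_right: "(U, \<theta>) \<in> Frm \<Longrightarrow> x \<in> U \<Longrightarrow> v \<in> Fib x \<Longrightarrow> \<theta> x (inv (\<theta> x) v) = v"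
  using bij_betw_imp_surj_on[OF frame_bij] by (metis f_inv_into_f)

lemma frame_inv_linear:
  assumes "(U, \<theta>) \<in> Frm" "x \<in> U" "v \<in> Fib x" "w \<in> Fib x"
  shows "inv (\<theta> x) (a *\<^sub>R v + b *\<^sub>R w) = a *\<^sub>R inv (\<theta> x) v + b *\<^sub>R inv (\<theta> x) w"
proof -
  have "a *\<^sub>R v + b *\<^sub>R w = \<theta> x (a *\<^sub>R inv (\<theta> x) v + b *\<^sub>R inv (\<theta> x) w)"
    using frame_linear[OF assms(1,2)] frame_inv_right[OF assms(1,2)] assms(3,4)
    by (simp add: linear_add linear_scale)
  then show ?thesis using frame_inv[OF assms(1,2)] by simp
qed

lemma pull_alternating:
  assumes "(U, \<theta>) \<in> Frm" "x \<in> U" "alternating_on UNIV p \<omega>"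
  shows "alternating_on (Fib x) p (pull \<theta> x \<omega>)"
  unfolding alternating_on_def
proof (intro conjI allI impI, goal_cases)
  case (1 us vs v w a b)
  then show ?case
    using assms(3)[unfolded alternating_on_def, THEN conjunct1, rule_format]
    by (simp add: pull_def frame_inv_linear[OF assms(1,2)])
next
  case (2 us vs ws v w)
  show ?case
    unfolding pull_def map_append list.map
    by (rule assms(3)[unfolded alternating_on_def, THEN conjunct2, rule_format]) (use 2 in simp)
qed

text \<open>In another frame the coefficients of the form are \<omega> evaluated on smooth
  transition functions; a bump function makes the form global.\<close>

lemma pull_extend:
  assumes U: "(U, \<theta>) \<in> Frm" "x0 \<in> U" and \<omega>: "\<omega> \<in> alternating_forms n"
  obtains \<eta> N where "\<eta> \<in> \<Omega>" "open N" "x0 \<in> N" "N \<subseteq> U"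
    "\<And>x vs. x \<in> N \<Longrightarrow> set vs \<subseteq> Fib x \<Longrightarrow> \<eta> x vs = pull \<theta> x \<omega> vs"
proof -
  note alt = alternating_forms_all[OF \<omega>]
  obtain h K V where h: "h \<in> C" "closed K" "K \<subseteq> U" "\<And>x. x \<notin> K \<Longrightarrow> h x = 0"
    and V: "open V" "x0 \<in> V" "V \<subseteq> U" "\<And>x. x \<in> V \<Longrightarrow> h x = 1"
    using bump[OF frame_open[OF U(1)] U(2)] by metis
  define \<eta> where "\<eta> = (\<lambda>x vs. if x \<in> U \<and> set vs \<subseteq> Fib x then h x * pull \<theta> x \<omega> vs else 0)"
  have "\<eta> \<in> \<Omega>"
  proof (rule OmegaI[of _ n])
    fix x p
    show "alternating_on (Fib x) p (\<eta> x)"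
    proof (cases "x \<in> U")
      case True
      have "alternating_on (Fib x) p (\<lambda>vs. h x * pull \<theta> x \<omega> vs + 0 * pull \<theta> x \<omega> vs)"
        by (intro alternating_on_linear pull_alternating[OF U(1) True] alt)
      then have *: "alternating_on (Fib x) p (\<lambda>vs. h x * pull \<theta> x \<omega> vs)" by simp
      show ?thesis unfolding alternating_on_def
      proof (intro conjI allI impI, goal_cases)
        case (1 us vs v w a b)
        then show ?case
          using *[unfolded alternating_on_def, THEN conjunct1, rule_format, OF 1] True subspace_fibre[of x]
          by (simp add: \<eta>_def subspace_add subspace_scale)
      next
        case (2 us vs ws v w)
        then show ?case
          using *[unfolded alternating_on_def, THEN conjunct2, rule_format, OF 2] True by (simp add: \<eta>_def)
      qed
    qed (simp add: \<eta>_def alternating_on_def)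
  next
    show "\<eta> x vs = 0" if "n < length vs" for x vs
      using \<omega> that by (simp add: \<eta>_def pull_def alternating_forms_def)
  next
    fix U' \<theta>' ws assume U': "(U', \<theta>') \<in> Frm"
    note oU' = frame_open[OF U'] and oU = frame_open[OF U(1)]
    have "\<exists>gs. (\<forall>g\<in>set gs. msmooth At (U \<inter> U') g) \<and> (\<forall>x\<in>U \<inter> U'. map (inv (\<theta> x)) (map (\<theta>' x) ws) = map (\<lambda>g. g x) gs)"
    proof (induction ws)
      case Nil
      show ?case by (rule exI[of _ "[]"]) simp
    next
      case (Cons w ws)
      then obtain gs where gs: "\<forall>g\<in>set gs. msmooth At (U \<inter> U') g"
        "\<forall>x\<in>U \<inter> U'. map (inv (\<theta> x)) (map (\<theta>' x) ws) = map (\<lambda>g. g x) gs" by blast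
      obtain g where "msmooth At (U' \<inter> U) g" "\<And>x. x \<in> U' \<inter> U \<Longrightarrow> \<theta>' x w = \<theta> x (g x)"
        using frame_transition[OF U' U(1)] by blast
      then show ?case using gs frame_inv[OF U(1)]
        by (intro exI[of _ "g # gs"]) (auto simp: Int_commute)
    qed
    then obtain gs where gs: "\<And>g. g \<in> set gs \<Longrightarrow> msmooth At (U \<inter> U') g"
      "\<And>x. x \<in> U \<inter> U' \<Longrightarrow> map (inv (\<theta> x)) (map (\<theta>' x) ws) = map (\<lambda>g. g x) gs" by blast
    have "msmooth At (U \<inter> U') (\<lambda>x. \<omega> ([] @ map (\<lambda>g. g x) gs))"
      by (rule multilinear_smooth[OF alt]) (use oU oU' gs in auto)
    from bump_extend[OF h oU oU' this]
    show "msmooth At U' (\<lambda>x. \<eta> x (map (\<theta>' x) ws))"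
    proof (rule msmooth_cong[OF oU'])
      fix x assume "x \<in> U'"
      then show "\<eta> x (map (\<theta>' x) ws) = (if x \<in> U then h x *\<^sub>R \<omega> ([] @ map (\<lambda>g. g x) gs) else 0)"
        using frame_map_in_fibre[OF U', of x ws] gs(2)[of x] unfolding \<eta>_def pull_def by auto
    qed
  qed (simp add: \<eta>_def)
  then show thesis
  proof (rule that[OF _ V(1-3)])
    show "\<eta> x vs = pull \<theta> x \<omega> vs" if "x \<in> V" "set vs \<subseteq> Fib x" for x vs
      using that subsetD[OF V(3) that(1)] V(4)[OF that(1)] by (simp add: \<eta>_def)
  qed
qed

text \<open>The reconstruction of forms from their values, transposed: applying \<open>R\<close> to
  it gives the coefficients. They are values of \<open>R\<close> on forms that are constant in the
  frame, which makes their smoothness accessible.\<close>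

lemma exterior_power_expand:
  assumes U: "(U, \<theta>) \<in> Frm" "x \<in> U" and R: "R \<in> exterior_power (Fib x) (int n)"
    and T: "finite T" "\<And>ws. ws \<in> T \<Longrightarrow> length ws = n" "\<And>ws. ws \<in> T \<Longrightarrow> \<epsilon> ws \<in> alternating_forms n"
    "\<And>\<omega> us. \<omega> \<in> alternating_forms n \<Longrightarrow> \<omega> us = (\<Sum>ws\<in>T. \<omega> ws * \<epsilon> ws us)"
  shows "R = (\<Sum>ws\<in>T. R (pull \<theta> x (\<epsilon> ws)) *\<^sub>R wedge (Fib x) (map (\<theta> x) ws))"
proof
  fix \<omega>
  have app: "(\<Sum>ws\<in>S. c ws *\<^sub>R W ws) \<omega> = (\<Sum>ws\<in>S. c ws * W ws \<omega>)" if "finite S"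
    for S and c :: "'f list \<Rightarrow> real" and W :: "'f list \<Rightarrow> ('v list \<Rightarrow> real) \<Rightarrow> real"
    using that by (induction S) auto
  show "R \<omega> = (\<Sum>ws\<in>T. R (pull \<theta> x (\<epsilon> ws)) *\<^sub>R wedge (Fib x) (map (\<theta> x) ws)) \<omega>"
  proof (cases "alternating_on (Fib x) (int n) \<omega>")
    case False
    then show ?thesis
      using exterior_power_not_alternating[OF R False] T(2) by (simp add: app[OF T(1)] wedge_def)
  next
    case True
    \<comment> \<open>This moves \<omega> to the model fibre, where the dual family lives, with
      value 0 in the other degrees.\<close>
    define \<omega>' where "\<omega>' = (\<lambda>us. if length us = n then \<omega> (map (\<theta> x) us) else 0)"
    have "alternating_on UNIV (int n) \<omega>'"
      unfolding alternating_on_def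
    proof (intro conjI allI impI, goal_cases)
      case (1 us vs v w a b)
      have "\<omega> (map (\<theta> x) us @ (a *\<^sub>R \<theta> x v + b *\<^sub>R \<theta> x w) # map (\<theta> x) vs) =
          a * \<omega> (map (\<theta> x) us @ \<theta> x v # map (\<theta> x) vs) + b * \<omega> (map (\<theta> x) us @ \<theta> x w # map (\<theta> x) vs)"
        by (rule True[unfolded alternating_on_def, THEN conjunct1, rule_format])
          (use 1 frame_in_fibre[OF U] in auto)
      then show ?case using 1 frame_linear[OF U] by (simp add: \<omega>'_def linear_add linear_scale)
    next
      case (2 us vs ws v w)
      have "\<omega> (map (\<theta> x) us @ \<theta> x v # map (\<theta> x) vs @ \<theta> x w # map (\<theta> x) ws) =
          - \<omega> (map (\<theta> x) us @ \<theta> x w # map (\<theta> x) vs @ \<theta> x v # map (\<theta> x) ws)"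
        by (rule True[unfolded alternating_on_def, THEN conjunct2, rule_format])
          (use 2 frame_in_fibre[OF U] in auto)
      then show ?case using 2 by (simp add: \<omega>'_def)
    qed
    then have \<omega>': "\<omega>' \<in> alternating_forms n" by (simp add: alternating_forms_def \<omega>'_def)
    have palt: "alternating_on (Fib x) (int n) (pull \<theta> x (\<epsilon> ws))" if "ws \<in> T" for ws
      by (rule pull_alternating[OF U alternating_forms_all[OF T(3)[OF that]]])
    have "R \<omega> = R (\<lambda>us. \<Sum>ws\<in>T. \<omega> (map (\<theta> x) ws) * pull \<theta> x (\<epsilon> ws) us)"
    proof (rule exterior_power_cong[OF R True])
      show "alternating_on (Fib x) (int n) (\<lambda>us. \<Sum>ws\<in>T. \<omega> (map (\<theta> x) ws) * pull \<theta> x (\<epsilon> ws) us)"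
        by (rule alternating_on_weighted_sum[OF palt])
      fix us assume us: "set us \<subseteq> Fib x" "int (length us) = int n"
      have "map (\<theta> x) (map (inv (\<theta> x)) us) = us"
        using us(1) frame_inv_right[OF U] by (intro map_idI[THEN trans[OF map_map]]) auto
      then have "\<omega> us = \<omega>' (map (inv (\<theta> x)) us)" using us(2) by (simp add: \<omega>'_def)
      also have "\<dots> = (\<Sum>ws\<in>T. \<omega>' ws * \<epsilon> ws (map (inv (\<theta> x)) us))" by (rule T(4)[OF \<omega>'])
      also have "\<dots> = (\<Sum>ws\<in>T. \<omega> (map (\<theta> x) ws) * pull \<theta> x (\<epsilon> ws) us)"
        using T(2) by (intro sum.cong) (auto simp: \<omega>'_def pull_def)
      finally show "\<omega> us = (\<Sum>ws\<in>T. \<omega> (map (\<theta> x) ws) * pull \<theta> x (\<epsilon> ws) us)" .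
    qed
    also have "\<dots> = (\<Sum>ws\<in>T. \<omega> (map (\<theta> x) ws) * R (pull \<theta> x (\<epsilon> ws)))"
      by (rule exterior_power_sum[OF R palt])
    also have "\<dots> = (\<Sum>ws\<in>T. R (pull \<theta> x (\<epsilon> ws)) * wedge (Fib x) (map (\<theta> x) ws) \<omega>)"
      using True T(2) by (intro sum.cong) (auto simp: wedge_def)
    finally show ?thesis by (simp add: app[OF T(1)])
  qed
qed

text \<open>The degree-0 component of the interior product reads off the value of \<open>R x\<close>
  on a constant form. By \<open>foldr_contract\<close>, successive contractions evaluate in reverse
  order, hence the reversal of \<omega> in the proof.\<close>

lemma pull_test_form:
  assumes U: "(U, \<theta>) \<in> Frm" "x0 \<in> U" and \<omega>: "\<omega> \<in> alternating_forms n"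
  obtains \<eta> N where "\<eta> \<in> \<Omega>" "open N" "x0 \<in> N" "N \<subseteq> U"
    "\<And>x R. x \<in> N \<Longrightarrow> R x \<in> exterior_power (Fib x) (int n) \<Longrightarrow> interior R \<eta> x [] = R x (pull \<theta> x \<omega>)"
proof -
  have "(\<lambda>us. \<omega> (rev us)) \<in> alternating_forms n"
    using \<omega> alternating_on_rev[of UNIV "int n" \<omega>] by (simp add: alternating_forms_def)
  then obtain \<eta> N where \<eta>: "\<eta> \<in> \<Omega>" "open N" "x0 \<in> N" "N \<subseteq> U"
    "\<And>x vs. x \<in> N \<Longrightarrow> set vs \<subseteq> Fib x \<Longrightarrow> \<eta> x vs = pull \<theta> x (\<lambda>us. \<omega> (rev us)) vs"
    using pull_extend[OF U] by metis
  have "interior R \<eta> x [] = R x (pull \<theta> x \<omega>)"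
    if x: "x \<in> N" and R: "R x \<in> exterior_power (Fib x) (int n)" for x R
    unfolding interior_def
  proof (rule exterior_power_cong[OF R alternating_on_contracted[OF \<eta>(1)]])
    show "alternating_on (Fib x) (int n) (pull \<theta> x \<omega>)"
      using x \<eta>(4) by (intro pull_alternating[OF U(1)] alternating_forms_all[OF \<omega>]) auto
    show "foldr contract us (\<eta> x) [] = pull \<theta> x \<omega> us" if "set us \<subseteq> Fib x" for us
      using \<eta>(5)[OF x, of "rev us"] that by (simp add: foldr_contract pull_def rev_map)
  qed
  then show thesis using that \<eta> by blast
qed

section \<open>The interior product by a multivector field\<close>

lemma multivectors_exterior: "P \<in> multivectors L p \<Longrightarrow> P x \<in> exterior_power (Fib x) p"
  by (simp add: multivectors_def)

lemma foldr_interior: "foldr \<iota> Vs \<eta> x = foldr contract (map (\<lambda>V. V x) Vs) (\<eta> x)"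
  by (induction Vs) (auto simp: section_interior_def)

lemma contr_foldr: "set Vs \<subseteq> Sec \<Longrightarrow> contr (int (length Vs)) (\<lambda>\<eta>. foldr \<iota> Vs \<eta>)"
proof (induction Vs)
  case Nil
  show ?case using contr.congr[OF contr.mult[OF smooth_functions_const[of 1]], of "\<lambda>\<eta>. \<eta>"] by simp
next
  case (Cons V Vs)
  then show ?case using contr.step[of "int (length Vs)" "\<lambda>\<eta>. foldr \<iota> Vs \<eta>" V] by (simp add: add.commute)
qed

lemma contr_sum:
  "(\<And>t. t \<in> T \<Longrightarrow> contr k (F t)) \<Longrightarrow> contr k (\<lambda>\<eta> x vs. \<Sum>t\<in>T. F t \<eta> x vs)"
proof (induction T rule: infinite_finite_induct)
  case (insert t T)
  then show ?case using contr_add_op[of k "F t" "\<lambda>\<eta> x vs. \<Sum>t\<in>T. F t \<eta> x vs"] by simp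
qed (simp_all add: contr.zero)

text \<open>Near \<open>x0\<close> the frame vectors and coefficients of \<open>P\<close> extend to
  global sections and functions, hence to one contraction operator, the same for all forms.\<close>

lemma interior_local:
  assumes P: "P \<in> multivectors L p"
  obtains N F where "open N" "x0 \<in> N" "contr p F"
    "\<And>\<eta> x. \<eta> \<in> \<Omega> \<Longrightarrow> x \<in> N \<Longrightarrow> interior P \<eta> x = F \<eta> x"
proof -
  obtain U \<theta> where U: "(U, \<theta>) \<in> Frm" "x0 \<in> U" by (rule frame_around)
  have "\<forall>(U, \<theta>)\<in>Frm. \<exists>T c. finite T \<and> (\<forall>ws\<in>T. int (length ws) = p \<and> msmooth At U (c ws)) \<and>
      (\<forall>x\<in>U. P x = (\<Sum>ws\<in>T. c ws x *\<^sub>R wedge (Fib x) (map (\<theta> x) ws)))"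
    using P by (simp add: multivectors_def)
  from bspec[OF this U(1), unfolded prod.case] obtain T c where T: "finite T"
    "\<And>ws. ws \<in> T \<Longrightarrow> int (length ws) = p" "\<And>ws. ws \<in> T \<Longrightarrow> msmooth At U (c ws)"
    "\<And>x. x \<in> U \<Longrightarrow> P x = (\<Sum>ws\<in>T. c ws x *\<^sub>R wedge (Fib x) (map (\<theta> x) ws))" by blast
  obtain h N where h: "h \<in> C" "open N" "x0 \<in> N" "N \<subseteq> U" "\<And>x. x \<in> N \<Longrightarrow> h x = 1"
    "\<And>w. extend h U (\<lambda>x. \<theta> x w) \<in> Sec" "\<And>g :: 'm \<Rightarrow> real. msmooth At U g \<Longrightarrow> extend h U g \<in> C"
    using local_extension[OF U] by metis
  define Ws where "Ws = (\<lambda>ws. map (\<lambda>w. extend h U (\<lambda>x. \<theta> x w)) ws)"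
  define F where "F = (\<lambda>\<eta> x vs. \<Sum>ws\<in>T. extend h U (c ws) x * foldr \<iota> (Ws ws) \<eta> x vs)"
  have "contr p F"
    unfolding F_def
  proof (rule contr_sum)
    fix ws assume ws: "ws \<in> T"
    have "contr (int (length (Ws ws))) (\<lambda>\<eta>. foldr \<iota> (Ws ws) \<eta>)"
      using h(6) by (intro contr_foldr) (auto simp: Ws_def)
    then show "contr p (\<lambda>\<eta> x vs. extend h U (c ws) x * foldr \<iota> (Ws ws) \<eta> x vs)"
      using contr_mult[OF _ h(7)[OF T(3)[OF ws]]] T(2)[OF ws] by (simp add: Ws_def)
  qed
  moreover have "interior P \<eta> x = F \<eta> x" if \<eta>: "\<eta> \<in> \<Omega>" and x: "x \<in> N" for \<eta> x
  proof
    fix vs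
    have app: "(\<Sum>ws\<in>S. c ws x *\<^sub>R W ws) \<omega> = (\<Sum>ws\<in>S. c ws x * W ws \<omega>)" if "finite S"
      for S \<omega> and W :: "'f list \<Rightarrow> ('v list \<Rightarrow> real) \<Rightarrow> real"
      using that by (induction S) auto
    have m: "map (\<lambda>V. V x) (Ws ws) = map (\<theta> x) ws" for ws
      using h(4,5) x by (auto simp: Ws_def extend_def)
    have "interior P \<eta> x vs = (\<Sum>ws\<in>T. c ws x * foldr contract (map (\<theta> x) ws) (\<eta> x) vs)"
      using T(4)[of x] x h(4) alternating_on_contracted[OF \<eta>]
      by (auto simp: interior_def app[OF T(1)] wedge_def subset_iff)
    also have "\<dots> = F \<eta> x vs"
      using x h(4,5) by (auto simp: F_def extend_def foldr_interior m subset_iff)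
    finally show "interior P \<eta> x vs = F \<eta> x vs" .
  qed
  ultimately show thesis using that h(2,3) by blast
qed

text \<open>Membership in \<open>Omega L\<close> is a local condition apart from the degree
  bound.\<close>

lemma interior_Omega:
  assumes P: "P \<in> multivectors L p" and \<eta>: "\<eta> \<in> \<Omega>"
  shows "interior P \<eta> \<in> \<Omega>"
proof -
  have loc: "\<exists>N \<zeta>. open N \<and> x0 \<in> N \<and> \<zeta> \<in> \<Omega> \<and> (\<forall>x\<in>N. interior P \<eta> x = \<zeta> x)" for x0
  proof -
    obtain N F where "open N" "x0 \<in> N" "contr p F" "\<And>\<eta> x. \<eta> \<in> \<Omega> \<Longrightarrow> x \<in> N \<Longrightarrow> interior P \<eta> x = F \<eta> x"
      using interior_local[OF P] by metis
    then show ?thesis using contr_Omega \<eta> by blast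
  qed
  obtain n where n: "\<And>x vs. n < length vs \<Longrightarrow> \<eta> x vs = 0" using Omega_bounded[OF \<eta>] by blast
  show ?thesis
  proof (rule OmegaI[of _ n])
    show "alternating_on (Fib x) q (interior P \<eta> x)" for x q
      using loc[of x] Omega_alternating by metis
    show "interior P \<eta> x vs = 0" if "\<not> set vs \<subseteq> Fib x" for x vs
      using loc[of x] Omega_outside that by metis
    \<comment> \<open>Beyond the degree bound the functional \<open>P x\<close> is applied to the
      zero form.\<close>
    show "interior P \<eta> x vs = 0" if "n < length vs" for x vs
      using n that exterior_power_zero_form[OF multivectors_exterior[OF P, of x]]
      by (simp add: interior_def foldr_contract)
    fix U \<theta> ws assume U: "(U, \<theta>) \<in> Frm"
    show "msmooth At U (\<lambda>x. interior P \<eta> x (map (\<theta> x) ws))"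
    proof (rule msmooth_localI[OF frame_open[OF U]])
      fix x0
      obtain N \<zeta> where \<zeta>: "open N" "x0 \<in> N" "\<zeta> \<in> \<Omega>" "\<forall>x\<in>N. interior P \<eta> x = \<zeta> x" using loc by blast
      have "msmooth At (U \<inter> N) (\<lambda>x. \<zeta> x (map (\<theta> x) ws))"
        by (rule msmooth_subset[OF Omega_smooth[OF \<zeta>(3) U]]) simp
      then show "\<exists>N g'. open N \<and> x0 \<in> N \<and> msmooth At (U \<inter> N) g' \<and>
          (\<forall>y\<in>U \<inter> N. interior P \<eta> y (map (\<theta> y) ws) = g' y)"
        using \<zeta> by (intro exI[of _ N] exI[of _ "\<lambda>x. \<zeta> x (map (\<theta> x) ws)"]) auto
    qed
  qed
qed

lemma interior_linear_form:
  assumes P: "P \<in> multivectors L p" and "\<eta> \<in> \<Omega>" "\<zeta> \<in> \<Omega>"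
  shows "interior P (\<lambda>x vs. a * \<eta> x vs + b * \<zeta> x vs) = (\<lambda>x vs. a * interior P \<eta> x vs + b * interior P \<zeta> x vs)"
proof (intro ext)
  fix x vs
  obtain N F where F: "x \<in> N" "contr p F" "\<And>\<eta> x. \<eta> \<in> \<Omega> \<Longrightarrow> x \<in> N \<Longrightarrow> interior P \<eta> x = F \<eta> x"
    using interior_local[OF P] by metis
  show "interior P (\<lambda>x vs. a * \<eta> x vs + b * \<zeta> x vs) x vs = a * interior P \<eta> x vs + b * interior P \<zeta> x vs"
    using F(3)[OF _ F(1)] contr_linear[OF F(2) assms(2,3)] assms Omega_linear by simp
qed

lemma interior_scale_form:
  "P \<in> multivectors L p \<Longrightarrow> \<eta> \<in> \<Omega> \<Longrightarrow> interior P (\<lambda>x vs. a * \<eta> x vs) = (\<lambda>x vs. a * interior P \<eta> x vs)"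
  using interior_linear_form[of P p \<eta> \<eta> a 0] by simp

section \<open>Locality of the exterior derivative\<close>

lemma cochain_lie_local:
  assumes N: "open N"
  shows "V \<in> Sec \<Longrightarrow> smooth_valued c \<Longrightarrow> smooth_valued c' \<Longrightarrow> set Vs \<subseteq> Sec \<Longrightarrow>
    (\<And>Us y. set Us \<subseteq> Sec \<Longrightarrow> y \<in> N \<Longrightarrow> c Us y = c' Us y) \<Longrightarrow> y \<in> N \<Longrightarrow>
    cochain_lie V c Vs y = cochain_lie V c' Vs y"
proof (induction Vs arbitrary: c c')
  case Nil
  then show ?case using act_local[OF Nil(1) _ _ N, of "c []" "c' []"] smooth_valuedD by simp
next
  case (Cons W Vs)
  have "cochain_lie V (\<lambda>Us. c (W # Us)) Vs y = cochain_lie V (\<lambda>Us. c' (W # Us)) Vs y"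
    by (rule Cons.IH) (use Cons.prems smooth_valued_insert in auto)
  then show ?case using Cons.prems bracket_section by simp
qed

lemma cochain_d_local:
  assumes N: "open N"
  shows "smooth_valued c \<Longrightarrow> smooth_valued c' \<Longrightarrow> set Vs \<subseteq> Sec \<Longrightarrow>
    (\<And>Us y. set Us \<subseteq> Sec \<Longrightarrow> y \<in> N \<Longrightarrow> c Us y = c' Us y) \<Longrightarrow> y \<in> N \<Longrightarrow>
    cochain_d c Vs y = cochain_d c' Vs y"
proof (induction Vs arbitrary: c c')
  case (Cons W Vs)
  have "cochain_d (\<lambda>Us. c (W # Us)) Vs y = cochain_d (\<lambda>Us. c' (W # Us)) Vs y"
    by (rule Cons.IH) (use Cons.prems smooth_valued_insert in auto)
  moreover have "cochain_lie W c Vs y = cochain_lie W c' Vs y"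
    by (rule cochain_lie_local[OF N]) (use Cons.prems in auto)
  ultimately show ?case by simp
qed simp

lemma d_local:
  assumes "\<eta> \<in> \<Omega>" "\<zeta> \<in> \<Omega>" "open N" "\<And>y. y \<in> N \<Longrightarrow> \<eta> y = \<zeta> y" "x \<in> N"
  shows "d \<eta> x = d \<zeta> x"
proof
  fix vs
  show "d \<eta> x vs = d \<zeta> x vs"
  proof (cases "set vs \<subseteq> Fib x")
    case True
    then obtain Vs where Vs: "set Vs \<subseteq> Sec" "map (\<lambda>V. V x) Vs = vs" using sections_through by blast
    have "cochain_d (eval_form \<eta>) Vs x = cochain_d (eval_form \<zeta>) Vs x"
      by (rule cochain_d_local[OF assms(3) _ _ Vs(1) _ assms(5)])
        (simp_all add: cochain_smooth_valued cochain_eval_form assms eval_form_def)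
    then show ?thesis
      using eval_d[OF assms(1) Vs(1)] eval_d[OF assms(2) Vs(1)] Vs(2) by (auto simp: eval_form_def fun_eq_iff)
  qed (simp add: Omega_outside d_Omega assms)
qed

section \<open>The Schouten-Nijenhuis bracket\<close>

text \<open>The point is fixed first: multiplication by f becomes f(x) times the empty wedge, and
  i(V) in front becomes the exterior product with V(x) from the left. Nothing is claimed yet about
  dependence on \<open>x\<close>.\<close>

lemma contr_functional:
  "contr k F \<Longrightarrow> \<exists>R\<in>exterior_power (Fib x) k. \<forall>\<eta>\<in>\<Omega>. \<forall>vs. F \<eta> x vs = R (\<lambda>us. foldr contract us (\<eta> x) vs)"
proof (induction rule: contr.induct)
  case (zero k)
  show ?case by (rule bexI[of _ 0]) (simp_all add: exterior_power_def span_zero)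
next
  case (mult f)
  show ?case
  proof (rule bexI[of _ "f x *\<^sub>R wedge (Fib x) []"])
    show "f x *\<^sub>R wedge (Fib x) [] \<in> exterior_power (Fib x) 0"
      unfolding exterior_power_def by (intro span_scale span_base imageI) simp
    show "\<forall>\<eta>\<in>\<Omega>. \<forall>vs. f x * \<eta> x vs = (f x *\<^sub>R wedge (Fib x) []) (\<lambda>us. foldr contract us (\<eta> x) vs)"
    proof (intro ballI allI)
      show "f x * \<eta> x vs = (f x *\<^sub>R wedge (Fib x) []) (\<lambda>us. foldr contract us (\<eta> x) vs)"
        if "\<eta> \<in> \<Omega>" for \<eta> vs
        using alternating_on_contracted[OF that, of x 0 vs] by (simp add: wedge_def)
    qed
  qed
next
  case (step k F V)
  then obtain R where R: "R \<in> exterior_power (Fib x) k"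
    "\<And>\<eta> vs. \<eta> \<in> \<Omega> \<Longrightarrow> F \<eta> x vs = R (\<lambda>us. foldr contract us (\<eta> x) vs)" by blast
  obtain R' where R': "R' \<in> exterior_power (Fib x) (k + 1)"
    "\<And>\<omega>. alternating_on (Fib x) (k + 1) \<omega> \<Longrightarrow> R' \<omega> = R (\<lambda>us. \<omega> (V x # us))"
    using exterior_power_wedge_left[OF R(1) section_in_fibre[OF step.hyps(2)]] by blast
  have "\<iota> V (F \<eta>) x vs = R' (\<lambda>us. foldr contract us (\<eta> x) vs)" if "\<eta> \<in> \<Omega>" for \<eta> vs
  proof -
    have "\<iota> V (F \<eta>) x vs = R (\<lambda>us. foldr contract us (\<eta> x) (V x # vs))"
      using R(2)[OF that] by (simp add: section_interior_apply)
    also have "\<dots> = R (\<lambda>us. foldr contract (V x # us) (\<eta> x) vs)" by (simp add: contract_def)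
    also have "\<dots> = R' (\<lambda>us. foldr contract us (\<eta> x) vs)"
      using R'(2)[OF alternating_on_contracted[OF that]] by simp
    finally show ?thesis .
  qed
  then show ?case using R'(1) by blast
next
  case (linear k F G a b)
  then obtain R S where R: "R \<in> exterior_power (Fib x) k"
    "\<And>\<eta> vs. \<eta> \<in> \<Omega> \<Longrightarrow> F \<eta> x vs = R (\<lambda>us. foldr contract us (\<eta> x) vs)"
    and S: "S \<in> exterior_power (Fib x) k"
    "\<And>\<eta> vs. \<eta> \<in> \<Omega> \<Longrightarrow> G \<eta> x vs = S (\<lambda>us. foldr contract us (\<eta> x) vs)" by blast
  have "a *\<^sub>R R + b *\<^sub>R S \<in> exterior_power (Fib x) k"
    using R(1) S(1) unfolding exterior_power_def by (intro span_add span_scale)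
  then show ?case using R(2) S(2) by (intro bexI[of _ "a *\<^sub>R R + b *\<^sub>R S"]) simp_all
next
  case (congr k F F')
  then show ?case by simp
qed

text \<open>For fixed \<open>x\<close> one operator \<open>H\<close> works for all forms, which is
  what \<open>contr_functional\<close> needs.\<close>

lemma dbl_interior_local:
  assumes P: "P \<in> multivectors L p" and Q: "Q \<in> multivectors L q"
  obtains H where "contr (p + q - 1) H"
    "\<And>\<eta>. \<eta> \<in> \<Omega> \<Longrightarrow> dbl p q (interior P) (interior Q) \<eta> x = H \<eta> x"
proof -
  obtain N F where F: "open N" "x \<in> N" "contr p F" "\<And>\<eta> x. \<eta> \<in> \<Omega> \<Longrightarrow> x \<in> N \<Longrightarrow> interior P \<eta> x = F \<eta> x"
    using interior_local[OF P] by metis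
  obtain M G where G: "open M" "x \<in> M" "contr q G" "\<And>\<eta> x. \<eta> \<in> \<Omega> \<Longrightarrow> x \<in> M \<Longrightarrow> interior Q \<eta> x = G \<eta> x"
    using interior_local[OF Q] by metis
  note \<Omega> = contr_Omega[OF F(3)] contr_Omega[OF G(3)] interior_Omega[OF P] interior_Omega[OF Q] d_Omega
  have NM: "open (N \<inter> M)" using F(1) G(1) by (rule open_Int)
  have "dbl p q (interior P) (interior Q) \<eta> x = dbl p q F G \<eta> x" if \<eta>: "\<eta> \<in> \<Omega>" for \<eta>
  proof -
    have PF: "interior P \<zeta> y = F \<xi> y" if "\<zeta> \<in> \<Omega>" "\<xi> \<in> \<Omega>" "y \<in> N" "\<zeta> y = \<xi> y" for \<zeta> \<xi> y
      using F(4)[OF that(1,3)] contr_pointwise[OF F(3) that(1,2,4)] by simp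
    have QG: "interior Q \<zeta> y = G \<xi> y" if "\<zeta> \<in> \<Omega>" "\<xi> \<in> \<Omega>" "y \<in> M" "\<zeta> y = \<xi> y" for \<zeta> \<xi> y
      using G(4)[OF that(1,3)] contr_pointwise[OF G(3) that(1,2,4)] by simp
    have "d (interior Q \<eta>) x = d (G \<eta>) x"
      by (rule d_local[OF _ _ G(1) _ G(2)]) (simp_all add: \<Omega> \<eta> G(4))
    then have 1: "interior P (d (interior Q \<eta>)) x = F (d (G \<eta>)) x"
      by (intro PF \<Omega> \<eta> F(2))
    \<comment> \<open>Here \<open>d\<close> is applied last, so agreement is needed on a
      neighbourhood; the contractions outside a \<open>d\<close> need it at \<open>x\<close>
      only.\<close>
    have "interior P (interior Q \<eta>) y = F (G \<eta>) y" if "y \<in> N \<inter> M" for y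
      using that by (intro PF \<Omega> \<eta> G(4)) auto
    then have 2: "d (interior P (interior Q \<eta>)) x = d (F (G \<eta>)) x"
      by (intro d_local[OF _ _ NM]) (use \<Omega> \<eta> F(2) G(2) in simp_all)
    have 3: "interior Q (interior P (d \<eta>)) x = G (F (d \<eta>)) x"
      by (intro QG \<Omega> \<eta> G(2) F(4) F(2))
    have "d (interior P \<eta>) x = d (F \<eta>) x"
      by (rule d_local[OF _ _ F(1) _ F(2)]) (simp_all add: \<Omega> \<eta> F(4))
    then have 4: "interior Q (d (interior P \<eta>)) x = G (d (F \<eta>)) x"
      by (intro QG \<Omega> \<eta> G(2))
    show ?thesis unfolding dbl_def 1 2 3 4 ..
  qed
  then show thesis using that[OF contr_dbl[OF G(3) F(3)]] by blast
qed

lemma dbl_Omega: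
  assumes P: "P \<in> multivectors L p" and Q: "Q \<in> multivectors L q" and "\<eta> \<in> \<Omega>"
  shows "dbl p q (interior P) (interior Q) \<eta> \<in> \<Omega>"
  unfolding dbl_def
  by (intro Omega_diff Omega_scale interior_Omega[OF P] interior_Omega[OF Q] d_Omega assms)

text \<open>Uniqueness half of the Schouten bracket: the degree-0 components on test forms recover
  every coefficient in a frame. In negative degree both fields are zero.\<close>

lemma multivectors_eqI:
  assumes "R \<in> multivectors L k" "R' \<in> multivectors L k"
    and eq: "\<And>\<eta>. \<eta> \<in> \<Omega> \<Longrightarrow> interior R \<eta> = interior R' \<eta>"
  shows "R = R'"
proof
  fix x
  note R = multivectors_exterior[OF assms(1), of x] and R' = multivectors_exterior[OF assms(2), of x]
  show "R x = R' x"
  proof (cases "k < 0")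
    case True
    then show ?thesis using R R' exterior_power_negative[OF True, of "Fib x"] by simp
  next
    case False
    then obtain n where n: "k = int n" using nonneg_int_cases by (metis not_less)
    obtain U \<theta> where U: "(U, \<theta>) \<in> Frm" "x \<in> U" by (rule frame_around)
    obtain T and \<epsilon> :: "'f list \<Rightarrow> 'f list \<Rightarrow> real" where T: "finite T" "\<And>ws. ws \<in> T \<Longrightarrow> length ws = n"
      "\<And>ws. ws \<in> T \<Longrightarrow> \<epsilon> ws \<in> alternating_forms n"
      "\<And>\<omega> us. \<omega> \<in> alternating_forms n \<Longrightarrow> \<omega> us = (\<Sum>ws\<in>T. \<omega> ws * \<epsilon> ws us)"
      using alternating_forms_dual[where n = n] by blast
    have "R x (pull \<theta> x (\<epsilon> ws)) = R' x (pull \<theta> x (\<epsilon> ws))" if ws: "ws \<in> T" for ws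
    proof -
      obtain \<eta> N where \<eta>: "\<eta> \<in> \<Omega>" "x \<in> N"
        "\<And>x R. x \<in> N \<Longrightarrow> R x \<in> exterior_power (Fib x) (int n) \<Longrightarrow> interior R \<eta> x [] = R x (pull \<theta> x (\<epsilon> ws))"
        using pull_test_form[OF U T(3)[OF ws]] by metis
      show ?thesis using \<eta>(3)[OF \<eta>(2), of R] \<eta>(3)[OF \<eta>(2), of R'] eq[OF \<eta>(1)] R R' n by simp
    qed
    then have "(\<Sum>ws\<in>T. R x (pull \<theta> x (\<epsilon> ws)) *\<^sub>R wedge (Fib x) (map (\<theta> x) ws)) =
        (\<Sum>ws\<in>T. R' x (pull \<theta> x (\<epsilon> ws)) *\<^sub>R wedge (Fib x) (map (\<theta> x) ws))"
      by (intro sum.cong) auto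
    then show ?thesis
      using exterior_power_expand[OF U R[unfolded n] T] exterior_power_expand[OF U R'[unfolded n] T] by metis
  qed
qed

lemma schouten_exists:
  assumes P: "P \<in> multivectors L p" and Q: "Q \<in> multivectors L q"
  shows "\<exists>R\<in>multivectors L (p + q - 1). \<forall>\<eta>\<in>\<Omega>. interior R \<eta> = dbl p q (interior P) (interior Q) \<eta>"
proof -
  let ?D = "dbl p q (interior P) (interior Q)" and ?k = "p + q - 1"
  have "\<exists>R\<in>exterior_power (Fib x) ?k. \<forall>\<eta>\<in>\<Omega>. \<forall>vs. ?D \<eta> x vs = R (\<lambda>us. foldr contract us (\<eta> x) vs)" for x
  proof -
    obtain H where "contr ?k H" "\<And>\<eta>. \<eta> \<in> \<Omega> \<Longrightarrow> ?D \<eta> x = H \<eta> x" using dbl_interior_local[OF P Q] by metis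
    then show ?thesis using contr_functional[of ?k H x] by simp
  qed
  \<comment> \<open>The elements are chosen point by point; regularity of the resulting field is a
    separate matter.\<close>
  then obtain R where R: "\<And>x. R x \<in> exterior_power (Fib x) ?k"
    "\<And>x \<eta> vs. \<eta> \<in> \<Omega> \<Longrightarrow> ?D \<eta> x vs = R x (\<lambda>us. foldr contract us (\<eta> x) vs)" by metis
  have int: "interior R \<eta> = ?D \<eta>" if "\<eta> \<in> \<Omega>" for \<eta>
    using R(2)[OF that] by (simp add: interior_def fun_eq_iff)
  have "\<exists>T c. finite T \<and> (\<forall>ws\<in>T. int (length ws) = ?k \<and> msmooth At U (c ws)) \<and>
      (\<forall>x\<in>U. R x = (\<Sum>ws\<in>T. c ws x *\<^sub>R wedge (Fib x) (map (\<theta> x) ws)))" if U: "(U, \<theta>) \<in> Frm" for U \<theta>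
  proof (cases "?k < 0")
    case True
    then have "R x = 0" for x using R(1)[of x] exterior_power_negative[OF True, of "Fib x"] by simp
    then show ?thesis by (intro exI[of _ "{}"]) simp
  next
    case False
    then obtain n where n: "?k = int n" using nonneg_int_cases by (metis not_less)
    obtain T and \<epsilon> :: "'f list \<Rightarrow> 'f list \<Rightarrow> real" where T: "finite T" "\<And>ws. ws \<in> T \<Longrightarrow> length ws = n"
      "\<And>ws. ws \<in> T \<Longrightarrow> \<epsilon> ws \<in> alternating_forms n"
      "\<And>\<omega> us. \<omega> \<in> alternating_forms n \<Longrightarrow> \<omega> us = (\<Sum>ws\<in>T. \<omega> ws * \<epsilon> ws us)"
      using alternating_forms_dual[where n = n] by blast
    \<comment> \<open>Near \<open>x0\<close> the coefficient is the degree-0 component of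
      \<open>?D \<eta>\<close> for a test form \<eta>, and \<open>?D\<close> maps
      \<open>Omega L\<close> to itself.\<close>
    have "msmooth At U (\<lambda>x. R x (pull \<theta> x (\<epsilon> ws)))" if ws: "ws \<in> T" for ws
    proof (rule msmooth_localI[OF frame_open[OF U]])
      fix x0 assume x0: "x0 \<in> U"
      obtain \<eta> N where \<eta>: "\<eta> \<in> \<Omega>" "open N" "x0 \<in> N"
        "\<And>x R. x \<in> N \<Longrightarrow> R x \<in> exterior_power (Fib x) (int n) \<Longrightarrow> interior R \<eta> x [] = R x (pull \<theta> x (\<epsilon> ws))"
        using pull_test_form[OF U x0 T(3)[OF ws]] by metis
      have "eval_form (?D \<eta>) [] \<in> C"
        by (rule eval_form_smooth[OF dbl_Omega[OF P Q \<eta>(1)]]) simp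
      moreover have "R y (pull \<theta> y (\<epsilon> ws)) = eval_form (?D \<eta>) [] y" if "y \<in> N" for y
        using \<eta>(4)[OF that, of R] R(1)[of y] int[OF \<eta>(1)] n by (simp add: eval_form_def)
      ultimately show "\<exists>N g'. open N \<and> x0 \<in> N \<and> msmooth At (U \<inter> N) g' \<and>
          (\<forall>y\<in>U \<inter> N. R y (pull \<theta> y (\<epsilon> ws)) = g' y)"
        using \<eta>(2,3) smooth_functions_msmooth by blast
    qed
    moreover have "R x = (\<Sum>ws\<in>T. R x (pull \<theta> x (\<epsilon> ws)) *\<^sub>R wedge (Fib x) (map (\<theta> x) ws))" if "x \<in> U" for x
      by (rule exterior_power_expand[OF U that R(1)[of x, unfolded n] T])
    ultimately show ?thesis
      using T(1,2) n by (intro exI[of _ T] exI[of _ "\<lambda>ws x. R x (pull \<theta> x (\<epsilon> ws))"]) auto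
  qed
  then have "R \<in> multivectors L ?k" using R(1) by (auto simp: multivectors_def)
  then show ?thesis using int by blast
qed

section \<open>Commutation relations of Lie derivatives by multivector fields\<close>

lemma lie_derivative_apply:
  "lie_derivative L p P \<eta> = (\<lambda>x vs. interior P (d \<eta>) x vs - sg p * d (interior P \<eta>) x vs)"
  by (simp add: lie_derivative_def graded_bracket_def sg_def power_int_minus_one_minus fun_eq_iff)

lemma sg_diff_1: "sg (p - 1) = - sg p"
  using sg_add[of p "-1"] by simp

lemma double_bracket:
  assumes P: "P \<in> multivectors L p" and Q: "Q \<in> multivectors L q" and \<eta>: "\<eta> \<in> \<Omega>"
  shows "graded_bracket (1 - p) (- q) (graded_bracket (- p) 1 (interior P) d) (interior Q) \<eta> =
    dbl p q (interior P) (interior Q) \<eta>"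
proof -
  \<comment> \<open>The integers (1 - p)(- q) and q + p q have the same parity; the latter is the
    exponent in \<open>dbl\<close>.\<close>
  have s: "(-1) powi ((1 - p) * - q) = sg (q + p * q)"
  proof -
    have "sg ((1 - p) * - q) = sg (p * q + - q)" by (simp add: algebra_simps)
    then show ?thesis unfolding sg_def[symmetric] sg_add by simp
  qed
  have "interior Q (\<lambda>x vs. 1 * interior P (d \<eta>) x vs + (- sg p) * d (interior P \<eta>) x vs) =
      (\<lambda>x vs. 1 * interior Q (interior P (d \<eta>)) x vs + (- sg p) * interior Q (d (interior P \<eta>)) x vs)"
    by (intro interior_linear_form[OF Q] interior_Omega[OF P] d_Omega \<eta>)
  moreover have b: "graded_bracket (- p) 1 (interior P) d =
      (\<lambda>\<eta> x vs. interior P (d \<eta>) x vs - sg p * d (interior P \<eta>) x vs)"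
    by (rule ext) (rule lie_derivative_apply[unfolded lie_derivative_def])
  ultimately show ?thesis
    unfolding graded_bracket_def[of "1 - p"] s b by (simp add: dbl_def fun_eq_iff)
qed

lemma schouten_bracket_spec:
  assumes P: "P \<in> multivectors L p" and Q: "Q \<in> multivectors L q"
  shows "schouten_bracket L p P q Q \<in> multivectors L (p + q - 1) \<and>
    (\<forall>\<eta>\<in>\<Omega>. interior (schouten_bracket L p P q Q) \<eta> = dbl p q (interior P) (interior Q) \<eta>)"
proof -
  let ?S = "\<lambda>R. R \<in> multivectors L (p + q - 1) \<and> (\<forall>\<eta>\<in>\<Omega>. interior R \<eta> = dbl p q (interior P) (interior Q) \<eta>)"
  have "\<exists>!R. ?S R"
    using schouten_exists[OF P Q] by (auto intro!: multivectors_eqI)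
  then have "?S (THE R. ?S R)" by (rule theI')
  moreover have "schouten_bracket L p P q Q = (THE R. ?S R)"
    unfolding schouten_bracket_def by (simp add: double_bracket[OF P Q] cong: conj_cong)
  ultimately show ?thesis by simp
qed

text \<open>Since d d = 0, only d i(P) d survives on either side.\<close>

lemma lie_derivative_d:
  assumes P: "P \<in> multivectors L p" and \<eta>: "\<eta> \<in> \<Omega>"
  shows "lie_derivative L p P (d \<eta>) = (\<lambda>x vs. - sg p * d (lie_derivative L p P \<eta>) x vs)"
proof -
  have "interior P (d (d \<eta>)) = (\<lambda>x vs. 0)"
    using interior_scale_form[OF P Omega_zero, of 0] by (simp add: d_d[OF \<eta>])
  then have 1: "lie_derivative L p P (d \<eta>) = (\<lambda>x vs. - sg p * d (interior P (d \<eta>)) x vs)"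
    by (simp add: lie_derivative_apply)
  have "d (\<lambda>x vs. 1 * interior P (d \<eta>) x vs + (- sg p) * d (interior P \<eta>) x vs) =
      (\<lambda>x vs. 1 * d (interior P (d \<eta>)) x vs + (- sg p) * d (d (interior P \<eta>)) x vs)"
    by (intro d_linear interior_Omega[OF P] d_Omega \<eta>)
  then have "d (lie_derivative L p P \<eta>) = d (interior P (d \<eta>))"
    by (simp add: lie_derivative_apply d_d[OF interior_Omega[OF P \<eta>]])
  then show ?thesis using 1 by simp
qed

lemma lie_derivative_Omega: "P \<in> multivectors L p \<Longrightarrow> \<eta> \<in> \<Omega> \<Longrightarrow> lie_derivative L p P \<eta> \<in> \<Omega>"
  unfolding lie_derivative_apply by (intro Omega_diff Omega_scale interior_Omega d_Omega)

lemma lie_derivative_diff: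
  assumes P: "P \<in> multivectors L p" and "\<eta> \<in> \<Omega>" "\<zeta> \<in> \<Omega>"
  shows "lie_derivative L p P (\<lambda>x vs. \<eta> x vs - a * \<zeta> x vs) =
    (\<lambda>x vs. lie_derivative L p P \<eta> x vs - a * lie_derivative L p P \<zeta> x vs)"
proof -
  have "d (\<lambda>x vs. 1 * \<eta> x vs + (- a) * \<zeta> x vs) = (\<lambda>x vs. 1 * d \<eta> x vs + (- a) * d \<zeta> x vs)"
    by (rule d_linear[OF assms(2,3)])
  moreover have "interior P (\<lambda>x vs. 1 * d \<eta> x vs + (- a) * d \<zeta> x vs) =
      (\<lambda>x vs. 1 * interior P (d \<eta>) x vs + (- a) * interior P (d \<zeta>) x vs)"
    by (intro interior_linear_form[OF P] d_Omega assms)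
  moreover have "interior P (\<lambda>x vs. 1 * \<eta> x vs + (- a) * \<zeta> x vs) =
      (\<lambda>x vs. 1 * interior P \<eta> x vs + (- a) * interior P \<zeta> x vs)"
    by (intro interior_linear_form[OF P] assms)
  moreover have "d (\<lambda>x vs. 1 * interior P \<eta> x vs + (- a) * interior P \<zeta> x vs) =
      (\<lambda>x vs. 1 * d (interior P \<eta>) x vs + (- a) * d (interior P \<zeta>) x vs)"
    by (intro d_linear interior_Omega[OF P] assms)
  ultimately show ?thesis by (simp add: lie_derivative_apply algebra_simps)
qed

lemma schouten_interior:
  assumes P: "P \<in> multivectors L p" and Q: "Q \<in> multivectors L q" and \<eta>: "\<eta> \<in> \<Omega>"
  shows "interior (schouten_bracket L p P q Q) \<eta> = (\<lambda>x vs. lie_derivative L p P (interior Q \<eta>) x vs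
    - sg (q + p * q) * interior Q (lie_derivative L p P \<eta>) x vs)"
proof -
  have "interior Q (\<lambda>x vs. 1 * interior P (d \<eta>) x vs + (- sg p) * d (interior P \<eta>) x vs) =
      (\<lambda>x vs. 1 * interior Q (interior P (d \<eta>)) x vs + (- sg p) * interior Q (d (interior P \<eta>)) x vs)"
    by (intro interior_linear_form[OF Q] interior_Omega[OF P] d_Omega \<eta>)
  then show ?thesis
    using schouten_bracket_spec[OF P Q] \<eta> by (simp add: lie_derivative_apply dbl_def)
qed

text \<open>The graded Jacobi identity for \<open>[L(P), [i(Q), d]]\<close>, together with \<open>[L(P), d] = 0\<close>.\<close>

lemma lie_derivative_commutator:
  assumes P: "P \<in> multivectors L p" and Q: "Q \<in> multivectors L q" and \<eta>: "\<eta> \<in> \<Omega>"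
  shows "lie_derivative L (p + q - 1) (schouten_bracket L p P q Q) \<eta> =
    (\<lambda>x vs. lie_derivative L p P (lie_derivative L q Q \<eta>) x vs
      - sg ((p - 1) * (q - 1)) * lie_derivative L q Q (lie_derivative L p P \<eta>) x vs)"
proof -
  let ?P = "lie_derivative L p P" and ?s = "sg (q + p * q)"
  have s: "sg (p + q - 1) = - (sg p * sg q)" "sg ((p - 1) * (q - 1)) = - (?s * sg p)"
  proof -
    show "sg (p + q - 1) = - (sg p * sg q)" by (simp add: sg_diff_1 sg_add)
    have "(p - 1) * (q - 1) = p * q + (- p + (- q + 1))" by (simp add: algebra_simps)
    then have "sg ((p - 1) * (q - 1)) = sg (p * q) * (sg (- p) * (sg (- q) * sg 1))"
      by (simp only: sg_add)
    then show "sg ((p - 1) * (q - 1)) = - (?s * sg p)" by (simp add: sg_add)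
  qed
  note \<Omega> = interior_Omega[OF P] interior_Omega[OF Q] d_Omega lie_derivative_Omega[OF P] \<eta>
  \<comment> \<open>Moving L(P) across \<open>d\<close> turns both sides into combinations of L(P)
    i(Q) d, i(Q) d L(P), d L(P) i(Q) and d i(Q) L(P); the signs then match term by term.\<close>
  have "interior Q (?P (d \<eta>)) = (\<lambda>x vs. - sg p * interior Q (d (?P \<eta>)) x vs)"
    unfolding lie_derivative_d[OF P \<eta>] by (intro interior_scale_form[OF Q] \<Omega>)
  then have 1: "interior (schouten_bracket L p P q Q) (d \<eta>) =
      (\<lambda>x vs. ?P (interior Q (d \<eta>)) x vs + ?s * sg p * interior Q (d (?P \<eta>)) x vs)"
    using schouten_interior[OF P Q d_Omega[OF \<eta>]] by (simp add: mult.assoc)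
  have 2: "d (interior (schouten_bracket L p P q Q) \<eta>) =
      (\<lambda>x vs. 1 * d (?P (interior Q \<eta>)) x vs + (- ?s) * d (interior Q (?P \<eta>)) x vs)"
  proof -
    have "d (\<lambda>x vs. 1 * ?P (interior Q \<eta>) x vs + (- ?s) * interior Q (?P \<eta>) x vs) =
        (\<lambda>x vs. 1 * d (?P (interior Q \<eta>)) x vs + (- ?s) * d (interior Q (?P \<eta>)) x vs)"
      by (intro d_linear \<Omega>)
    then show ?thesis using schouten_interior[OF P Q \<eta>] by simp
  qed
  have 3: "?P (lie_derivative L q Q \<eta>) =
      (\<lambda>x vs. ?P (interior Q (d \<eta>)) x vs + sg q * sg p * d (?P (interior Q \<eta>)) x vs)"
    unfolding lie_derivative_apply[of q Q]
    by (subst lie_derivative_diff[OF P]) (simp_all add: \<Omega> lie_derivative_d[OF P] mult.assoc)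
  show ?thesis
    unfolding 3 lie_derivative_apply[of "p + q - 1"] lie_derivative_apply[of q Q "?P \<eta>"] 1 2 s
    by (simp add: fun_eq_iff algebra_simps)
qed

end

theorem proposition4p4p8:
  fixes L :: "('m::{t2_space, second_countable_topology}, 'b::{real_inner, heine_borel},
      'v::real_vector, 'f::{real_inner, heine_borel}) algebroid"
    and p q :: int
    and P Q :: "'m \<Rightarrow> ('v list \<Rightarrow> real) \<Rightarrow> real"
  assumes "lie_algebroid L"
    and "P \<in> multivectors L p"
    and "Q \<in> multivectors L q"
  shows "(\<forall>\<eta>\<in>Omega L.
      graded_bracket (1 - p) 1 (lie_derivative L p P) (exterior_derivative L) \<eta> =
        lie_derivative L p P (exterior_derivative L \<eta>)
          - ((-1) powi (p - 1)) *\<^sub>R exterior_derivative L (lie_derivative L p P \<eta>) \<and>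
      lie_derivative L p P (exterior_derivative L \<eta>)
          - ((-1) powi (p - 1)) *\<^sub>R exterior_derivative L (lie_derivative L p P \<eta>) = 0) \<and>
    (\<forall>\<eta>\<in>Omega L.
      graded_bracket (1 - p) (1 - q) (lie_derivative L p P) (lie_derivative L q Q) \<eta> =
        lie_derivative L p P (lie_derivative L q Q \<eta>)
          - ((-1) powi ((p - 1) * (q - 1))) *\<^sub>R lie_derivative L q Q (lie_derivative L p P \<eta>) \<and>
      lie_derivative L p P (lie_derivative L q Q \<eta>)
          - ((-1) powi ((p - 1) * (q - 1))) *\<^sub>R lie_derivative L q Q (lie_derivative L p P \<eta>) =
        lie_derivative L (p + q - 1) (schouten_bracket L p P q Q) \<eta>)"
proof -
  interpret algebroid_context L by unfold_locales (rule assms(1))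
  have "(1 - p) * (1 - q) = (p - 1) * (q - 1)" by (simp add: algebra_simps)
  moreover have "(-1 :: real) powi (1 - p) = (-1) powi (p - 1)"
    by (rule power_int_minus_one_diff_commute)
  ultimately have bracket:
    "graded_bracket (1 - p) 1 F G \<eta> = F (G \<eta>) - ((-1) powi (p - 1)) *\<^sub>R G (F \<eta>)"
    "graded_bracket (1 - p) (1 - q) F G \<eta> = F (G \<eta>) - ((-1) powi ((p - 1) * (q - 1))) *\<^sub>R G (F \<eta>)"
    for F G :: "('m \<Rightarrow> 'v list \<Rightarrow> real) \<Rightarrow> ('m \<Rightarrow> 'v list \<Rightarrow> real)" and \<eta>
    by (simp_all add: graded_bracket_def)
  show ?thesis
    unfolding bracket sg_def[symmetric]
  proof (intro conjI ballI refl)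
    fix \<eta> assume \<eta>: "\<eta> \<in> \<Omega>"
    show "lie_derivative L p P (d \<eta>) - sg (p - 1) *\<^sub>R d (lie_derivative L p P \<eta>) = 0"
      unfolding lie_derivative_d[OF assms(2) \<eta>] by (simp add: fun_eq_iff sg_diff_1)
    show "lie_derivative L p P (lie_derivative L q Q \<eta>)
        - sg ((p - 1) * (q - 1)) *\<^sub>R lie_derivative L q Q (lie_derivative L p P \<eta>) =
        lie_derivative L (p + q - 1) (schouten_bracket L p P q Q) \<eta>"
      unfolding lie_derivative_commutator[OF assms(2,3) \<eta>] by (simp add: fun_eq_iff)
  qed
qed

end
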